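(* For any linear operator $V$ acting on $\Lambda$ and any $P\in\Lambda$ set $$\widetilde{V}^q P[X] \;=\; V^Y P[qX+(1-q)Y]\,\Big|_{Y=X},$$ where $V^Y$ is $V$ acting on symmetric functions in the $Y$ variables (the $X$ variables being treated as scalars). If $G_k=G_k(X;t)$ is any linear operator on $\Lambda$ with the property that $$G_k\, H_\mu[X;t] \;=\; H_{\mu+1^k}[X;t]\qquad\text{for all partitions } \mu \text{ of length } \le k,$$ then $\widetilde{G_k}^q$ has the property $$\widetilde{G_k}^q\, H_\mu[X;q,t] \;=\; H_{\mu+1^k}[X;q,t]\qquad\text{for all partitions } \mu \text{ of length } \le k.$$ In particular (given such an operator $G_k$ for each $k\ge 1$), for every partition $\mu$ with conjugate $\mu'=(\mu_1',\mu_2',\ldots,\mu_h')$, $$H_\mu[X;q,t] \;=\; \widetilde{G_{\mu_1'}}^q\,\widetilde{G_{\mu_2'}}^q\cdots \widetilde{G_{\mu_h'}}^q\,\mathbf{1}.$$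
   Context: $\Lambda$ is the algebra of symmetric functions in an alphabet $X=\{x_1,x_2,\ldots\}$ with coefficients in $\mathbb{Q}(q,t)$; linear means $\mathbb{Q}(q,t)$-linear. An operator written $V(X;t)$ does not involve $q$. Plethysm: if $F=Q(p_1,p_2,\ldots)\in\Lambda$ is expressed in power sums and $E=E(t_1,t_2,\ldots)$ is a formal series in variables (which may include $q,t$), then $F[E]=Q(p_1,p_2,\ldots)|_{p_r\to E(t_1^r,t_2^r,\ldots)}$. Inside brackets $X$ stands for $x_1+x_2+\cdots$. For instance $P[qX+(1-q)Y]$ is obtained by $p_r\mapsto q^r p_r[X]+(1-q^r)p_r[Y]$, and $P[X/(1-t)]$ by $p_r\mapsto p_r[X]/(1-t^r)$. Macdonald's integral form is $J_\lambda(x;q,t)=h_\lambda(q,t)P_\lambda(x;q,t)$, where $P_\lambda(x;q,t)$ is the (monic) Macdonald polynomial in Macdonald's standard normalization, and $h_\lambda(q,t)=\prod_{s\in\lambda}(1-q^{a_\lambda(s)}t^{l_\lambda(s)+1})$ with $a_\lambda(s)$, $l_\lambda(s)$ the arm and leg of the cell $s$ in the diagram of $\lambda$. The modified polynomials are $$H_\mu[X;q,t]=J_\mu\big[\tfrac{X}{1-t};q,t\big]=\sum_\lambda S_\lambda[X]K_{\lambda\mu}(q,t),\qquad H_\mu[X;t]=H_\mu[X;0,t]=Q_\mu\big[\tfrac{X}{1-t};t\big]=\sum_\lambda S_\lambda[X]K_{\lambda\mu}(t),$$ where $S_\lambda$ are Schur functions, $Q_\mu[X;t]=J_\mu[X;0,t]$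 is the Hall–Littlewood polynomial, $K_{\lambda\mu}(q,t)$ are the Macdonald $q,t$-Kostka coefficients and $K_{\lambda\mu}(t)=K_{\lambda\mu}(0,t)$ the Kostka–Foulkes polynomials. For a partition $\mu$ of length $\le k$, $\mu+1^k=(\mu_1+1,\ldots,\mu_k+1)$ (with $\mu_i=0$ for $i>l(\mu)$), i.e. the partition obtained by prepending a column of length $k$ to the diagram of $\mu$. *)

theory Defs
  imports
    "HOL-Library.Poly_Mapping"
    "HOL-Library.Multiset"
    "HOL-Computational_Algebra.Polynomial"
    "HOL-Computational_Algebra.Fraction_Field"
    "HOL-Computational_Algebra.Polynomial_Factorial"
begin

section \<open>Symmetric functions over a commutative ring\<close>

text \<open>
  A monomial in the alphabet \<open>x\<^sub>0, x\<^sub>1, \<dots>\<close> is its finitely supported exponent vector.  A symmetric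
  function is a formal power series of bounded degree that is invariant under all permutations of
  the variables; the monomials have finite support, so it makes no difference whether infinitary
  permutations are admitted.
\<close>

type_synonym mon = "nat \<Rightarrow>\<^sub>0 nat"

definition mdeg :: "mon \<Rightarrow> nat" where
  "mdeg m = sum (Poly_Mapping.lookup m) (Poly_Mapping.keys m)"

definition bounded_degree :: "(mon \<Rightarrow> 'a::zero) \<Rightarrow> bool" where
  "bounded_degree f \<longleftrightarrow> (\<exists>d. \<forall>m. f m \<noteq> 0 \<longrightarrow> mdeg m \<le> d)"

definition perm_invariant :: "(mon \<Rightarrow> 'a) \<Rightarrow> bool" where
  "perm_invariant f \<longleftrightarrow> (\<forall>\<pi> m. bij \<pi> \<longrightarrow> f (Poly_Mapping.map_key \<pi> m) = f m)"

lemma mdeg_0 [simp]: "mdeg 0 = 0"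
  by (simp add: mdeg_def)

lemma mdeg_superset:
  "finite A \<Longrightarrow> Poly_Mapping.keys m \<subseteq> A \<Longrightarrow> mdeg m = sum (Poly_Mapping.lookup m) A"
  unfolding mdeg_def by (rule sum.mono_neutral_left) (auto simp: in_keys_iff)

lemma mdeg_add [simp]: "mdeg (a + b) = mdeg a + mdeg b"
proof -
  let ?A = "Poly_Mapping.keys a \<union> Poly_Mapping.keys b"
  have "mdeg (a + b) = sum (Poly_Mapping.lookup (a + b)) ?A"
    using keys_add[of a b] by (intro mdeg_superset) auto
  also have "\<dots> = sum (Poly_Mapping.lookup a) ?A + sum (Poly_Mapping.lookup b) ?A"
    by (simp add: lookup_add sum.distrib)
  also have "\<dots> = mdeg a + mdeg b"
    by (simp add: mdeg_superset[of ?A a] mdeg_superset[of ?A b])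
  finally show ?thesis .
qed

lemma mdeg_single [simp]: "mdeg (Poly_Mapping.single i r) = r"
  by (simp add: mdeg_def)

lemma map_key_inv:
  fixes \<pi> :: "nat \<Rightarrow> nat"
  assumes "bij \<pi>"
  shows "Poly_Mapping.map_key \<pi> (Poly_Mapping.map_key (inv \<pi>) m) = m"
    and "Poly_Mapping.map_key (inv \<pi>) (Poly_Mapping.map_key \<pi> m) = m"
proof -
  have i: "inj \<pi>" "inj (inv \<pi>)" using assms by (simp_all add: bij_is_inj bij_imp_bij_inv)
  show "Poly_Mapping.map_key \<pi> (Poly_Mapping.map_key (inv \<pi>) m) = m"
    by (rule poly_mapping_eqI) (simp add: map_key.rep_eq i assms bij_is_inj inv_f_f)
  show "Poly_Mapping.map_key (inv \<pi>) (Poly_Mapping.map_key \<pi> m) = m"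
    by (rule poly_mapping_eqI)
      (simp add: map_key.rep_eq i assms bij_is_surj surj_f_inv_f)
qed

lemma map_key_single_bij:
  fixes \<pi> :: "nat \<Rightarrow> nat"
  assumes "bij \<pi>"
  shows "Poly_Mapping.map_key \<pi> (Poly_Mapping.single i r) = Poly_Mapping.single (inv \<pi> i) r"
  using map_key_single[OF bij_is_inj[OF assms], of "inv \<pi> i" r] assms
  by (simp add: bij_is_surj surj_f_inv_f)

lemma map_key_eq_0_iff:
  fixes \<pi> :: "nat \<Rightarrow> nat"
  assumes "bij \<pi>"
  shows "Poly_Mapping.map_key \<pi> m = 0 \<longleftrightarrow> m = 0"
proof
  assume "Poly_Mapping.map_key \<pi> m = 0"
  then have "Poly_Mapping.map_key (inv \<pi>) (Poly_Mapping.map_key \<pi> m) = 0"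
    using bij_imp_bij_inv[OF assms] by (simp add: bij_is_inj)
  then show "m = 0" by (simp add: map_key_inv(2)[OF assms])
qed (use assms in \<open>simp add: bij_is_inj\<close>)

typedef (overloaded) 'a symfun =
  "{f :: mon \<Rightarrow> 'a::zero. bounded_degree f \<and> perm_invariant f}"
  morphisms scoeff Abs_symfun
  by (rule exI[of _ "\<lambda>_. 0"]) (simp add: bounded_degree_def perm_invariant_def)

setup_lifting type_definition_symfun

lemma symfun_eqI: "(\<And>m. scoeff F m = scoeff G m) \<Longrightarrow> F = G"
  by (simp add: scoeff_inject[symmetric] fun_eq_iff)

definition splits :: "mon \<Rightarrow> (mon \<times> mon) set" where
  "splits m = {(a, b). a + b = m}"

lemma finite_splits [simp]: "finite (splits m)"
proof -
  let ?K = "Poly_Mapping.keys m"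
  let ?M = "\<Union>i\<in>?K. {..Poly_Mapping.lookup m i}"
  let ?F = "{f. (\<forall>i. (i \<in> ?K \<longrightarrow> f i \<in> ?M) \<and> (i \<notin> ?K \<longrightarrow> f i = (0::nat)))}"
  let ?S = "{a :: mon. Poly_Mapping.lookup a \<in> ?F}"
  have "finite ?F"
    by (rule finite_set_of_finite_funs) auto
  then have S: "finite ?S"
    by (rule finite_vimageI[where h = Poly_Mapping.lookup, unfolded vimage_def])
      (simp add: inj_on_def)
  have fst_in: "a \<in> ?S" if "a + b = m" for a b
  proof -
    have *: "Poly_Mapping.lookup a i \<le> Poly_Mapping.lookup m i" for i
      using that by (auto simp: lookup_add)
    have "Poly_Mapping.lookup a i \<in> ?M" if "i \<in> ?K" for i
      using that * by auto
    moreover have "Poly_Mapping.lookup a i = 0" if "i \<notin> ?K" for i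
      using that *[of i] by (simp add: in_keys_iff)
    ultimately show ?thesis by simp
  qed
  have "splits m \<subseteq> ?S \<times> ?S"
  proof
    fix x assume "x \<in> splits m"
    then obtain a b where x: "x = (a, b)" and ab: "a + b = m"
      by (cases x) (simp add: splits_def)
    from ab have "b + a = m" by (simp add: add.commute)
    with ab show "x \<in> ?S \<times> ?S"
      unfolding x by (intro SigmaI fst_in)
  qed
  then show ?thesis
    by (rule finite_subset[OF _ finite_cartesian_product[OF S S]])
qed

instantiation symfun :: (comm_ring_1) comm_ring_1
begin

lift_definition zero_symfun :: "'a symfun" is "\<lambda>_. 0"
  by (simp add: bounded_degree_def perm_invariant_def)

lift_definition one_symfun :: "'a symfun" is "\<lambda>m. if m = 0 then 1 else 0"
  by (simp add: bounded_degree_def perm_invariant_def map_key_eq_0_iff)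

lift_definition uminus_symfun :: "'a symfun \<Rightarrow> 'a symfun" is "\<lambda>f m. - f m"
  by (simp add: bounded_degree_def perm_invariant_def)

lift_definition plus_symfun :: "'a symfun \<Rightarrow> 'a symfun \<Rightarrow> 'a symfun" is "\<lambda>f g m. f m + g m"
proof (goal_cases)
  case (1 f g)
  then obtain d e where "\<forall>m. f m \<noteq> 0 \<longrightarrow> mdeg m \<le> d" "\<forall>m. g m \<noteq> 0 \<longrightarrow> mdeg m \<le> e"
    by (auto simp: bounded_degree_def)
  then have "\<forall>m. f m + g m \<noteq> 0 \<longrightarrow> mdeg m \<le> max d e"
    by (metis add_0 max.coboundedI1 max.coboundedI2)
  then have "bounded_degree (\<lambda>m. f m + g m)"
    unfolding bounded_degree_def by blast
  with 1 show ?case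
    by (simp add: perm_invariant_def)
qed

lift_definition minus_symfun :: "'a symfun \<Rightarrow> 'a symfun \<Rightarrow> 'a symfun" is "\<lambda>f g m. f m - g m"
proof (goal_cases)
  case (1 f g)
  then obtain d e where "\<forall>m. f m \<noteq> 0 \<longrightarrow> mdeg m \<le> d" "\<forall>m. g m \<noteq> 0 \<longrightarrow> mdeg m \<le> e"
    by (auto simp: bounded_degree_def)
  then have "\<forall>m. f m - g m \<noteq> 0 \<longrightarrow> mdeg m \<le> max d e"
    by (metis diff_0_right max.coboundedI1 max.coboundedI2)
  then have "bounded_degree (\<lambda>m. f m - g m)"
    unfolding bounded_degree_def by blast
  with 1 show ?case
    by (simp add: perm_invariant_def)
qed

lift_definition times_symfun :: "'a symfun \<Rightarrow> 'a symfun \<Rightarrow> 'a symfun" is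
  "\<lambda>f g m. \<Sum>(a, b)\<in>splits m. f a * g b"
proof (goal_cases)
  case (1 f g)
  then obtain d e where de: "\<And>m. f m \<noteq> 0 \<Longrightarrow> mdeg m \<le> d" "\<And>m. g m \<noteq> 0 \<Longrightarrow> mdeg m \<le> e"
    by (auto simp: bounded_degree_def)
  have "mdeg m \<le> d + e" if nz: "(\<Sum>(a, b)\<in>splits m. f a * g b) \<noteq> 0" for m
  proof -
    obtain x where x: "x \<in> splits m" "(case x of (a, b) \<Rightarrow> f a * g b) \<noteq> 0"
      using nz by (meson sum.neutral)
    obtain a b where ab: "x = (a, b)" by (cases x)
    with x have "a + b = m" "f a \<noteq> 0" "g b \<noteq> 0" by (auto simp: splits_def)
    then show ?thesis using de(1)[of a] de(2)[of b] by auto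
  qed
  moreover have "(\<Sum>(a, b)\<in>splits (Poly_Mapping.map_key \<pi> m). f a * g b)
      = (\<Sum>(a, b)\<in>splits m. f a * g b)" if "bij \<pi>" for \<pi> m
  proof -
    have i: "inj \<pi>" "inj (inv \<pi>)" using that by (simp_all add: bij_is_inj bij_imp_bij_inv)
    have inv: "f (Poly_Mapping.map_key (inv \<pi>) a) = f a" "g (Poly_Mapping.map_key (inv \<pi>) a) = g a" for a
      using 1 bij_imp_bij_inv[OF that] by (auto simp: perm_invariant_def)
    have split: "a + b = Poly_Mapping.map_key \<pi> m \<longleftrightarrow>
        Poly_Mapping.map_key (inv \<pi>) a + Poly_Mapping.map_key (inv \<pi>) b = m" for a b
      by (metis i map_key_plus map_key_inv[OF that])
    show ?thesis
      by (rule sum.reindex_bij_witness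
          [where i = "\<lambda>(a, b). (Poly_Mapping.map_key \<pi> a, Poly_Mapping.map_key \<pi> b)"
             and j = "\<lambda>(a, b). (Poly_Mapping.map_key (inv \<pi>) a, Poly_Mapping.map_key (inv \<pi>) b)"])
        (auto simp: splits_def split inv map_key_inv[OF that])
  qed
  ultimately show ?case
    unfolding bounded_degree_def perm_invariant_def by blast
qed

instance
proof
  fix F G H :: "'a symfun"
  show "F * G * H = F * (G * H)"
  proof (rule symfun_eqI)
    fix m
    have "scoeff (F * G * H) m =
        (\<Sum>((a, c), (x, y))\<in>Sigma (splits m) (\<lambda>(a, c). splits a).
           scoeff F x * scoeff G y * scoeff H c)"
      by (simp add: times_symfun.rep_eq sum_distrib_right sum.Sigma split_def)
    also have "\<dots> =
        (\<Sum>((x, d), (y, c))\<in>Sigma (splits m) (\<lambda>(x, d). splits d).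
           scoeff F x * (scoeff G y * scoeff H c))"
      by (rule sum.reindex_bij_witness
          [where i = "\<lambda>((x, d), (y, c)). ((x + y, c), (x, y))"
             and j = "\<lambda>((a, c), (x, y)). ((x, y + c), (y, c))"])
        (auto simp: splits_def ac_simps)
    also have "\<dots> = scoeff (F * (G * H)) m"
      by (simp add: times_symfun.rep_eq sum_distrib_left sum.Sigma split_def)
    finally show "scoeff (F * G * H) m = scoeff (F * (G * H)) m" .
  qed
  show "F * G = G * F"
  proof (rule symfun_eqI)
    fix m
    show "scoeff (F * G) m = scoeff (G * F) m"
      unfolding times_symfun.rep_eq
      by (rule sum.reindex_bij_witness[where i = "\<lambda>(a, b). (b, a)" and j = "\<lambda>(a, b). (b, a)"])
        (auto simp: splits_def ac_simps)
  qed
  show "1 * F = F"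
  proof (rule symfun_eqI)
    fix m
    have "scoeff (1 * F) m = (\<Sum>x\<in>splits m. if x = (0, m) then scoeff F m else 0)"
      unfolding times_symfun.rep_eq one_symfun.rep_eq
      by (rule sum.cong) (auto simp: splits_def split: if_splits)
    also have "\<dots> = scoeff F m"
      by (subst sum.delta[OF finite_splits]) (simp add: splits_def)
    finally show "scoeff (1 * F) m = scoeff F m" .
  qed
  show "(F + G) * H = F * H + G * H"
    by (rule symfun_eqI)
      (simp add: times_symfun.rep_eq plus_symfun.rep_eq distrib_right sum.distrib split_def)
  show "(0 :: 'a symfun) \<noteq> 1"
  proof
    assume "(0 :: 'a symfun) = 1"
    then have "scoeff (0 :: 'a symfun) 0 = scoeff 1 0" by simp
    then show False by (simp add: zero_symfun.rep_eq one_symfun.rep_eq)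
  qed
  show "F + G + H = F + (G + H)"
    by (rule symfun_eqI) (simp add: plus_symfun.rep_eq add.assoc)
  show "F + G = G + F"
    by (rule symfun_eqI) (simp add: plus_symfun.rep_eq add.commute)
  show "0 + F = F"
    by (rule symfun_eqI) (simp add: plus_symfun.rep_eq zero_symfun.rep_eq)
  show "- F + F = 0"
    by (rule symfun_eqI) (simp add: plus_symfun.rep_eq zero_symfun.rep_eq uminus_symfun.rep_eq)
  show "F - G = F + - G"
    by (rule symfun_eqI) (simp add: plus_symfun.rep_eq minus_symfun.rep_eq uminus_symfun.rep_eq)
qed

end

lift_definition sconst :: "'a \<Rightarrow> 'a::zero symfun" is "\<lambda>c m. if m = 0 then c else 0"
  by (simp add: bounded_degree_def perm_invariant_def map_key_eq_0_iff)

lift_definition sscale :: "'a \<Rightarrow> 'a symfun \<Rightarrow> 'a::comm_ring_1 symfun" is "\<lambda>c f m. c * f m"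
proof (goal_cases)
  case (1 c f)
  then obtain d where "\<forall>m. f m \<noteq> 0 \<longrightarrow> mdeg m \<le> d" by (auto simp: bounded_degree_def)
  then have "\<forall>m. c * f m \<noteq> 0 \<longrightarrow> mdeg m \<le> d" by force
  then have "bounded_degree (\<lambda>m. c * f m)"
    unfolding bounded_degree_def by blast
  with 1 show ?case
    by (simp add: perm_invariant_def)
qed

lemma sscale_eq_sconst_mult: "sscale c F = sconst c * F"
proof (rule symfun_eqI)
  fix m
  have "scoeff (sconst c * F) m = (\<Sum>x\<in>splits m. if x = (0, m) then c * scoeff F m else 0)"
    unfolding times_symfun.rep_eq sconst.rep_eq
    by (rule sum.cong) (auto simp: splits_def split: if_splits)
  also have "\<dots> = c * scoeff F m"
    by (subst sum.delta[OF finite_splits]) (simp add: splits_def)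
  finally show "scoeff (sscale c F) m = scoeff (sconst c * F) m"
    by (simp add: sscale.rep_eq)
qed

global_interpretation symfun: vector_space "sscale :: 'a::field \<Rightarrow> 'a symfun \<Rightarrow> 'a symfun"
  by standard (rule symfun_eqI; simp add: sscale.rep_eq plus_symfun.rep_eq algebra_simps)+

text \<open>Change of coefficients; meaningful when \<open>f 0 = 0\<close>.\<close>

definition map_coeffs :: "('a::zero \<Rightarrow> 'b::zero) \<Rightarrow> 'a symfun \<Rightarrow> 'b symfun" where
  "map_coeffs f F = Abs_symfun (\<lambda>m. f (scoeff F m))"

lemma scoeff_map_coeffs:
  assumes "f 0 = 0"
  shows "scoeff (map_coeffs f F) m = f (scoeff F m)"
proof -
  have "(\<lambda>m. f (scoeff F m)) \<in> {g. bounded_degree g \<and> perm_invariant g}"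
  proof -
    obtain d where "\<forall>m. scoeff F m \<noteq> 0 \<longrightarrow> mdeg m \<le> d"
      using scoeff[of F] by (auto simp: bounded_degree_def)
    then have "\<forall>m. f (scoeff F m) \<noteq> 0 \<longrightarrow> mdeg m \<le> d" using assms by force
    then have "bounded_degree (\<lambda>m. f (scoeff F m))"
      unfolding bounded_degree_def by blast
    then show ?thesis
      using scoeff[of F] by (simp add: perm_invariant_def)
  qed
  then show ?thesis
    by (simp add: map_coeffs_def Abs_symfun_inverse)
qed


section \<open>Partitions\<close>

definition is_partition :: "nat list \<Rightarrow> bool" where
  "is_partition \<nu> \<longleftrightarrow> sorted_wrt (\<ge>) \<nu> \<and> 0 \<notin> set \<nu>"

definition nth_part :: "nat list \<Rightarrow> nat \<Rightarrow> nat" where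
  "nth_part \<nu> i = (if i < length \<nu> then \<nu> ! i else 0)"

definition col_length :: "nat list \<Rightarrow> nat \<Rightarrow> nat" where
  "col_length \<nu> j = card {i. i < length \<nu> \<and> j < \<nu> ! i}"

definition conj_partition :: "nat list \<Rightarrow> nat list" where
  "conj_partition \<nu> = map (col_length \<nu>) [0..<nth_part \<nu> 0]"

definition add_column :: "nat \<Rightarrow> nat list \<Rightarrow> nat list" where
  "add_column k \<mu> = map (\<lambda>i. nth_part \<mu> i + 1) [0..<k]"

definition cells :: "nat list \<Rightarrow> (nat \<times> nat) set" where
  "cells \<nu> = {(i, j). i < length \<nu> \<and> j < \<nu> ! i}"

definition arm_length :: "nat list \<Rightarrow> nat \<times> nat \<Rightarrow> nat" where
  "arm_length \<nu> = (\<lambda>(i, j). nth_part \<nu> i - j - 1)"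

definition leg_length :: "nat list \<Rightarrow> nat \<times> nat \<Rightarrow> nat" where
  "leg_length \<nu> = (\<lambda>(i, j). col_length \<nu> j - i - 1)"

text \<open>Strict dominance order.\<close>

definition dominated :: "nat list \<Rightarrow> nat list \<Rightarrow> bool" where
  "dominated \<mu> \<nu> \<longleftrightarrow> \<mu> \<noteq> \<nu> \<and> sum_list \<mu> = sum_list \<nu> \<and>
     (\<forall>k. sum_list (take k \<mu>) \<le> sum_list (take k \<nu>))"

text \<open>The integer \<open>z\<^sub>\<nu>\<close>, the order of the centraliser of a permutation of cycle type \<open>\<nu>\<close>.\<close>

definition zee :: "nat list \<Rightarrow> nat" where
  "zee \<nu> = (\<Prod>i\<in>set \<nu>. i ^ count_list \<nu> i * fact (count_list \<nu> i))"


section \<open>Monomial and power sum symmetric functions\<close>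

definition exponents :: "mon \<Rightarrow> nat multiset" where
  "exponents m = image_mset (Poly_Mapping.lookup m) (mset_set (Poly_Mapping.keys m))"

lemma sum_mset_exponents: "\<Sum>\<^sub># (exponents m) = mdeg m"
  by (simp add: exponents_def mdeg_def sum_unfold_sum_mset)

lemma exponents_map_key:
  assumes "bij \<pi>"
  shows "exponents (Poly_Mapping.map_key \<pi> m) = exponents m"
proof -
  have i: "inj \<pi>" by (rule bij_is_inj[OF assms])
  have "\<pi> ` (\<pi> -` Poly_Mapping.keys m) = Poly_Mapping.keys m"
    by (simp add: assms bij_is_surj surj_image_vimage_eq)
  then have "image_mset \<pi> (mset_set (\<pi> -` Poly_Mapping.keys m)) = mset_set (Poly_Mapping.keys m)"
    by (metis i image_mset_mset_set inj_on_subset subset_UNIV)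
  then show ?thesis
    unfolding exponents_def keys_map_key[OF i]
    by (metis (mono_tags, lifting) comp_apply i image_mset.comp map_key.rep_eq)
qed

lift_definition monomial_sym :: "nat list \<Rightarrow> 'a::zero_neq_one symfun" is
  "\<lambda>\<nu> m. if exponents m = mset \<nu> then 1 else 0"
  by (auto simp: bounded_degree_def perm_invariant_def exponents_map_key sum_mset_exponents[symmetric])

lift_definition power_sum :: "nat \<Rightarrow> 'a::zero_neq_one symfun" is
  "\<lambda>r m. if \<exists>i. m = Poly_Mapping.single i r then 1 else 0"
proof (goal_cases)
  case (1 r)
  have "(\<exists>i. Poly_Mapping.map_key \<pi> m = Poly_Mapping.single i r) \<longleftrightarrow>
      (\<exists>i. m = Poly_Mapping.single i r)" if \<pi>: "bij \<pi>" for \<pi> :: "nat \<Rightarrow> nat" and m :: mon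
  proof
    assume "\<exists>i. Poly_Mapping.map_key \<pi> m = Poly_Mapping.single i r"
    then obtain i where "Poly_Mapping.map_key \<pi> m = Poly_Mapping.single i r" by blast
    then have "m = Poly_Mapping.map_key (inv \<pi>) (Poly_Mapping.single i r)"
      by (metis map_key_inv(2)[OF \<pi>])
    then show "\<exists>i. m = Poly_Mapping.single i r"
      using map_key_single_bij[OF bij_imp_bij_inv[OF \<pi>], of i r] by auto
  qed (use map_key_single_bij[OF \<pi>] in blast)
  then show ?case
    by (auto simp: bounded_degree_def perm_invariant_def)
qed

definition power_sums :: "nat list \<Rightarrow> 'a::comm_ring_1 symfun" where
  "power_sums \<nu> = prod_list (map power_sum \<nu>)"

text \<open>The coefficient of \<open>m\<^sub>\<nu>\<close>, which is that of any monomial with exponents \<open>\<nu>\<close>.\<close>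

definition monomial_coeff :: "'a::zero symfun \<Rightarrow> nat list \<Rightarrow> 'a" where
  "monomial_coeff F \<nu> = scoeff F (Poly_Mapping.nth \<nu>)"

definition monomial_support :: "'a::zero symfun \<Rightarrow> nat list set" where
  "monomial_support F = {\<nu>. is_partition \<nu> \<and> monomial_coeff F \<nu> \<noteq> 0}"

text \<open>
  Expansion in the basis \<open>p\<^sub>\<nu>\<close>, that is, as a polynomial in \<open>p\<^sub>1, p\<^sub>2, \<dots>\<close>.  It exists and is unique
  over a field of characteristic 0.
\<close>

definition psum_coeff :: "'a::field symfun \<Rightarrow> nat list \<Rightarrow> 'a" where
  "psum_coeff F \<nu> =
     symfun.representation (power_sums ` {\<mu>. is_partition \<mu>}) F (power_sums \<nu>)"

definition psum_support :: "'a::field symfun \<Rightarrow> nat list set" where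
  "psum_support F = {\<nu>. is_partition \<nu> \<and> psum_coeff F \<nu> \<noteq> 0}"

text \<open>
  Plethystic substitution \<open>p\<^sub>r \<mapsto> e r\<close> into an algebra whose scalars are embedded by \<open>\<iota>\<close>.
\<close>

definition plethysm :: "('a \<Rightarrow> 'r) \<Rightarrow> (nat \<Rightarrow> 'r) \<Rightarrow> 'a::field symfun \<Rightarrow> 'r::comm_ring_1" where
  "plethysm \<iota> e F = (\<Sum>\<nu>\<in>psum_support F. \<iota> (psum_coeff F \<nu>) * prod_list (map e \<nu>))"


section \<open>The coefficient field\<close>

text \<open>
  \<open>\<rat>(q,t)\<close> as the fraction field of \<open>\<rat>[t][q]\<close>: the outer polynomial variable is \<open>q\<close>.
\<close>

type_synonym qt = "rat poly poly fract"

definition qq :: qt where "qq = to_fract [:0, 1:]"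

definition tt :: qt where "tt = to_fract [:[:0, 1:]:]"

text \<open>
  Substitution \<open>q = 0\<close>, for those rational functions that have a representation whose denominator
  does not vanish at \<open>q = 0\<close>; the value does not depend on the representation.
\<close>

definition at_q0 :: "qt \<Rightarrow> qt" where
  "at_q0 c = (THE d. \<exists>a b. c = Fract a b \<and> poly b 0 \<noteq> 0 \<and> d = Fract [:poly a 0:] [:poly b 0:])"

definition q_free :: "qt \<Rightarrow> bool" where
  "q_free c \<longleftrightarrow> (\<exists>a b. b \<noteq> 0 \<and> c = Fract [:a:] [:b:])"

lemma at_q0_Fract:
  assumes "poly b 0 \<noteq> 0"
  shows "at_q0 (Fract a b) = Fract [:poly a 0:] [:poly b 0:]"
  unfolding at_q0_def
proof (rule the_equality)
  show "\<exists>a' b'. Fract a b = Fract a' b' \<and> poly b' 0 \<noteq> 0 \<and>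
      Fract [:poly a 0:] [:poly b 0:] = Fract [:poly a' 0:] [:poly b' 0:]"
    using assms by blast
next
  fix d
  assume "\<exists>a' b'. Fract a b = Fract a' b' \<and> poly b' 0 \<noteq> 0 \<and>
      d = Fract [:poly a' 0:] [:poly b' 0:]"
  then obtain a' b' where 1: "Fract a b = Fract a' b'" "poly b' 0 \<noteq> 0"
    and d: "d = Fract [:poly a' 0:] [:poly b' 0:]" by blast
  have "b \<noteq> 0" "b' \<noteq> 0" using assms 1 by auto
  with 1 have "a * b' = a' * b" by (simp add: eq_fract(1))
  from arg_cong[OF this, of "\<lambda>p. poly p 0"]
  have "poly a 0 * poly b' 0 = poly a' 0 * poly b 0" by simp
  then show "d = Fract [:poly a 0:] [:poly b 0:]"
    using assms 1 by (simp add: d eq_fract(1)) (metis mult.commute)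
qed

lemma at_q0_0 [simp]: "at_q0 0 = 0"
  using at_q0_Fract[of 1 0] by (simp add: fract_collapse)


section \<open>Macdonald and Hall--Littlewood polynomials\<close>

text \<open>\<open>\<langle>p\<^sub>\<nu>, p\<^sub>\<mu>\<rangle> = \<delta>\<^bsub>\<nu>\<mu>\<^esub> z\<^sub>\<nu> \<Prod>\<^sub>i (1 - q\<^sup>\<nu>\<^sup>i) / (1 - t\<^sup>\<nu>\<^sup>i)\<close>, the exponents being the parts of \<open>\<nu>\<close>.\<close>

definition qt_inner :: "qt symfun \<Rightarrow> qt symfun \<Rightarrow> qt" where
  "qt_inner F G = (\<Sum>\<nu>\<in>psum_support F \<inter> psum_support G.
     psum_coeff F \<nu> * psum_coeff G \<nu> * of_nat (zee \<nu>) *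
     prod_list (map (\<lambda>r. (1 - qq ^ r) / (1 - tt ^ r)) \<nu>))"

definition macdonald_family :: "(nat list \<Rightarrow> qt symfun) \<Rightarrow> bool" where
  "macdonald_family P \<longleftrightarrow>
     (\<forall>\<nu>. is_partition \<nu> \<longrightarrow>
        P \<nu> - monomial_sym \<nu> \<in>
          symfun.span (monomial_sym ` {\<mu>. is_partition \<mu> \<and> dominated \<mu> \<nu>})) \<and>
     (\<forall>\<nu> \<mu>. is_partition \<nu> \<longrightarrow> is_partition \<mu> \<longrightarrow> \<nu> \<noteq> \<mu> \<longrightarrow> qt_inner (P \<nu>) (P \<mu>) = 0)"

definition macdonald_P :: "nat list \<Rightarrow> qt symfun" where
  "macdonald_P \<nu> = (THE F. \<exists>P. macdonald_family P \<and> F = P \<nu>)"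

definition hook_poly :: "nat list \<Rightarrow> qt" where
  "hook_poly \<nu> = (\<Prod>s\<in>cells \<nu>. 1 - qq ^ arm_length \<nu> s * tt ^ (leg_length \<nu> s + 1))"

definition macdonald_J :: "nat list \<Rightarrow> qt symfun" where
  "macdonald_J \<nu> = sscale (hook_poly \<nu>) (macdonald_P \<nu>)"

text \<open>The substitution \<open>X \<mapsto> X / (1 - t)\<close>.\<close>

definition over_one_minus_t :: "qt symfun \<Rightarrow> qt symfun" where
  "over_one_minus_t = plethysm sconst (\<lambda>r. sscale (1 / (1 - tt ^ r)) (power_sum r))"

definition H_qt :: "nat list \<Rightarrow> qt symfun" where
  "H_qt \<mu> = over_one_minus_t (macdonald_J \<mu>)"

definition hall_littlewood_Q :: "nat list \<Rightarrow> qt symfun" where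
  "hall_littlewood_Q \<mu> = map_coeffs at_q0 (macdonald_J \<mu>)"

definition H_t :: "nat list \<Rightarrow> qt symfun" where
  "H_t \<mu> = over_one_minus_t (hall_littlewood_Q \<mu>)"


section \<open>Operators and their q-analogues\<close>

text \<open>
  Functions symmetric in \<open>X\<close> and in \<open>Y\<close> separately are symmetric functions in \<open>Y\<close> with coefficients
  that are symmetric functions in \<open>X\<close>.  So \<open>sconst G\<close> is \<open>G[X]\<close> and \<open>map_coeffs sconst G\<close> is \<open>G[Y]\<close>.
\<close>

type_synonym bisym = "qt symfun symfun"

abbreviation linear_op :: "(qt symfun \<Rightarrow> qt symfun) \<Rightarrow> bool" where
  "linear_op V \<equiv> Vector_Spaces.linear sscale sscale V"

text \<open>\<open>V\<close> does not involve \<open>q\<close>: it maps symmetric functions over \<open>\<rat>(t)\<close> to such.\<close>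

definition q_free_op :: "(qt symfun \<Rightarrow> qt symfun) \<Rightarrow> bool" where
  "q_free_op V \<longleftrightarrow>
     (\<forall>F. (\<forall>m. q_free (scoeff F m)) \<longrightarrow> (\<forall>m. q_free (scoeff (V F) m)))"

text \<open>
  \<open>V\<^sup>Y\<close> is the extension of \<open>V\<close>, acting on functions of \<open>Y\<close>, that is linear over the symmetric
  functions in \<open>X\<close>; it is given here on the basis \<open>m\<^sub>\<nu>[Y]\<close>.
\<close>

definition act_Y :: "(qt symfun \<Rightarrow> qt symfun) \<Rightarrow> bisym \<Rightarrow> bisym" where
  "act_Y V F = (\<Sum>\<nu>\<in>monomial_support F.
     sscale (monomial_coeff F \<nu>) (map_coeffs sconst (V (monomial_sym \<nu>))))"

definition set_Y_eq_X :: "bisym \<Rightarrow> qt symfun" where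
  "set_Y_eq_X F = (\<Sum>\<nu>\<in>monomial_support F. monomial_coeff F \<nu> * monomial_sym \<nu>)"

text \<open>\<open>P[qX + (1-q)Y]\<close>.\<close>

definition qX_plus_Y :: "qt symfun \<Rightarrow> bisym" where
  "qX_plus_Y = plethysm (\<lambda>c. sconst (sconst c))
     (\<lambda>r. sconst (sscale (qq ^ r) (power_sum r)) +
          sscale (sconst (1 - qq ^ r)) (power_sum r))"

definition q_analogue :: "(qt symfun \<Rightarrow> qt symfun) \<Rightarrow> qt symfun \<Rightarrow> qt symfun" where
  "q_analogue V P = set_Y_eq_X (act_Y V (qX_plus_Y P))"

definition adds_column ::
    "nat \<Rightarrow> (nat list \<Rightarrow> qt symfun) \<Rightarrow> (qt symfun \<Rightarrow> qt symfun) \<Rightarrow> bool" where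
  "adds_column k H V \<longleftrightarrow>
     (\<forall>\<mu>. is_partition \<mu> \<and> length \<mu> \<le> k \<longrightarrow> V (H \<mu>) = H (add_column k \<mu>))"

end

theory Submission
  imports
    Defs
    "HOL-Library.List_Lexorder"
    "HOL-Combinatorics.Permutations"
    "HOL-Computational_Algebra.Formal_Power_Series"
    "Jordan_Normal_Form.Determinant"
begin

text \<open>
  The coefficient field is ordered with \<open>q\<close> and \<open>t\<close> infinitely large, so the Macdonald scalar product is
  positive definite and Gram--Schmidt gives an orthogonal basis \<open>P\<close>.  On \<open>n\<close> variables consider
  \<open>D(X) F(z) = a(z)\<^sup>-\<^sup>1 \<Sum>\<^sub>I X\<^bsup>|I|\<^esup> a(t\<^sup>I z) F(q\<^sup>I z)\<close>, where \<open>a\<close> is the Vandermonde determinant, \<open>I\<close> runs over the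
  subsets of the variables, and \<open>c\<^sup>I z\<close> is \<open>z\<close> with \<open>z\<^sub>i\<close> replaced by \<open>c z\<^sub>i\<close> for \<open>i \<in> I\<close>.  Applied to the
  Cauchy kernel, \<open>D(X)\<close> gives a determinant with entries \<open>1/(1 - x z) + X/(1 - t x z)\<close>.  Its symmetry in \<open>x\<close>
  and \<open>z\<close> shows that the \<open>P\<^sub>\<nu>\<close> are eigenfunctions; comparing \<open>X = -1\<close> with \<open>X = -t\<close> gives the effect of
  prepending a column on the norms.

  Let \<open>\<Omega>[XZ]\<close> be the generating function \<open>\<Sum>\<^sub>\<nu> P\<^sub>\<nu>(z;0,t) H\<^sub>\<nu>[X;t]\<close>, where \<open>Z\<close> has \<open>k\<close> variables.  As
  \<open>e\<^sub>k P\<^sub>\<nu> = P\<^bsub>\<nu>+1\<^sup>k\<^esub>\<close> in \<open>k\<close> variables, and as \<open>D(-1)\<close> at \<open>q = 0\<close> is the projection to the span of the \<open>P\<^sub>\<nu>\<close> of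
  length \<open>k\<close>, the operator \<open>G\<close> satisfies
  \<open>a(z) e\<^sub>k(z) G \<Omega>[XZ] = \<Sum>\<^sub>I (-1)\<^bsup>|I|\<^esup> a(t\<^sup>I z) \<Omega>[X (Z - Z\<^sub>I)]\<close>.  The q-analogue of \<open>G\<close> therefore maps
  \<open>\<Omega>[XZ/(1-q)]\<close> to the same sum with \<open>\<Omega>[X (Z - (1-q) Z\<^sub>I)/(1-q)]\<close>, which is \<open>D(-1)\<close> at general \<open>q\<close> acting on
  \<open>\<Omega>[XZ/(1-q)] = \<Sum>\<^sub>\<nu> P\<^sub>\<nu>(z;q,t) H\<^sub>\<nu>[X;q,t] / \<kappa>\<^sub>\<nu>\<close>.  Comparing the coefficients of \<open>P\<^sub>\<nu>(z;q,t)\<close> proves the theorem.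
\<close>


section \<open>Partitions and monomial expansions\<close>

text \<open>\<open>macdonald_P\<close> is a definite description, so the family has to be shown to
  exist and to be unique. Gram-Schmidt yields triangularity only for a total order refining
  dominance. Triangularity for dominance itself follows because the eigenvalues of D(X), taken for
  all X, separate partitions. The norms enter through \<kappa>_\<nu> alone: hook polynomial and norm
  change together, under a prepended column, by the eigenvalue of D(-1), which is 1 at q = 0. The
  passage from G to its q-analogue is an addition of exponents. Substituting qX + (1-q)Y turns
  Omega[XZ/(1-q)] into Omega[qXZ/(1-q)] Omega[YZ]; G acts on the second factor only; after Y = X the
  alphabets add up to qZ/(1-q) + Z - Z_I = (Z - (1-q) Z_I)/(1-q), which is q^I z divided by 1 - q.
  Identities in z are tested at points with distinct positive integer coordinates. Such points
  decide polynomial identities, are fixed by q = 0 and keep Vandermonde determinants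
  nonzero.\<close>

definition partitions_of :: "nat \<Rightarrow> nat list set" where
  "partitions_of d = {\<nu>. is_partition \<nu> \<and> sum_list \<nu> = d}"

lemma partitions_ofD: "\<nu> \<in> partitions_of d \<Longrightarrow> is_partition \<nu>" "\<nu> \<in> partitions_of d \<Longrightarrow> sum_list \<nu> = d"
  by (simp_all add: partitions_of_def)

lemma is_partition_pos: "is_partition \<nu> \<Longrightarrow> r \<in> set \<nu> \<Longrightarrow> r > 0"
  unfolding is_partition_def by (metis gr0I)

lemma length_le_sum_list: "0 \<notin> set \<nu> \<Longrightarrow> length \<nu> \<le> sum_list (\<nu> :: nat list)"
  by (induction \<nu>) (auto simp: Suc_le_eq)

lemma finite_partitions_of [simp]: "finite (partitions_of d)"
proof (rule finite_subset)
  show "partitions_of d \<subseteq> {xs. set xs \<subseteq> {..d} \<and> length xs \<le> d}"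
    using member_le_sum_list length_le_sum_list
    by (auto simp: partitions_of_def is_partition_def)
  show "finite {xs::nat list. set xs \<subseteq> {..d} \<and> length xs \<le> d}"
    by (rule finite_lists_length_le) simp
qed

lemma is_partition_sorted_rev: "is_partition \<nu> \<longleftrightarrow> sorted (rev \<nu>) \<and> 0 \<notin> set \<nu>"
  by (simp add: is_partition_def sorted_wrt_rev)

lemma partition_eqI:
  assumes "is_partition \<mu>" "is_partition \<nu>" "mset \<mu> = mset \<nu>"
  shows "\<mu> = \<nu>"
proof -
  have "sort (rev \<mu>) = rev \<nu>"
    by (rule properties_for_sort) (use assms in \<open>auto simp: is_partition_sorted_rev\<close>)
  moreover have "sort (rev \<mu>) = rev \<mu>"
    using assms(1) by (simp add: is_partition_sorted_rev sorted_sort_id)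
  ultimately show ?thesis by simp
qed

section \<open>Monomials and their exponent partitions\<close>

definition partition_of_mon :: "mon \<Rightarrow> nat list" where
  "partition_of_mon m = rev (sorted_list_of_multiset (exponents m))"

lemma size_exponents: "size (exponents m) = card (Poly_Mapping.keys m)"
  by (simp add: exponents_def)

lemma zero_notin_exponents: "0 \<notin># exponents m"
  by (auto simp: exponents_def in_keys_iff)

lemma mset_partition_of_mon [simp]: "mset (partition_of_mon m) = exponents m"
  by (simp add: partition_of_mon_def)

lemma is_partition_partition_of_mon [simp]: "is_partition (partition_of_mon m)"
proof -
  have "0 \<notin> set (partition_of_mon m)"
    using zero_notin_exponents[of m] by (metis mset_partition_of_mon set_mset_mset)
  then show ?thesis
    by (simp add: is_partition_sorted_rev partition_of_mon_def)
qed

lemma sum_list_partition_of_mon [simp]: "sum_list (partition_of_mon m) = mdeg m"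
  by (metis mset_partition_of_mon sum_mset_exponents sum_mset_sum_list)

lemma length_partition_of_mon [simp]: "length (partition_of_mon m) = card (Poly_Mapping.keys m)"
  by (metis mset_partition_of_mon size_exponents size_mset)

lemma mset_map_lookup:
  assumes "Poly_Mapping.keys m \<subseteq> {..<n}"
  shows "mset (map (Poly_Mapping.lookup m) [0..<n])
    = exponents m + replicate_mset (n - card (Poly_Mapping.keys m)) 0"
proof -
  let ?K = "Poly_Mapping.keys m"
  have fin: "finite ?K" by simp
  have "mset (map (Poly_Mapping.lookup m) [0..<n])
      = image_mset (Poly_Mapping.lookup m) (mset_set {..<n})"
    by (simp add: atLeast0LessThan)
  also have "mset_set {..<n} = mset_set ?K + mset_set ({..<n} - ?K)"
    using assms mset_set_Union[of ?K "{..<n} - ?K"] by (simp add: Un_absorb1)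
  finally have *: "mset (map (Poly_Mapping.lookup m) [0..<n]) = exponents m +
      image_mset (Poly_Mapping.lookup m) (mset_set ({..<n} - ?K))"
    by (simp add: exponents_def)
  have "image_mset (Poly_Mapping.lookup m) (mset_set ({..<n} - ?K))
      = image_mset (\<lambda>_. 0) (mset_set ({..<n} - ?K))"
    by (rule image_mset_cong) (auto simp: in_keys_iff)
  also have "\<dots> = replicate_mset (n - card ?K) 0"
    using assms by (simp add: image_mset_const_eq card_Diff_subset)
  finally show ?thesis using * by simp
qed

lemma scoeff_map_key: "bij \<pi> \<Longrightarrow> scoeff F (Poly_Mapping.map_key \<pi> m) = scoeff F m"
  using scoeff[of F] by (simp add: perm_invariant_def)

text \<open>Pad both exponent lists with zeros to a common length N. A permutation matching the
  lists, extended by the identity beyond N, carries one monomial to the other, and F is invariant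
  under it.\<close>

lemma scoeff_eq_exponents:
  assumes "exponents m = exponents m'"
  shows "scoeff F m = scoeff F m'"
proof -
  have "finite (Poly_Mapping.keys m \<union> Poly_Mapping.keys m')" by simp
  then obtain N where N: "Poly_Mapping.keys m \<union> Poly_Mapping.keys m' \<subseteq> {..<N}"
    using finite_nat_bounded by blast
  have c: "card (Poly_Mapping.keys m) = card (Poly_Mapping.keys m')"
    using assms by (metis size_exponents)
  let ?xs = "map (Poly_Mapping.lookup m) [0..<N]" and ?ys = "map (Poly_Mapping.lookup m') [0..<N]"
  have "mset ?xs = mset ?ys"
    using N assms c by (simp only: mset_map_lookup Un_subset_iff)
  then obtain p where p: "p permutes {..<length ?ys}" "permute_list p ?ys = ?xs"
    by (rule mset_eq_permutation)
  have p': "p permutes {..<N}" using p(1) by simp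
  have bij: "bij p" by (rule permutes_bij[OF p'])
  have "Poly_Mapping.lookup m i = Poly_Mapping.lookup m' (p i)" for i
  proof (cases "i < N")
    case True
    then have "p i < N" using permutes_in_image[OF p', of i] by simp
    have "?xs ! i = permute_list p ?ys ! i" using p(2) by simp
    also have "\<dots> = ?ys ! p i" using True by (simp add: permute_list_nth[OF p(1)])
    finally show ?thesis using True \<open>p i < N\<close> by simp
  next
    case False
    then have "p i = i" using p' by (simp add: permutes_def)
    then show ?thesis using N False by (metis Un_subset_iff in_keys_iff lessThan_iff subsetD)
  qed
  then have "Poly_Mapping.map_key p m' = m"
    by (intro poly_mapping_eqI) (simp add: map_key.rep_eq bij_is_inj[OF bij])
  then show ?thesis using scoeff_map_key[OF bij, of F m'] by simp
qed

lemma keys_nth_eq: "Poly_Mapping.keys (Poly_Mapping.nth \<nu>) = {i. i < length \<nu> \<and> \<nu> ! i \<noteq> 0}"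
proof (rule Set.set_eqI)
  fix i
  have "i \<in> Poly_Mapping.keys (Poly_Mapping.nth \<nu>) \<longleftrightarrow> Poly_Mapping.lookup (Poly_Mapping.nth \<nu>) i \<noteq> 0"
    by (rule in_keys_iff)
  then show "i \<in> Poly_Mapping.keys (Poly_Mapping.nth \<nu>) \<longleftrightarrow> i \<in> {i. i < length \<nu> \<and> \<nu> ! i \<noteq> 0}"
    by (simp add: nth.rep_eq nth_default_def)
qed

lemma exponents_nth:
  assumes "0 \<notin> set \<nu>"
  shows "exponents (Poly_Mapping.nth \<nu>) = mset \<nu>"
proof -
  have k: "Poly_Mapping.keys (Poly_Mapping.nth \<nu>) = {..<length \<nu>}"
    using assms by (auto simp: keys_nth_eq simp del: keys_nth) (metis gr0I nth_mem)
  have "mset (map (Poly_Mapping.lookup (Poly_Mapping.nth \<nu>)) [0..<length \<nu>]) = mset \<nu>"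
    by (rule arg_cong[where f = mset], rule nth_equalityI) (auto simp: nth.rep_eq nth_default_def)
  then show ?thesis
    using mset_map_lookup[of "Poly_Mapping.nth \<nu>" "length \<nu>"] k by simp
qed

lemma exponents_nth_partition: "is_partition \<nu> \<Longrightarrow> exponents (Poly_Mapping.nth \<nu>) = mset \<nu>"
  by (rule exponents_nth) (simp add: is_partition_def)

lemma partition_of_nth [simp]: "is_partition \<nu> \<Longrightarrow> partition_of_mon (Poly_Mapping.nth \<nu>) = \<nu>"
  by (rule partition_eqI) (simp_all add: exponents_nth_partition)

lemma scoeff_eq_monomial_coeff: "scoeff F m = monomial_coeff F (partition_of_mon m)"
  unfolding monomial_coeff_def
  by (rule scoeff_eq_exponents) (simp add: exponents_nth_partition)

lemma mdeg_nth: "is_partition \<nu> \<Longrightarrow> mdeg (Poly_Mapping.nth \<nu>) = sum_list \<nu>"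
  by (metis partition_of_nth sum_list_partition_of_mon)

section \<open>Coefficients in the monomial basis\<close>

lemma scoeff_add [simp]: "scoeff (F + G) m = scoeff F m + scoeff G m"
  by (simp add: plus_symfun.rep_eq)

lemma scoeff_diff [simp]: "scoeff (F - G) m = scoeff F m - scoeff G m"
  by (simp add: minus_symfun.rep_eq)

lemma scoeff_zero [simp]: "scoeff 0 m = 0"
  by (simp add: zero_symfun.rep_eq)

lemma scoeff_sscale [simp]: "scoeff (sscale c F) m = c * scoeff F m"
  by (simp add: sscale.rep_eq)

lemma scoeff_sum [simp]: "scoeff (sum f A) m = (\<Sum>a\<in>A. scoeff (f a) m)"
  by (induction A rule: infinite_finite_induct) auto

lemma monomial_coeff_simps [simp]:
  "monomial_coeff (F + G) \<nu> = monomial_coeff F \<nu> + monomial_coeff G \<nu>"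
  "monomial_coeff (F - G) \<nu> = monomial_coeff F \<nu> - monomial_coeff G \<nu>"
  "monomial_coeff 0 \<nu> = 0"
  "monomial_coeff (sscale c F) \<nu> = c * monomial_coeff F \<nu>"
  "monomial_coeff (sum f A) \<nu> = (\<Sum>a\<in>A. monomial_coeff (f a) \<nu>)"
  by (simp_all add: monomial_coeff_def)

lemma scoeff_monomial_sym: "is_partition \<nu> \<Longrightarrow>
    scoeff (monomial_sym \<nu>) m = (if partition_of_mon m = \<nu> then 1 else 0)"
  by (auto simp: monomial_sym.rep_eq intro: partition_eqI)

lemma monomial_coeff_monomial_sym: "is_partition \<mu> \<Longrightarrow> is_partition \<nu> \<Longrightarrow>
    monomial_coeff (monomial_sym \<nu>) \<mu> = (if \<mu> = \<nu> then 1 else 0)"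
  by (simp add: monomial_coeff_def scoeff_monomial_sym)

lemma obtain_degree_bound:
  obtains D where "\<And>m. scoeff F m \<noteq> 0 \<Longrightarrow> mdeg m \<le> D"
  using scoeff[of F] by (auto simp: bounded_degree_def)

lemma finite_monomial_support [simp]: "finite (monomial_support F)"
proof -
  obtain D where D: "\<And>m. scoeff F m \<noteq> 0 \<Longrightarrow> mdeg m \<le> D" using obtain_degree_bound[of F] by blast
  have "monomial_support F \<subseteq> (\<Union>d\<le>D. partitions_of d)"
    using D by (force simp: monomial_support_def monomial_coeff_def partitions_of_def mdeg_nth[symmetric])
  then show ?thesis by (rule finite_subset) simp
qed

lemma monomial_expansion:
  assumes "finite A" "monomial_support F \<subseteq> A" "\<And>\<nu>. \<nu> \<in> A \<Longrightarrow> is_partition \<nu>"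
  shows "F = (\<Sum>\<nu>\<in>A. sscale (monomial_coeff F \<nu>) (monomial_sym \<nu>))"
proof (rule symfun_eqI)
  fix m
  have "(\<Sum>\<nu>\<in>A. monomial_coeff F \<nu> * scoeff (monomial_sym \<nu>) m)
      = (\<Sum>\<nu>\<in>A. if partition_of_mon m = \<nu> then monomial_coeff F \<nu> else 0)"
    using assms(3) by (intro sum.cong refl) (simp add: scoeff_monomial_sym)
  also have "\<dots> = (if partition_of_mon m \<in> A then monomial_coeff F (partition_of_mon m) else 0)"
    using assms(1) by (simp add: sum.delta')
  also have "\<dots> = scoeff F m"
  proof -
    have "monomial_coeff F (partition_of_mon m) = 0" if "partition_of_mon m \<notin> A"
      using assms(2) is_partition_partition_of_mon[of m] that unfolding monomial_support_def by blast
    then show ?thesis by (simp add: scoeff_eq_monomial_coeff[of F m])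
  qed
  finally show "scoeff F m = scoeff (\<Sum>\<nu>\<in>A. sscale (monomial_coeff F \<nu>) (monomial_sym \<nu>)) m"
    by simp
qed


section \<open>Evaluation at finitely many points\<close>

definition mons :: "nat \<Rightarrow> nat \<Rightarrow> mon set" where
  "mons n D = {m. Poly_Mapping.keys m \<subseteq> {..<n} \<and> mdeg m \<le> D}"

lemma lookup_le_mdeg: "Poly_Mapping.lookup m i \<le> mdeg m"
proof (cases "i \<in> Poly_Mapping.keys m")
  case True
  then show ?thesis unfolding mdeg_def by (intro member_le_sum) auto
qed (simp add: in_keys_iff)

lemma finite_mons [simp]: "finite (mons n D)"
proof -
  let ?F = "{f. (\<forall>i. (i \<in> {..<n} \<longrightarrow> f i \<in> {..D}) \<and> (i \<notin> {..<n} \<longrightarrow> f i = (0::nat)))}"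
  have "finite ?F" by (rule finite_set_of_finite_funs) auto
  then have S: "finite {m :: mon. Poly_Mapping.lookup m \<in> ?F}"
    by (rule finite_vimageI[where h = Poly_Mapping.lookup, unfolded vimage_def])
      (simp add: inj_on_def)
  show ?thesis
    by (rule finite_subset[OF _ S])
      (auto simp: mons_def in_keys_iff intro: order_trans[OF lookup_le_mdeg])
qed

definition mon_eval :: "nat \<Rightarrow> (nat \<Rightarrow> 'a) \<Rightarrow> mon \<Rightarrow> 'a::comm_ring_1" where
  "mon_eval n x m = (\<Prod>i<n. x i ^ Poly_Mapping.lookup m i)"

lemma mon_eval_add: "mon_eval n x (a + b) = mon_eval n x a * mon_eval n x b"
  by (simp add: mon_eval_def lookup_add power_add prod.distrib)

text \<open>Setting the variables from index n on to 0 drops exactly the monomials that involve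
  them; bounded degree makes the remaining sum finite.\<close>

definition evl :: "nat \<Rightarrow> (nat \<Rightarrow> 'a) \<Rightarrow> 'a symfun \<Rightarrow> 'a::comm_ring_1" where
  "evl n x F = (\<Sum>m | Poly_Mapping.keys m \<subseteq> {..<n} \<and> scoeff F m \<noteq> 0. scoeff F m * mon_eval n x m)"

lemma evl_mons:
  assumes "\<And>m. scoeff F m \<noteq> 0 \<Longrightarrow> mdeg m \<le> D"
  shows "evl n x F = (\<Sum>m\<in>mons n D. scoeff F m * mon_eval n x m)"
  unfolding evl_def
  by (rule sum.mono_neutral_left[OF finite_mons]) (use assms in \<open>auto simp: mons_def\<close>)

lemma evl_add [simp]: "evl n x (F + G) = evl n x F + evl n x G"
proof -
  obtain D where D: "\<And>m. scoeff F m \<noteq> 0 \<Longrightarrow> mdeg m \<le> D" using obtain_degree_bound[of F] by blast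
  obtain E where E: "\<And>m. scoeff G m \<noteq> 0 \<Longrightarrow> mdeg m \<le> E" using obtain_degree_bound[of G] by blast
  let ?M = "max D E"
  have "evl n x F = (\<Sum>m\<in>mons n ?M. scoeff F m * mon_eval n x m)"
    by (rule evl_mons) (use D in fastforce)
  moreover have "evl n x G = (\<Sum>m\<in>mons n ?M. scoeff G m * mon_eval n x m)"
    by (rule evl_mons) (use E in fastforce)
  moreover have "evl n x (F + G) = (\<Sum>m\<in>mons n ?M. scoeff (F + G) m * mon_eval n x m)"
    by (rule evl_mons) (metis D E add_0 max.coboundedI1 max.coboundedI2 scoeff_add)
  ultimately show ?thesis by (simp add: sum.distrib distrib_right)
qed

lemma evl_zero [simp]: "evl n x 0 = 0"
  by (simp add: evl_def)

lemma evl_sscale [simp]: "evl n x (sscale c F) = c * evl n x F"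
proof -
  obtain D where D: "\<And>m. scoeff F m \<noteq> 0 \<Longrightarrow> mdeg m \<le> D" using obtain_degree_bound[of F] by blast
  have "evl n x (sscale c F) = (\<Sum>m\<in>mons n D. scoeff (sscale c F) m * mon_eval n x m)"
    by (rule evl_mons) (metis D mult_zero_right scoeff_sscale)
  then show ?thesis by (simp add: evl_mons[OF D] sum_distrib_left mult.assoc)
qed

lemma evl_sum [simp]: "evl n x (sum f A) = (\<Sum>a\<in>A. evl n x (f a))"
  by (induction A rule: infinite_finite_induct) auto

lemma evl_diff [simp]: "evl n x (F - G) = evl n x F - evl n x G"
proof -
  have "evl n x F = evl n x ((F - G) + G)" by simp
  then show ?thesis by (simp only: evl_add) simp
qed

lemma keys_add_mon: "Poly_Mapping.keys (a + b :: mon) = Poly_Mapping.keys a \<union> Poly_Mapping.keys b"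
  by (auto simp: in_keys_iff lookup_add)

lemma evl_mult [simp]: "evl n x (F * G) = evl n x F * evl n x G"
proof -
  obtain D where D: "\<And>m. scoeff F m \<noteq> 0 \<Longrightarrow> mdeg m \<le> D" using obtain_degree_bound[of F] by blast
  obtain E where E: "\<And>m. scoeff G m \<noteq> 0 \<Longrightarrow> mdeg m \<le> E" using obtain_degree_bound[of G] by blast
  let ?T = "mons n D \<times> mons n E"
  let ?h = "\<lambda>(a, b). (scoeff F a * scoeff G b) * mon_eval n x (a + b)"
  have deg: "mdeg m \<le> D + E" if nz: "scoeff (F * G) m \<noteq> 0" for m
  proof -
    obtain y where y: "y \<in> splits m" "(case y of (a, b) \<Rightarrow> scoeff F a * scoeff G b) \<noteq> 0"
      using nz unfolding times_symfun.rep_eq by (meson sum.neutral)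
    obtain a b where ab: "y = (a, b)" by (cases y)
    with y have "a + b = m" "scoeff F a \<noteq> 0" "scoeff G b \<noteq> 0" by (auto simp: splits_def)
    then show ?thesis using D[of a] E[of b] by auto
  qed
  have inner: "scoeff (F * G) m * mon_eval n x m = sum ?h {y \<in> ?T. fst y + snd y = m}"
    if m: "m \<in> mons n (D + E)" for m
  proof -
    have "scoeff (F * G) m * mon_eval n x m = sum ?h (splits m)"
      unfolding times_symfun.rep_eq sum_distrib_right
      by (rule sum.cong) (auto simp: splits_def)
    also have "\<dots> = sum ?h {y \<in> ?T. fst y + snd y = m}"
    proof (rule sum.mono_neutral_right)
      show "{y \<in> ?T. fst y + snd y = m} \<subseteq> splits m" by (auto simp: splits_def)
      show "\<forall>y\<in>splits m - {y \<in> ?T. fst y + snd y = m}. ?h y = 0"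
      proof
        fix y assume y: "y \<in> splits m - {y \<in> ?T. fst y + snd y = m}"
        obtain a b where ab: "y = (a, b)" by (cases y)
        have s: "a + b = m" using y ab by (auto simp: splits_def)
        then have k: "Poly_Mapping.keys a \<subseteq> {..<n}" "Poly_Mapping.keys b \<subseteq> {..<n}"
          using m by (auto simp: mons_def keys_add_mon)
        have "\<not> (mdeg a \<le> D \<and> mdeg b \<le> E)"
          using y s k by (auto simp: ab mons_def)
        then have "scoeff F a = 0 \<or> scoeff G b = 0" using D E by blast
        then show "?h y = 0" by (auto simp: ab)
      qed
    qed simp
    finally show ?thesis .
  qed
  have "evl n x (F * G) = (\<Sum>m\<in>mons n (D + E). scoeff (F * G) m * mon_eval n x m)"
    by (rule evl_mons[OF deg])
  also have "\<dots> = (\<Sum>m\<in>mons n (D + E). sum ?h {y \<in> ?T. fst y + snd y = m})"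
    by (rule sum.cong[OF refl inner])
  \<comment> \<open>Every pair of monomials from the two degree boxes is collected at its
    product.\<close>
  also have "\<dots> = sum ?h ?T"
    by (rule sum.group) (auto simp: mons_def keys_add_mon intro!: finite_mons[unfolded mons_def])
  also have "\<dots> = evl n x F * evl n x G"
    by (simp add: evl_mons[OF D] evl_mons[OF E] sum_product sum.cartesian_product mon_eval_add)
      (rule sum.cong, auto)
  finally show ?thesis .
qed

lemma evl_one [simp]: "evl n x 1 = (1 :: 'a::comm_ring_1)"
proof -
  have "{m. Poly_Mapping.keys m \<subseteq> {..<n} \<and> scoeff (1 :: 'a symfun) m \<noteq> 0} = {0}"
    by (auto simp: one_symfun.rep_eq)
  then show ?thesis by (simp add: evl_def one_symfun.rep_eq mon_eval_def)
qed

lemma single_eq_single_iff: "r > 0 \<Longrightarrow> Poly_Mapping.single i r = Poly_Mapping.single j (r::nat) \<longleftrightarrow> i = j"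
  by (metis keys_single less_numeral_extra(3) singleton_insert_inj_eq)

lemma evl_power_sum:
  assumes "r > 0"
  shows "evl n x (power_sum r) = (\<Sum>i<n. x i ^ r :: 'a::comm_ring_1)"
proof -
  have *: "{m. Poly_Mapping.keys m \<subseteq> {..<n} \<and> scoeff (power_sum r :: 'a symfun) m \<noteq> 0}
      = (\<lambda>i. Poly_Mapping.single i r) ` {..<n}"
    using assms by (auto simp: power_sum.rep_eq single_eq_single_iff split: if_splits)
  have inj: "inj_on (\<lambda>i. Poly_Mapping.single i r) {..<n}"
    using assms by (auto simp: inj_on_def single_eq_single_iff)
  have "mon_eval n x (Poly_Mapping.single i r) = x i ^ r" if "i < n" for i
  proof -
    have "mon_eval n x (Poly_Mapping.single i r) = (\<Prod>j<n. if i = j then x i ^ r else 1)"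
      unfolding mon_eval_def by (rule prod.cong) (auto simp: lookup_single when_def)
    then show ?thesis using that by (simp add: prod.delta')
  qed
  moreover have "scoeff (power_sum r :: 'a symfun) (Poly_Mapping.single i r) = 1" for i
    by (auto simp: power_sum.rep_eq)
  ultimately show ?thesis
    unfolding evl_def * sum.reindex[OF inj] by simp
qed

lemma evl_power_sums:
  assumes "0 \<notin> set \<nu>"
  shows "evl n x (power_sums \<nu>) = prod_list (map (\<lambda>r. \<Sum>i<n. x i ^ r :: 'a::comm_ring_1) \<nu>)"
  using assms by (induction \<nu>) (auto simp: power_sums_def evl_power_sum)


section \<open>Dominance order\<close>

text \<open>A linear order on partitions that refines dominance, longer partitions being smaller.\<close>

definition partition_key :: "nat list \<Rightarrow> int list" where
  "partition_key \<nu> = - int (length \<nu>) # map int \<nu>"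

lemma partition_key_inj [simp]: "partition_key \<mu> = partition_key \<nu> \<longleftrightarrow> \<mu> = \<nu>"
  by (auto simp: partition_key_def dest: map_injective)

text \<open>The reason for putting the length first: a function triangular for this order with
  leading term \<nu> has only monomials in at least \<open>length \<nu>\<close> variables, so it
  vanishes in fewer variables.\<close>

lemma partition_key_le_length: "partition_key \<mu> \<le> partition_key \<nu> \<Longrightarrow> length \<nu> \<le> length \<mu>"
  by (auto simp: partition_key_def)

text \<open>Up to the first difference the partial sums agree, so the next partial sum forces the
  smaller entry there.\<close>

lemma lex_less_of_partial_sums:
  fixes \<mu> \<nu> :: "nat list"
  assumes "length \<mu> = length \<nu>" "\<mu> \<noteq> \<nu>"
    and "\<And>k. sum_list (take k \<mu>) \<le> sum_list (take k \<nu>)"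
  shows "map int \<mu> < map int \<nu>"
  using assms
proof (induction \<mu> \<nu> rule: list_induct2)
  case (Cons a \<mu> b \<nu>)
  have "a \<le> b" using Cons.prems(2)[of 1] by simp
  show ?case
  proof (cases "a = b")
    case True
    have "sum_list (take k \<mu>) \<le> sum_list (take k \<nu>)" for k
      using Cons.prems(2)[of "Suc k"] True by simp
    then show ?thesis using Cons True by simp
  qed (use \<open>a \<le> b\<close> in auto)
qed simp

text \<open>If \<nu> were longer, its first \<open>length \<mu>\<close> parts would already reach
  the common total, although positive parts are still to come.\<close>

lemma dominated_length_le:
  assumes "is_partition \<nu>" "dominated \<mu> \<nu>"
  shows "length \<nu> \<le> length \<mu>"
proof (rule ccontr)
  assume "\<not> length \<nu> \<le> length \<mu>"
  then have l: "length \<mu> < length \<nu>" by simp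
  have "sum_list \<nu> \<le> sum_list (take (length \<mu>) \<nu>)"
    using assms(2) unfolding dominated_def by (metis order_refl take_all)
  moreover have "sum_list \<nu> = sum_list (take (length \<mu>) \<nu>) + sum_list (drop (length \<mu>) \<nu>)"
    by (metis append_take_drop_id sum_list_append)
  moreover have "sum_list (drop (length \<mu>) \<nu>) \<ge> length (drop (length \<mu>) \<nu>)"
    by (rule length_le_sum_list) (use assms(1) in \<open>auto simp: is_partition_def dest: in_set_dropD\<close>)
  moreover have "length (drop (length \<mu>) \<nu>) > 0" using l by simp
  ultimately show False by linarith
qed

lemma dominated_key_less:
  assumes "is_partition \<nu>" "dominated \<mu> \<nu>"
  shows "partition_key \<mu> < partition_key \<nu>"
  using dominated_length_le[OF assms] lex_less_of_partial_sums[of \<mu> \<nu>] assms(2)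
  by (auto simp: partition_key_def dominated_def)

section \<open>Partial sums under rearrangement\<close>

lemma sum_list_take_le_excess: "sum_list (take k xs) \<le> k * c + (\<Sum>x\<leftarrow>xs. x - c :: nat)"
proof (induction xs arbitrary: k)
  case (Cons a xs)
  show ?case
  proof (cases k)
    case (Suc j)
    then show ?thesis using Cons.IH[of j] by simp
  qed simp
qed simp

lemma sum_list_excess: "(\<And>x. x \<in> set xs \<Longrightarrow> c \<le> x) \<Longrightarrow> sum_list xs = length xs * c + (\<Sum>x\<leftarrow>xs. x - c :: nat)"
proof (induction xs)
  case (Cons a xs)
  then have "sum_list xs = length xs * c + (\<Sum>x\<leftarrow>xs. x - c)" "c \<le> a" by simp_all
  then show ?case by simp
qed simp

text \<open>For any threshold c, a sum of k entries is at most k c plus the total excess over c, and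
  that excess depends on the multiset only. The sorted list attains the bound for c =
  \<open>ys ! k\<close>: the first k entries are at least c and the later ones have no
  excess.\<close>

lemma sum_list_take_le_sorted:
  fixes xs ys :: "nat list"
  assumes eq: "mset xs = mset ys" and sorted: "sorted_wrt (\<ge>) ys"
  shows "sum_list (take k xs) \<le> sum_list (take k ys)"
proof (cases "k < length ys")
  case True
  define c where "c = ys ! k"
  have "(\<Sum>y\<leftarrow>drop k ys. y - c) = 0"
  proof -
    have "y \<le> c" if y: "y \<in> set (drop k ys)" for y
    proof -
      obtain i where i: "i < length (drop k ys)" "y = drop k ys ! i" using y by (metis in_set_conv_nth)
      show ?thesis
        using sorted_wrt_nth_less[OF sorted, of k "k + i"] i True by (cases i) (auto simp: c_def)
    qed
    then show ?thesis by (simp add: sum_list_0)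
  qed
  then have 1: "(\<Sum>y\<leftarrow>ys. y - c) = (\<Sum>y\<leftarrow>take k ys. y - c)"
    by (metis append_take_drop_id add_0_right map_append sum_list_append)
  have 2: "c \<le> y" if y: "y \<in> set (take k ys)" for y
  proof -
    obtain i where i: "i < length (take k ys)" "y = take k ys ! i" using y by (metis in_set_conv_nth)
    then show ?thesis using sorted_wrt_nth_less[OF sorted, of i k] True by (auto simp: c_def)
  qed
  have "sum_list (take k xs) \<le> k * c + (\<Sum>x\<leftarrow>xs. x - c)" by (rule sum_list_take_le_excess)
  also have "(\<Sum>x\<leftarrow>xs. x - c) = (\<Sum>y\<leftarrow>ys. y - c)"
    using eq by (metis mset_map sum_mset_sum_list)
  also have "k * c + \<dots> = sum_list (take k ys)"
    using sum_list_excess[of "take k ys" c] 1 2 True by simp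
  finally show ?thesis .
next
  case False
  moreover have "length xs = length ys" using eq by (metis size_mset)
  moreover have "sum_list xs = sum_list ys" using eq by (metis sum_mset_sum_list)
  ultimately show ?thesis by simp
qed

lemma sum_nth_part: "(\<Sum>i<k. nth_part \<nu> i) = sum_list (take k \<nu>)"
proof (induction k)
  case (Suc k)
  show ?case
  proof (cases "k < length \<nu>")
    case True
    then show ?thesis using Suc by (simp add: nth_part_def take_Suc_conv_app_nth)
  qed (use Suc in \<open>simp add: nth_part_def\<close>)
qed simp

lemma sum_list_map_upt: "sum_list (map f [0..<k]) = (\<Sum>i<k. f i)"
  by (simp add: interv_sum_list_conv_sum_set_nat atLeast0LessThan)

lemma sum_permutes_le:
  fixes \<sigma> :: "nat \<Rightarrow> nat"
  assumes "\<sigma> permutes {0..<n}" "k \<le> n"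
  shows "(\<Sum>i<k. \<sigma> i) \<le> (\<Sum>i<k. n - 1 - i)"
proof -
  have "mset (map \<sigma> [0..<n]) = mset (rev [0..<n])"
    using assms(1) by (simp add: image_mset_mset_set permutes_inj_on permutes_image)
  then have "sum_list (take k (map \<sigma> [0..<n])) \<le> sum_list (take k (rev [0..<n]))"
    by (rule sum_list_take_le_sorted) (auto simp: sorted_wrt_iff_nth_less rev_nth)
  moreover have "take k (map \<sigma> [0..<n]) = map \<sigma> [0..<k]"
    using assms(2) by (simp add: take_map)
  moreover have "take k (rev [0..<n]) = map (\<lambda>i. n - 1 - i) [0..<k]"
    using assms(2) by (intro nth_equalityI) (auto simp: rev_nth)
  ultimately show ?thesis by (simp only: sum_list_map_upt)
qed

lemma sum_lookup_le_partition:
  assumes "Poly_Mapping.keys m \<subseteq> {..<n}" "k \<le> n"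
  shows "(\<Sum>i<k. Poly_Mapping.lookup m i) \<le> sum_list (take k (partition_of_mon m))"
proof -
  let ?r = "n - card (Poly_Mapping.keys m)"
  let ?ys = "partition_of_mon m @ replicate ?r 0"
  have "mset (map (Poly_Mapping.lookup m) [0..<n]) = mset ?ys"
    using mset_map_lookup[OF assms(1)] by simp
  moreover have "sorted_wrt (\<ge>) (replicate ?r (0::nat))"
    by (simp add: sorted_wrt_iff_nth_less)
  ultimately have "sum_list (take k (map (Poly_Mapping.lookup m) [0..<n])) \<le> sum_list (take k ?ys)"
    by (intro sum_list_take_le_sorted)
      (use is_partition_partition_of_mon[of m] in
        \<open>auto simp: sorted_wrt_append is_partition_def\<close>)
  moreover have "take k (map (Poly_Mapping.lookup m) [0..<n]) = map (Poly_Mapping.lookup m) [0..<k]"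
    using assms(2) by (simp add: take_map)
  ultimately show ?thesis by (simp add: sum_list_map_upt sum_list_replicate)
qed

text \<open>Partial sums of \<sigma> are at most those of (n-1,...,0), so partial sums of m are at
  least those of \<nu>; they are also at most those of the sorted exponents of m. Hence the latter
  dominate \<nu>. If they equal \<nu>, all these inequalities are equalities, which determines
  \<sigma> and m entry by entry.\<close>

lemma leading_exponent:
  assumes \<sigma>: "\<sigma> permutes {0..<n}" and m: "Poly_Mapping.keys m \<subseteq> {..<n}"
    and \<nu>: "is_partition \<nu>" "length \<nu> \<le> n"
    and eq: "\<And>i. i < n \<Longrightarrow> \<sigma> i + Poly_Mapping.lookup m i = (n - 1 - i) + nth_part \<nu> i"
  shows "partition_of_mon m = \<nu> \<or> dominated \<nu> (partition_of_mon m)"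
    and "partition_of_mon m = \<nu> \<Longrightarrow> m = Poly_Mapping.nth \<nu> \<and> (\<forall>i<n. \<sigma> i = n - 1 - i)"
proof -
  let ?\<mu> = "partition_of_mon m" and ?m = "Poly_Mapping.lookup m"
  have tot: "(\<Sum>i<k. \<sigma> i) + (\<Sum>i<k. ?m i) = (\<Sum>i<k. n - 1 - i) + sum_list (take k \<nu>)" if "k \<le> n" for k
    using eq that by (simp add: sum.distrib[symmetric] sum_nth_part[symmetric])
  have le1: "(\<Sum>i<k. \<sigma> i) \<le> (\<Sum>i<k. n - 1 - i)" if "k \<le> n" for k
    using sum_permutes_le[OF \<sigma> that] .
  have le2: "(\<Sum>i<k. ?m i) \<le> sum_list (take k ?\<mu>)" if "k \<le> n" for k
    using sum_lookup_le_partition[OF m that] .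
  have perm: "(\<Sum>i<n. \<sigma> i) = (\<Sum>i<n. n - 1 - i)"
  proof -
    have "(\<Sum>i<n. \<sigma> i) = (\<Sum>i<n. i)"
      using sum.permute[OF \<sigma>, of id] by (simp add: atLeast0LessThan comp_def)
    also have "\<dots> = (\<Sum>i<n. n - 1 - i)"
      using sum.nat_diff_reindex[of "\<lambda>i. i" n] by simp
    finally show ?thesis .
  qed
  have deg: "mdeg m = (\<Sum>i<n. ?m i)" by (rule mdeg_superset[OF _ m]) simp
  have sums: "sum_list \<nu> = sum_list ?\<mu>"
    using tot[of n] perm deg \<nu> by simp
  have len: "length ?\<mu> \<le> n"
    using card_mono[OF _ m] by simp
  have dom: "sum_list (take k \<nu>) \<le> sum_list (take k ?\<mu>)" for k
  proof (cases "k \<le> n")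
    case True
    then show ?thesis using tot[of k] le1[of k] le2[of k] by linarith
  next
    case False
    then show ?thesis using sums len \<nu> by simp
  qed
  show "?\<mu> = \<nu> \<or> dominated \<nu> ?\<mu>"
    using dom sums by (auto simp: dominated_def)
  assume \<mu>\<nu>: "?\<mu> = \<nu>"
  have ps: "(\<Sum>i<k. \<sigma> i) = (\<Sum>i<k. n - 1 - i)" if "k \<le> n" for k
    using tot[OF that] le1[OF that] le2[OF that, unfolded \<mu>\<nu>] by linarith
  have "\<sigma> i = n - 1 - i" if "i < n" for i
    using ps[of "Suc i"] ps[of i] that by simp
  moreover from this have "?m i = nth_part \<nu> i" if "i < n" for i
    using eq[OF that] that by simp
  moreover have "?m i = 0" if "\<not> i < n" for i
    using m that by (metis in_keys_iff lessThan_iff subsetD)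
  moreover have "Poly_Mapping.lookup (Poly_Mapping.nth \<nu>) i = nth_part \<nu> i" for i
    by (simp add: nth.rep_eq nth_default_def nth_part_def)
  moreover have "nth_part \<nu> i = 0" if "\<not> i < n" for i
    using \<nu>(2) that by (simp add: nth_part_def)
  ultimately have "?m i = Poly_Mapping.lookup (Poly_Mapping.nth \<nu>) i" for i
    by (cases "i < n") simp_all
  then show "m = Poly_Mapping.nth \<nu> \<and> (\<forall>i<n. \<sigma> i = n - 1 - i)"
    using \<open>\<And>i. i < n \<Longrightarrow> \<sigma> i = n - 1 - i\<close> by (simp add: poly_mapping_eqI)
qed


section \<open>Independence of monomial functions\<close>

text \<open>Natural number coordinates make sense in every field of characteristic 0 and are
  unchanged by \<open>at_q0\<close>. Distinct nonzero coordinates make the Vandermonde and Lagrange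
  determinants nonzero.\<close>

definition generic_points :: "nat \<Rightarrow> (nat \<Rightarrow> nat) set" where
  "generic_points n = {x. inj_on x {..<n} \<and> (\<forall>i<n. 0 < x i)}"

text \<open>Induction on the number of variables: with the first n coordinates fixed, the sum is a
  polynomial in the last one with infinitely many zeros. Several indices may share an exponent
  vector, hence the sum over a fibre of \<alpha>.\<close>

lemma monomials_independent:
  fixes c :: "'j \<Rightarrow> 'a::field_char_0"
  assumes "finite J"
    and "\<And>x. x \<in> generic_points n \<Longrightarrow> (\<Sum>j\<in>J. c j * (\<Prod>i<n. of_nat (x i) ^ \<alpha> j i)) = 0"
  shows "(\<Sum>j | j \<in> J \<and> (\<forall>i<n. \<alpha> j i = \<beta> i). c j) = 0"
  using assms
proof (induction n arbitrary: J)
  case 0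
  have "(\<lambda>_. 1) \<in> generic_points 0" by (simp add: generic_points_def)
  from 0(2)[OF this] show ?case by simp
next
  case (Suc n)
  let ?J = "{j \<in> J. \<alpha> j n = \<beta> n}"
  have "(\<Sum>j\<in>?J. c j * (\<Prod>i<n. of_nat (x i) ^ \<alpha> j i)) = 0" if x: "x \<in> generic_points n" for x
  proof -
    define p where "p = (\<Sum>j\<in>J. monom (c j * (\<Prod>i<n. of_nat (x i) ^ \<alpha> j i)) (\<alpha> j n))"
    have "poly p (of_nat k) = 0" if k: "k \<notin> x ` {..<n}" "k > 0" for k
    proof -
      have "x(n := k) \<in> generic_points (Suc n)"
      proof -
        have "inj_on (x(n := k)) {..<n}"
          by (rule inj_on_fun_updI) (use x k in \<open>simp_all add: generic_points_def\<close>)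
        moreover have "(x(n := k)) ` {..<n} = x ` {..<n}" by (rule image_cong) auto
        ultimately show ?thesis
          using x k by (simp add: generic_points_def lessThan_Suc)
      qed
      from Suc.prems(2)[OF this] show ?thesis
        by (simp add: p_def poly_sum poly_monom mult.assoc)
    qed
    then have "of_nat ` ({0<..} - x ` {..<n}) \<subseteq> {y. poly p y = 0}" by auto
    moreover have "infinite (of_nat ` ({0<..} - x ` {..<n}) :: 'a set)"
      by (subst finite_image_iff) (auto simp: inj_on_def infinite_Ioi)
    ultimately have "p = 0"
      using poly_roots_finite finite_subset by blast
    then have "coeff p (\<beta> n) = 0" by simp
    then show ?thesis
      using Suc.prems(1)
      by (simp add: p_def coeff_sum sum.inter_filter coeff_monom if_distrib cong: if_cong)
  qed
  from Suc.IH[OF _ this] Suc.prems(1)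
  have "(\<Sum>j | j \<in> ?J \<and> (\<forall>i<n. \<alpha> j i = \<beta> i). c j) = 0" by simp
  moreover have "{j. j \<in> ?J \<and> (\<forall>i<n. \<alpha> j i = \<beta> i)} = {j. j \<in> J \<and> (\<forall>i<Suc n. \<alpha> j i = \<beta> i)}"
    by (auto simp: less_Suc_eq)
  ultimately show ?case by simp
qed

lemma evl_zero_imp_monomial_coeff:
  fixes F :: "'a::field_char_0 symfun"
  assumes "\<And>x. x \<in> generic_points n \<Longrightarrow> evl n (\<lambda>i. of_nat (x i)) F = 0"
    and "is_partition \<nu>" "length \<nu> \<le> n"
  shows "monomial_coeff F \<nu> = 0"
proof -
  obtain D where D: "\<And>m. scoeff F m \<noteq> 0 \<Longrightarrow> mdeg m \<le> D" using obtain_degree_bound[of F] by blast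
  \<comment> \<open>E also bounds the size of \<nu>, so the monomial of \<nu> is among the summands
    even if its coefficient is 0.\<close>
  define E where "E = max D (sum_list \<nu>)"
  have E: "mdeg m \<le> E" if "scoeff F m \<noteq> 0" for m using D[OF that] by (simp add: E_def)
  have "(\<Sum>m | m \<in> mons n E \<and> (\<forall>i<n. Poly_Mapping.lookup m i = nth_part \<nu> i). scoeff F m) = 0"
    by (rule monomials_independent[OF finite_mons])
      (use assms(1) in \<open>simp add: evl_mons[OF E] mon_eval_def\<close>)
  moreover have "{m. m \<in> mons n E \<and> (\<forall>i<n. Poly_Mapping.lookup m i = nth_part \<nu> i)} = {Poly_Mapping.nth \<nu>}"
  proof (intro equalityI subsetI)
    fix m assume m: "m \<in> {m. m \<in> mons n E \<and> (\<forall>i<n. Poly_Mapping.lookup m i = nth_part \<nu> i)}"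
    have "Poly_Mapping.lookup m i = Poly_Mapping.lookup (Poly_Mapping.nth \<nu>) i" for i
    proof (cases "i < n")
      case True
      then show ?thesis using m by (simp add: nth.rep_eq nth_default_def nth_part_def)
    next
      case False
      then have "Poly_Mapping.lookup m i = 0"
        using m unfolding mons_def by (metis (mono_tags, lifting) in_keys_iff lessThan_iff mem_Collect_eq subsetD)
      then show ?thesis using False assms(3) by (simp add: nth.rep_eq nth_default_def)
    qed
    then show "m \<in> {Poly_Mapping.nth \<nu>}" by (simp add: poly_mapping_eqI)
  next
    fix m assume "m \<in> {Poly_Mapping.nth \<nu>}"
    then show "m \<in> {m. m \<in> mons n E \<and> (\<forall>i<n. Poly_Mapping.lookup m i = nth_part \<nu> i)}"
      using assms(2,3)
      by (auto simp: mons_def mdeg_nth E_def nth.rep_eq nth_default_def nth_part_def keys_nth_eq simp del: keys_nth)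
  qed
  ultimately show ?thesis by (simp add: monomial_coeff_def)
qed


section \<open>Shift operators\<close>

definition vdm :: "nat \<Rightarrow> (nat \<Rightarrow> 'a) \<Rightarrow> 'a::comm_ring_1" where
  "vdm n x = det (mat n n (\<lambda>(i, j). x i ^ j))"

lemma vdm_expand: "vdm n x = (\<Sum>\<sigma> | \<sigma> permutes {0..<n}. signof \<sigma> * (\<Prod>i<n. x i ^ \<sigma> i))"
proof -
  have "(\<Prod>i = 0..<n. mat n n (\<lambda>(i, j). x i ^ j) $$ (i, \<sigma> i)) = (\<Prod>i<n. x i ^ \<sigma> i)"
    if "\<sigma> permutes {0..<n}" for \<sigma>
  proof -
    have "\<sigma> i < n" if "i < n" for i
      using permutes_in_image[OF \<open>\<sigma> permutes {0..<n}\<close>, of i] that by simp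
    then show ?thesis by (intro prod.cong) auto
  qed
  then show ?thesis
    unfolding vdm_def by (subst det_def'[of _ n]) auto
qed

definition shift :: "'a \<Rightarrow> nat set \<Rightarrow> (nat \<Rightarrow> 'a) \<Rightarrow> nat \<Rightarrow> 'a::comm_ring_1" where
  "shift c I x = (\<lambda>i. if i \<in> I then c * x i else x i)"

text \<open>This is a(x) times the value of D(X) f at x. Keeping the factor a(x) avoids a division,
  so the expression makes sense in any commutative ring and at q = 0.\<close>

definition shift_sum ::
    "'a \<Rightarrow> 'a \<Rightarrow> nat \<Rightarrow> 'a \<Rightarrow> ((nat \<Rightarrow> 'a) \<Rightarrow> 'a) \<Rightarrow> (nat \<Rightarrow> 'a) \<Rightarrow> 'a::comm_ring_1" where
  "shift_sum q t n X f x =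
     (\<Sum>I\<in>Pow {..<n}. X ^ card I * vdm n (shift t I x) * f (shift q I x))"

text \<open>Each variable is independently left alone, with weight 1, or shifted, with weight X t^a
  q^b; the sum over subsets therefore factors.\<close>

lemma sum_shift_monomials:
  fixes x :: "nat \<Rightarrow> 'a::comm_ring_1"
  shows "(\<Sum>I\<in>Pow {..<n}. X ^ card I * (\<Prod>i<n. shift t I x i ^ a i) * (\<Prod>i<n. shift q I x i ^ b i))
    = (\<Prod>i<n. 1 + X * t ^ a i * q ^ b i) * (\<Prod>i<n. x i ^ (a i + b i))"
proof -
  have "X ^ card I * (\<Prod>i<n. shift t I x i ^ a i) * (\<Prod>i<n. shift q I x i ^ b i)
      = (\<Prod>i\<in>I. X * t ^ a i * q ^ b i) * (\<Prod>i<n. x i ^ (a i + b i))" if I: "I \<in> Pow {..<n}" for I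
  proof -
    have "(\<Prod>i\<in>I. X * t ^ a i * q ^ b i) = (\<Prod>i<n. if i \<in> I then X * t ^ a i * q ^ b i else 1)"
      using I by (simp add: prod.If_cases Int_absorb1)
    moreover have "X ^ card I = (\<Prod>i<n. if i \<in> I then X else 1)"
      using I by (simp add: prod.If_cases Int_absorb1)
    ultimately show ?thesis
      by (simp only: prod.distrib[symmetric])
        (rule prod.cong, auto simp: shift_def power_mult_distrib power_add)
  qed
  then have "(\<Sum>I\<in>Pow {..<n}. X ^ card I * (\<Prod>i<n. shift t I x i ^ a i) * (\<Prod>i<n. shift q I x i ^ b i))
      = (\<Sum>I\<in>Pow {..<n}. \<Prod>i\<in>I. X * t ^ a i * q ^ b i) * (\<Prod>i<n. x i ^ (a i + b i))"
    by (simp add: sum_distrib_right)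
  also have "(\<Sum>I\<in>Pow {..<n}. \<Prod>i\<in>I. X * t ^ a i * q ^ b i) = (\<Prod>i<n. X * t ^ a i * q ^ b i + 1)"
    by (subst prod_add) auto
  finally show ?thesis by (simp add: add.commute)
qed

lemma vdm_evl:
  assumes "\<And>m. scoeff F m \<noteq> 0 \<Longrightarrow> mdeg m \<le> D"
  shows "vdm n x * evl n x F = (\<Sum>(\<sigma>, m)\<in>{\<sigma>. \<sigma> permutes {0..<n}} \<times> mons n D.
    signof \<sigma> * scoeff F m * (\<Prod>i<n. x i ^ (\<sigma> i + Poly_Mapping.lookup m i)))"
proof -
  have *: "evl n x F = (\<Sum>m\<in>mons n D. scoeff F m * mon_eval n x m)"
    by (rule evl_mons) (rule assms)
  show ?thesis
    unfolding vdm_expand * sum_product sum.cartesian_product mon_eval_def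
    by (rule sum.cong) (auto simp: power_add prod.distrib mult_ac)
qed

lemma shift_sum_evl:
  assumes D: "\<And>m. scoeff F m \<noteq> 0 \<Longrightarrow> mdeg m \<le> D"
  shows "shift_sum q t n X (\<lambda>y. evl n y F) x = (\<Sum>(\<sigma>, m)\<in>{\<sigma>. \<sigma> permutes {0..<n}} \<times> mons n D.
    signof \<sigma> * scoeff F m * (\<Prod>i<n. 1 + X * t ^ \<sigma> i * q ^ Poly_Mapping.lookup m i) *
      (\<Prod>i<n. x i ^ (\<sigma> i + Poly_Mapping.lookup m i)))"
proof -
  have *: "evl n y F = (\<Sum>m\<in>mons n D. scoeff F m * mon_eval n y m)" for y
    by (rule evl_mons) (rule D)
  have "vdm n (shift t I x) * evl n (shift q I x) F = (\<Sum>(\<sigma>, m)\<in>{\<sigma>. \<sigma> permutes {0..<n}} \<times> mons n D.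
      signof \<sigma> * scoeff F m * ((\<Prod>i<n. shift t I x i ^ \<sigma> i) * (\<Prod>i<n. shift q I x i ^ Poly_Mapping.lookup m i)))"
    for I
    unfolding vdm_expand * sum_product sum.cartesian_product mon_eval_def
    by (rule sum.cong) (auto simp: mult_ac)
  then have "shift_sum q t n X (\<lambda>y. evl n y F) x = (\<Sum>I\<in>Pow {..<n}.
      \<Sum>(\<sigma>, m)\<in>{\<sigma>. \<sigma> permutes {0..<n}} \<times> mons n D. signof \<sigma> * scoeff F m *
        (X ^ card I * (\<Prod>i<n. shift t I x i ^ \<sigma> i) * (\<Prod>i<n. shift q I x i ^ Poly_Mapping.lookup m i)))"
    by (simp add: shift_sum_def mult.assoc sum_distrib_left split_def mult.left_commute)
  also have "\<dots> = (\<Sum>(\<sigma>, m)\<in>{\<sigma>. \<sigma> permutes {0..<n}} \<times> mons n D. signof \<sigma> * scoeff F m *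
      (\<Sum>I\<in>Pow {..<n}. X ^ card I * (\<Prod>i<n. shift t I x i ^ \<sigma> i) *
        (\<Prod>i<n. shift q I x i ^ Poly_Mapping.lookup m i)))"
    by (subst sum.swap) (simp add: sum_distrib_left split_def)
  finally show ?thesis
    unfolding sum_shift_monomials by (simp add: mult.assoc)
qed

text \<open>
  The coefficient of \<open>x\<^bsup>\<nu>+\<delta>\<^esup>\<close>, where \<open>\<delta> = (n-1,\<dots>,0)\<close>, in the alternants above; \<open>w\<close> is the
  eigenvalue factor.
\<close>

definition alternant_coeff ::
    "nat \<Rightarrow> nat \<Rightarrow> ((nat \<Rightarrow> nat) \<Rightarrow> mon \<Rightarrow> 'a) \<Rightarrow> 'a symfun \<Rightarrow> nat list \<Rightarrow> 'a::comm_ring_1" where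
  "alternant_coeff n D w F \<nu> =
     (\<Sum>(\<sigma>, m) | \<sigma> permutes {0..<n} \<and> m \<in> mons n D \<and>
         (\<forall>i<n. \<sigma> i + Poly_Mapping.lookup m i = (n - 1 - i) + nth_part \<nu> i).
       signof \<sigma> * scoeff F m * w \<sigma> m)"

definition flip :: "nat \<Rightarrow> nat \<Rightarrow> nat" where
  "flip n i = (if i < n then n - 1 - i else i)"

lemma flip_permutes: "flip n permutes {0..<n}"
proof (rule bij_imp_permutes)
  show "bij_betw (flip n) {0..<n} {0..<n}"
    by (rule bij_betw_byWitness[where f' = "flip n"]) (auto simp: flip_def)
qed (simp add: flip_def)

text \<open>By \<open>leading_exponent\<close>, any other pair (\<sigma>, m) contributing to this
  exponent has a monomial whose partition strictly dominates \<nu>, and F contains none.\<close>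

lemma alternant_coeff_leading:
  assumes \<nu>: "is_partition \<nu>" "length \<nu> \<le> n" "sum_list \<nu> \<le> D"
    and max: "\<And>\<mu>. is_partition \<mu> \<Longrightarrow> monomial_coeff F \<mu> \<noteq> 0 \<Longrightarrow> \<not> dominated \<nu> \<mu>"
  shows "alternant_coeff n D w F \<nu>
    = signof (flip n) * monomial_coeff F \<nu> * w (flip n) (Poly_Mapping.nth \<nu>)"
proof -
  let ?S = "{(\<sigma>, m). \<sigma> permutes {0..<n} \<and> m \<in> mons n D \<and>
         (\<forall>i<n. \<sigma> i + Poly_Mapping.lookup m i = (n - 1 - i) + nth_part \<nu> i)}"
  have fin: "finite ?S"
    by (rule finite_subset[of _ "{\<sigma>. \<sigma> permutes {0..<n}} \<times> mons n D"])
      (auto simp: finite_permutations)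
  have "alternant_coeff n D w F \<nu> = (\<Sum>(\<sigma>, m)\<in>{(flip n, Poly_Mapping.nth \<nu>)}. signof \<sigma> * scoeff F m * w \<sigma> m)"
    unfolding alternant_coeff_def
  proof (rule sum.mono_neutral_right[OF fin])
    show "{(flip n, Poly_Mapping.nth \<nu>)} \<subseteq> ?S"
      using \<nu> by (auto simp: flip_permutes mons_def mdeg_nth keys_nth_eq flip_def nth.rep_eq
          nth_default_def nth_part_def simp del: keys_nth)
    show "\<forall>p\<in>?S - {(flip n, Poly_Mapping.nth \<nu>)}. (case p of (\<sigma>, m) \<Rightarrow> signof \<sigma> * scoeff F m * w \<sigma> m) = 0"
    proof
      fix p assume p: "p \<in> ?S - {(flip n, Poly_Mapping.nth \<nu>)}"
      obtain \<sigma> m where \<sigma>m: "p = (\<sigma>, m)" by (cases p)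
      have *: "(\<sigma>, m) \<notin> {(flip n, Poly_Mapping.nth \<nu>)}" "\<sigma> permutes {0..<n}" "m \<in> mons n D"
        "\<forall>i<n. \<sigma> i + Poly_Mapping.lookup m i = (n - 1 - i) + nth_part \<nu> i"
        using p by (auto simp: \<sigma>m)
      have m: "Poly_Mapping.keys m \<subseteq> {..<n}" using *(3) by (simp add: mons_def)
      have "partition_of_mon m \<noteq> \<nu>"
      proof
        assume "partition_of_mon m = \<nu>"
        then have "m = Poly_Mapping.nth \<nu>" "\<forall>i<n. \<sigma> i = n - 1 - i"
          using leading_exponent(2)[OF *(2) m \<nu>(1,2)] *(4) by auto
        moreover from this(2) have "\<sigma> = flip n"
          using *(2) by (auto simp: flip_def permutes_def)
        ultimately show False using *(1) by simp
      qed
      then have "dominated \<nu> (partition_of_mon m)"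
        using leading_exponent(1)[OF *(2) m \<nu>(1,2)] *(4) by auto
      then have "scoeff F m = 0"
        using max[of "partition_of_mon m"] by (auto simp: scoeff_eq_monomial_coeff[of F m])
      then show "(case p of (\<sigma>, m) \<Rightarrow> signof \<sigma> * scoeff F m * w \<sigma> m) = 0" by (simp add: \<sigma>m)
    qed
  qed
  then show ?thesis by (simp add: monomial_coeff_def)
qed

lemma alternant_coeff_nonzero:
  assumes \<nu>: "is_partition \<nu>" "length \<nu> \<le> n" and nz: "alternant_coeff n D w F \<nu> \<noteq> 0"
  obtains \<mu> where "is_partition \<mu>" "monomial_coeff F \<mu> \<noteq> 0" "\<mu> = \<nu> \<or> dominated \<nu> \<mu>"
proof -
  obtain \<sigma> m where *: "\<sigma> permutes {0..<n}" "m \<in> mons n D"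
      "\<forall>i<n. \<sigma> i + Poly_Mapping.lookup m i = (n - 1 - i) + nth_part \<nu> i"
      "signof \<sigma> * scoeff F m * w \<sigma> m \<noteq> 0"
    using nz unfolding alternant_coeff_def by (force elim: sum.not_neutral_contains_not_neutral)
  have "Poly_Mapping.keys m \<subseteq> {..<n}" using *(2) by (simp add: mons_def)
  then have "partition_of_mon m = \<nu> \<or> dominated \<nu> (partition_of_mon m)"
    using leading_exponent(1)[OF *(1) _ \<nu>] *(3) by auto
  moreover have "monomial_coeff F (partition_of_mon m) \<noteq> 0"
    using *(4) by (auto simp: scoeff_eq_monomial_coeff[of F m])
  ultimately show thesis by (intro that[OF is_partition_partition_of_mon])
qed

text \<open>Converts an identity between values at all generic points into one between coefficients.
  A whole family L is treated at once because the kernel is a sum of products in two sets of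
  variables, and for one fixed set the values become the scalars u and v.\<close>

lemma alternant_coeffs_eq:
  fixes P :: "'i \<Rightarrow> 'a::field_char_0 symfun"
  assumes fin: "finite L"
    and D: "\<And>l m. l \<in> L \<Longrightarrow> scoeff (P l) m \<noteq> 0 \<Longrightarrow> mdeg m \<le> D"
    and eq: "\<And>x. x \<in> generic_points n \<Longrightarrow>
      (\<Sum>l\<in>L. u l * shift_sum q t n X (\<lambda>y. evl n y (P l)) (\<lambda>i. of_nat (x i)))
      = (\<Sum>l\<in>L. v l * (vdm n (\<lambda>i. of_nat (x i)) * evl n (\<lambda>i. of_nat (x i)) (P l)))"
  shows "(\<Sum>l\<in>L. u l * alternant_coeff n D (\<lambda>\<sigma> m. \<Prod>i<n. 1 + X * t ^ \<sigma> i * q ^ Poly_Mapping.lookup m i) (P l) \<nu>)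
    = (\<Sum>l\<in>L. v l * alternant_coeff n D (\<lambda>_ _. 1) (P l) \<nu>)"
proof -
  let ?S = "{\<sigma>. \<sigma> permutes {0..<n}} \<times> mons n D"
  let ?w = "\<lambda>\<sigma> m. \<Prod>i<n. 1 + X * t ^ \<sigma> i * q ^ Poly_Mapping.lookup m i"
  let ?c = "\<lambda>(l, \<sigma>, m). signof \<sigma> * scoeff (P l) m * (u l * ?w \<sigma> m - v l)"
  let ?\<alpha> = "\<lambda>(l, \<sigma>, m) i. \<sigma> i + Poly_Mapping.lookup m i"
  let ?\<beta> = "\<lambda>i. (n - 1 - i) + nth_part \<nu> i"
  let ?T = "{(\<sigma>, m). \<sigma> permutes {0..<n} \<and> m \<in> mons n D \<and> (\<forall>i<n. \<sigma> i + Poly_Mapping.lookup m i = ?\<beta> i)}"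
  have finS: "finite ?S" by (simp add: finite_permutations)
  have "(\<Sum>j | j \<in> L \<times> ?S \<and> (\<forall>i<n. ?\<alpha> j i = ?\<beta> i). ?c j) = 0"
  proof (rule monomials_independent)
    show "finite (L \<times> ?S)" using fin finS by simp
    fix x assume x: "x \<in> generic_points n"
    let ?x = "\<lambda>i. of_nat (x i) :: 'a"
    have 1: "u l * shift_sum q t n X (\<lambda>y. evl n y (P l)) ?x - v l * (vdm n ?x * evl n ?x (P l))
        = (\<Sum>s\<in>?S. ?c (l, s) * (\<Prod>i<n. ?x i ^ ?\<alpha> (l, s) i))" if l: "l \<in> L" for l
    proof -
      note shift_sum_evl[of "P l" D q t n X ?x, OF D[OF l]] vdm_evl[of "P l" D n ?x, OF D[OF l]]
      then show ?thesis
        by (simp add: sum_distrib_left sum_subtractf[symmetric])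
          (rule sum.cong, auto simp: algebra_simps)
    qed
    have "(\<Sum>j\<in>L \<times> ?S. ?c j * (\<Prod>i<n. ?x i ^ ?\<alpha> j i)) = (\<Sum>l\<in>L. \<Sum>s\<in>?S. ?c (l, s) * (\<Prod>i<n. ?x i ^ ?\<alpha> (l, s) i))"
      by (subst sum.cartesian_product) (rule sum.cong, auto)
    also have "\<dots> = (\<Sum>l\<in>L. u l * shift_sum q t n X (\<lambda>y. evl n y (P l)) ?x - v l * (vdm n ?x * evl n ?x (P l)))"
      by (rule sum.cong[OF refl]) (simp only: 1)
    also have "\<dots> = 0" using eq[OF x] by (simp add: sum_subtractf)
    finally show "(\<Sum>j\<in>L \<times> ?S. ?c j * (\<Prod>i<n. ?x i ^ ?\<alpha> j i)) = 0" .
  qed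
  moreover have "{j. j \<in> L \<times> ?S \<and> (\<forall>i<n. ?\<alpha> j i = ?\<beta> i)} = L \<times> ?T" by auto
  ultimately have "(\<Sum>j\<in>L \<times> ?T. ?c j) = 0" by simp
  then have "(\<Sum>l\<in>L. \<Sum>s\<in>?T. ?c (l, s)) = 0"
    by (subst sum.cartesian_product) (simp add: split_def)
  moreover have "(\<Sum>s\<in>?T. ?c (l, s)) = u l * alternant_coeff n D ?w (P l) \<nu>
      - v l * alternant_coeff n D (\<lambda>_ _. 1) (P l) \<nu>" for l
    unfolding alternant_coeff_def sum_distrib_left sum_subtractf[symmetric]
    by (rule sum.cong) (auto simp: algebra_simps)
  ultimately show ?thesis by (simp add: sum_subtractf)
qed


section \<open>Exponential generating series of power sums\<close>

text \<open>The degree \<open>d\<close> part of \<open>exp (\<Sum>\<^sub>r g\<^sub>r / r)\<close>; the scalars \<open>1 / z\<^sub>\<nu>\<close> are embedded by \<open>\<iota>\<close>.\<close>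

definition cauchy_sum :: "('k::field_char_0 \<Rightarrow> 'r::comm_ring_1) \<Rightarrow> (nat \<Rightarrow> 'r) \<Rightarrow> nat \<Rightarrow> 'r" where
  "cauchy_sum \<iota> g d = (\<Sum>\<nu>\<in>partitions_of d. \<iota> (1 / of_nat (zee \<nu>)) * prod_list (map g \<nu>))"

definition part_insert :: "nat \<Rightarrow> nat list \<Rightarrow> nat list" where
  "part_insert r \<nu> = rev (insort r (rev \<nu>))"

lemma mset_part_insert [simp]: "mset (part_insert r \<nu>) = add_mset r (mset \<nu>)"
  by (simp add: part_insert_def)

lemma is_partition_part_insert: "is_partition \<nu> \<Longrightarrow> r > 0 \<Longrightarrow> is_partition (part_insert r \<nu>)"
  by (auto simp: is_partition_sorted_rev part_insert_def sorted_insort set_insort_key)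

lemma sorted_wrt_remove1: "sorted_wrt P xs \<Longrightarrow> sorted_wrt P (remove1 a xs)"
  by (induction xs) (auto dest: notin_set_remove1)

lemma is_partition_remove1: "is_partition \<nu> \<Longrightarrow> is_partition (remove1 r \<nu>)"
  unfolding is_partition_def by (metis notin_set_remove1 sorted_wrt_remove1)

lemma sum_list_part_insert [simp]: "sum_list (part_insert r \<nu>) = r + sum_list \<nu>"
  by (simp add: sum_mset_sum_list[symmetric])

lemma sum_list_remove1: "r \<in> set \<nu> \<Longrightarrow> sum_list (remove1 r \<nu>) = sum_list \<nu> - (r::nat)"
proof -
  assume "r \<in> set \<nu>"
  then have "r + sum_list (remove1 r \<nu>) = sum_list \<nu>" by (induction \<nu>) auto
  then show ?thesis by linarith
qed

lemma prod_list_map_remove1: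
  "r \<in> set \<nu> \<Longrightarrow> prod_list (map g \<nu>) = g r * prod_list (map g (remove1 r \<nu>) :: 'a::comm_monoid_mult list)"
  by (induction \<nu>) (auto simp: mult_ac)

lemma zee_superset:
  assumes "finite A" "set \<nu> \<subseteq> A"
  shows "zee \<nu> = (\<Prod>i\<in>A. i ^ count_list \<nu> i * fact (count_list \<nu> i))"
  unfolding zee_def
  by (rule prod.mono_neutral_left) (use assms in \<open>auto simp: count_list_0_iff\<close>)

lemma zee_remove1:
  assumes "r \<in> set \<nu>"
  shows "zee \<nu> = r * count_list \<nu> r * zee (remove1 r \<nu>)"
proof -
  have c: "count_list (remove1 r \<nu>) i = (if i = r then count_list \<nu> r - 1 else count_list \<nu> i)" for i
    by (simp flip: count_mset)
  obtain k where k: "count_list \<nu> r = Suc k"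
    using assms by (metis count_list_0_iff not0_implies_Suc)
  have 1: "zee \<nu> = (r ^ Suc k * fact (Suc k)) * (\<Prod>i\<in>set \<nu> - {r}. i ^ count_list \<nu> i * fact (count_list \<nu> i))"
    unfolding zee_def using assms k by (subst prod.remove[of _ r]) auto
  have "zee (remove1 r \<nu>) = (\<Prod>i\<in>set \<nu>. i ^ count_list (remove1 r \<nu>) i * fact (count_list (remove1 r \<nu>) i))"
    by (rule zee_superset[OF _ set_remove1_subset]) simp
  then have 2: "zee (remove1 r \<nu>) = (r ^ k * fact k) * (\<Prod>i\<in>set \<nu> - {r}. i ^ count_list \<nu> i * fact (count_list \<nu> i))"
    using assms by (subst (asm) prod.remove[of _ r]) (auto simp: c k)
  show ?thesis unfolding 1 2 k by (simp only: power_Suc fact_Suc of_nat_id mult_ac)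
qed

lemma zee_pos: "is_partition \<nu> \<Longrightarrow> zee \<nu> > 0"
  unfolding zee_def by (rule prod_pos) (auto dest: is_partition_pos)

lemma partitions_of_0: "partitions_of 0 = {[]}"
proof -
  have "\<nu> = []" if "is_partition \<nu>" "sum_list \<nu> = 0" for \<nu>
    using length_le_sum_list[of \<nu>] that(1) unfolding that(2) by (simp add: is_partition_def)
  then show ?thesis by (auto simp: partitions_of_def is_partition_def)
qed

locale scalar_hom =
  fixes \<iota> :: "'k::field_char_0 \<Rightarrow> 'r::comm_ring_1"
  assumes hom_add: "\<iota> (a + b) = \<iota> a + \<iota> b"
    and hom_mult: "\<iota> (a * b) = \<iota> a * \<iota> b"
    and hom_one: "\<iota> 1 = 1"
begin

lemma hom_zero: "\<iota> 0 = 0"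
  using hom_add[of 0 0] by simp

lemma hom_of_nat: "\<iota> (of_nat n) = of_nat n"
  by (induction n) (simp_all add: hom_add hom_one hom_zero)

text \<open>Positive integers are invertible in the target ring, their inverses being images under
  \<open>\<iota>\<close>.\<close>

lemma torsion_free:
  fixes a b :: 'r
  shows "n > 0 \<Longrightarrow> of_nat n * a = of_nat n * b \<Longrightarrow> a = b"
proof -
  assume n: "n > 0" and eq: "of_nat n * a = of_nat n * b"
  have 1: "\<iota> (1 / of_nat n) * of_nat n = 1"
    using n hom_mult[of "1 / of_nat n" "of_nat n"] by (simp add: hom_of_nat hom_one)
  have "\<iota> (1 / of_nat n) * of_nat n * a = \<iota> (1 / of_nat n) * of_nat n * b"
    using eq by (simp add: mult.assoc)
  then show "a = b" by (simp add: 1)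
qed

lemma cauchy_sum_0 [simp]: "cauchy_sum \<iota> g 0 = 1"
  by (simp add: cauchy_sum_def partitions_of_0 zee_def hom_one)

text \<open>Logarithmic differentiation of exp(sum_r g_r x^r / r). On partitions: write d as the sum
  of r m_r over the distinct parts r, and delete one part r, using that z_\<nu> is r m_r times the z
  of the shorter partition.\<close>

lemma cauchy_sum_rec: "of_nat d * cauchy_sum \<iota> g d = (\<Sum>r=1..d. g r * cauchy_sum \<iota> g (d - r))"
proof -
  have *: "of_nat d * (\<iota> (1 / of_nat (zee \<nu>)) * prod_list (map g \<nu>))
      = (\<Sum>r\<in>set \<nu>. g r * (\<iota> (1 / of_nat (zee (remove1 r \<nu>))) * prod_list (map g (remove1 r \<nu>))))"
    if \<nu>: "\<nu> \<in> partitions_of d" for \<nu>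
  proof -
    have d: "d = (\<Sum>r\<in>set \<nu>. r * count_list \<nu> r)"
      using \<nu> sum_list_map_eq_sum_count[of "\<lambda>x. x" \<nu>] by (simp add: partitions_of_def mult.commute)
    have "of_nat (r * count_list \<nu> r) * (\<iota> (1 / of_nat (zee \<nu>)) * prod_list (map g \<nu>))
        = g r * (\<iota> (1 / of_nat (zee (remove1 r \<nu>))) * prod_list (map g (remove1 r \<nu>)))"
      if r: "r \<in> set \<nu>" for r
    proof -
      have pos: "zee \<nu> > 0" using \<nu> by (simp add: zee_pos partitions_of_def)
      have "of_nat (r * count_list \<nu> r) * \<iota> (1 / of_nat (zee \<nu>))
          = \<iota> (of_nat (r * count_list \<nu> r) * (1 / of_nat (zee \<nu>)))"
        by (simp only: hom_mult hom_of_nat)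
      also have "of_nat (r * count_list \<nu> r) * (1 / of_nat (zee \<nu>)) = 1 / (of_nat (zee (remove1 r \<nu>)) :: 'k)"
        using pos unfolding zee_remove1[OF r] by simp
      finally show ?thesis
        unfolding prod_list_map_remove1[OF r, of g] by (simp only: mult_ac)
    qed
    then show ?thesis
      by (subst d) (simp only: of_nat_sum sum_distrib_right cong: sum.cong)
  qed
  have "of_nat d * cauchy_sum \<iota> g d = (\<Sum>\<nu>\<in>partitions_of d. \<Sum>r\<in>set \<nu>.
      g r * (\<iota> (1 / of_nat (zee (remove1 r \<nu>))) * prod_list (map g (remove1 r \<nu>))))"
    unfolding cauchy_sum_def sum_distrib_left by (rule sum.cong[OF refl *])
  also have "\<dots> = (\<Sum>(\<nu>, r)\<in>Sigma (partitions_of d) set.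
      g r * (\<iota> (1 / of_nat (zee (remove1 r \<nu>))) * prod_list (map g (remove1 r \<nu>))))"
    by (subst sum.Sigma) auto
  also have "\<dots> = (\<Sum>(r, \<nu>)\<in>Sigma {1..d} (\<lambda>r. partitions_of (d - r)).
      g r * (\<iota> (1 / of_nat (zee \<nu>)) * prod_list (map g \<nu>)))"
  proof (rule sum.reindex_bij_witness
      [where i = "\<lambda>(r, \<nu>). (part_insert r \<nu>, r)" and j = "\<lambda>(\<nu>, r). (r, remove1 r \<nu>)"], goal_cases)
    case (1 a)
    obtain \<nu> r where a: "a = (\<nu>, r)" by (cases a)
    have r: "r \<in> set \<nu>" "is_partition \<nu>" "r > 0"
      using 1 by (auto simp: a partitions_of_def dest: is_partition_pos)
    have "part_insert r (remove1 r \<nu>) = \<nu>"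
      by (rule partition_eqI) (use r in \<open>auto intro: is_partition_part_insert is_partition_remove1\<close>)
    then show ?case by (simp add: a)
  next
    case (2 a)
    then obtain \<nu> r where a: "a = (\<nu>, r)" "r \<in> set \<nu>" "is_partition \<nu>" "sum_list \<nu> = d"
      by (auto simp: partitions_of_def)
    have "r > 0" "r \<le> d" using a is_partition_pos[of \<nu> r] member_le_sum_list[of r \<nu>] by auto
    then show ?case
      using a by (auto simp: partitions_of_def is_partition_remove1 sum_list_remove1)
  next
    case (3 b)
    then obtain \<nu> r where b: "b = (r, \<nu>)" "is_partition \<nu>" "0 < r" by (auto simp: partitions_of_def)
    have "remove1 r (part_insert r \<nu>) = \<nu>"
      by (rule partition_eqI) (use b in \<open>auto intro: is_partition_part_insert is_partition_remove1\<close>)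
    then show ?case by (simp add: b)
  next
    case (4 b)
    then obtain \<nu> r where b: "b = (r, \<nu>)" "is_partition \<nu>" "0 < r" "r \<le> d" "sum_list \<nu> = d - r"
      by (auto simp: partitions_of_def)
    have "r \<in> set (part_insert r \<nu>)"
      by (metis mset_part_insert set_mset_mset union_single_eq_member add_mset_add_single)
    then show ?case
      using b by (auto simp: partitions_of_def is_partition_part_insert)
  qed auto
  also have "\<dots> = (\<Sum>r=1..d. g r * cauchy_sum \<iota> g (d - r))"
    unfolding cauchy_sum_def sum_distrib_left by (subst sum.Sigma) auto
  finally show ?thesis .
qed

lemma cauchy_sum_unique:
  assumes "f 0 = 1" "\<And>d. of_nat d * f d = (\<Sum>r=1..d. g r * f (d - r))"
  shows "cauchy_sum \<iota> g d = f d"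
proof (induction d rule: less_induct)
  case (less d)
  show ?case
  proof (cases "d = 0")
    case False
    have "of_nat d * cauchy_sum \<iota> g d = of_nat d * f d"
      unfolding assms(2) cauchy_sum_rec by (rule sum.cong) (use less in auto)
    then show ?thesis using False torsion_free by blast
  qed (simp add: assms)
qed

lemma cauchy_sum_cong: "(\<And>r. r > 0 \<Longrightarrow> g r = h r) \<Longrightarrow> cauchy_sum \<iota> g = cauchy_sum \<iota> h"
  unfolding cauchy_sum_def
  by (intro ext sum.cong refl arg_cong2[where f = "(*)"] arg_cong[where f = prod_list] map_cong)
    (auto simp: partitions_of_def dest: is_partition_pos)

section \<open>Exponential series through their logarithmic derivatives\<close>

definition cauchy_series :: "(nat \<Rightarrow> 'r) \<Rightarrow> 'r fps" where
  "cauchy_series g = Abs_fps (cauchy_sum \<iota> g)"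

lemma cauchy_series_nth [simp]: "fps_nth (cauchy_series g) d = cauchy_sum \<iota> g d"
  by (simp add: cauchy_series_def)

lemma sum_from_1: "(\<Sum>r=0..d::nat. (if r = 0 then 0 else g r) * h (d - r)) = (\<Sum>r=1..d. g r * h (d - r) :: 'r)"
  by (simp add: sum.atLeast_Suc_atMost)

lemma cauchy_series_deriv:
  "fps_X * fps_deriv (cauchy_series g) = Abs_fps (\<lambda>r. if r = 0 then 0 else g r) * cauchy_series g"
proof (rule fps_ext)
  fix d
  have "fps_nth (fps_X * fps_deriv (cauchy_series g)) d = of_nat d * cauchy_sum \<iota> g d"
    by (cases d) simp_all
  then show "fps_nth (fps_X * fps_deriv (cauchy_series g)) d
      = fps_nth (Abs_fps (\<lambda>r. if r = 0 then 0 else g r) * cauchy_series g) d"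
    by (simp add: cauchy_sum_rec fps_mult_nth sum_from_1)
qed

text \<open>The second assumption prescribes the logarithmic derivative; coefficientwise it is the
  recursion of \<open>cauchy_sum_unique\<close>.\<close>

lemma cauchy_series_unique:
  assumes "fps_nth E 0 = 1" "fps_X * fps_deriv E = Abs_fps (\<lambda>r. if r = 0 then 0 else g r) * E"
  shows "cauchy_series g = E"
proof (rule fps_ext)
  fix d
  have "of_nat d * fps_nth E d = (\<Sum>r=1..d. g r * fps_nth E (d - r))" for d
  proof -
    have "of_nat d * fps_nth E d = fps_nth (fps_X * fps_deriv E) d" by (cases d) simp_all
    also have "\<dots> = (\<Sum>r=1..d. g r * fps_nth E (d - r))"
      unfolding assms(2) by (simp add: fps_mult_nth sum_from_1)
    finally show ?thesis .
  qed
  then show "fps_nth (cauchy_series g) d = fps_nth E d"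
    using cauchy_sum_unique[of "fps_nth E" g d] assms(1) by simp
qed

lemma cauchy_series_add: "cauchy_series (\<lambda>r. g r + h r) = cauchy_series g * cauchy_series h"
proof (rule cauchy_series_unique)
  have *: "Abs_fps (\<lambda>r. if r = 0 then 0 else g r + h r)
      = Abs_fps (\<lambda>r. if r = 0 then 0 else g r) + Abs_fps (\<lambda>r. if r = 0 then 0 else h r)"
    by (rule fps_ext) simp
  have "fps_X * fps_deriv (cauchy_series g * cauchy_series h)
      = (fps_X * fps_deriv (cauchy_series g)) * cauchy_series h
        + cauchy_series g * (fps_X * fps_deriv (cauchy_series h))"
    by (simp add: algebra_simps)
  then show "fps_X * fps_deriv (cauchy_series g * cauchy_series h)
      = Abs_fps (\<lambda>r. if r = 0 then 0 else g r + h r) * (cauchy_series g * cauchy_series h)"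
    unfolding cauchy_series_deriv * by (simp add: algebra_simps)
qed simp

lemma cauchy_series_cong: "(\<And>r. r > 0 \<Longrightarrow> g r = h r) \<Longrightarrow> cauchy_series g = cauchy_series h"
  unfolding cauchy_series_def by (subst cauchy_sum_cong[of g h]) auto

lemma cauchy_series_zero: "cauchy_series (\<lambda>_. 0) = 1"
  by (rule cauchy_series_unique) (auto simp: fps_eq_iff fps_mult_nth)

lemma cauchy_series_sum: "finite A \<Longrightarrow> cauchy_series (\<lambda>r. \<Sum>i\<in>A. g i r) = (\<Prod>i\<in>A. cauchy_series (g i))"
  by (induction A rule: finite_induct) (simp_all add: cauchy_series_zero cauchy_series_add)

text \<open>exp(sum_r a^r x^r / r) = 1/(1 - a x), written as a product because the coefficients are
  only a ring.\<close>

lemma cauchy_series_geometric: "cauchy_series (\<lambda>r. a ^ r) * (1 - fps_const a * fps_X) = 1"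
proof -
  have "cauchy_sum \<iota> (\<lambda>r. a ^ r) d = a ^ d" for d
    by (rule cauchy_sum_unique) (simp_all flip: power_add)
  then show ?thesis
    by (intro fps_ext) (simp add: right_diff_distrib mult.assoc[symmetric] fps_mult_right_const_nth
        mult.commute[of _ fps_X] power_eq_if)
qed

end

lemma cauchy_sum_hom:
  assumes "\<And>a b. \<phi> (a + b) = \<phi> a + \<phi> b" "\<And>a b. \<phi> (a * b) = \<phi> a * \<phi> b" "\<phi> 1 = 1" "\<And>c. \<phi> (\<iota> c) = \<kappa> c"
  shows "\<phi> (cauchy_sum \<iota> g d) = cauchy_sum \<kappa> (\<lambda>r. \<phi> (g r)) d"
proof -
  have z: "\<phi> 0 = 0" using assms(1)[of 0 0] by simp
  have s: "\<phi> (sum f A) = (\<Sum>a\<in>A. \<phi> (f a))" for f :: "nat list \<Rightarrow> _" and A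
    by (induction A rule: infinite_finite_induct) (simp_all add: z assms)
  have p: "\<phi> (prod_list (map g \<nu>)) = prod_list (map (\<lambda>r. \<phi> (g r)) \<nu>)" for \<nu>
    by (induction \<nu>) (simp_all add: assms)
  show ?thesis by (simp add: cauchy_sum_def s p assms)
qed

interpretation field_hom: scalar_hom "\<lambda>c :: 'a::field_char_0. c"
  by standard auto


section \<open>Cauchy determinants\<close>

text \<open>Up to scalars, the Lagrange interpolation basis at the nodes 1/x_l. These products are
  what remains of a common denominator when 1/(1 - x_l w) is cleared.\<close>

definition lagrange_poly :: "nat \<Rightarrow> (nat \<Rightarrow> 'a) \<Rightarrow> nat \<Rightarrow> 'a::comm_ring_1 poly" where
  "lagrange_poly n x l = (\<Prod>m\<in>{..<n} - {l}. [:1, - x m:])"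

definition lagrange_mat :: "nat \<Rightarrow> (nat \<Rightarrow> 'a) \<Rightarrow> 'a::comm_ring_1 mat" where
  "lagrange_mat n x = mat n n (\<lambda>(l, j). coeff (lagrange_poly n x l) j)"

lemma lagrange_mat_carrier [simp]: "lagrange_mat n x \<in> carrier_mat n n"
  by (simp add: lagrange_mat_def)

lemma poly_lagrange: "poly (lagrange_poly n x l) w = (\<Prod>m\<in>{..<n} - {l}. 1 - x m * w)"
  by (simp add: lagrange_poly_def poly_prod mult.commute)

lemma degree_prod_linear: "finite A \<Longrightarrow> degree (\<Prod>m\<in>A. [:1, - x m :: 'a::comm_ring_1:]) \<le> card A"
proof (induction A rule: finite_induct)
  case (insert a A)
  have "degree ([:1, - x a:] * (\<Prod>m\<in>A. [:1, - x m:])) \<le> degree [:1, - x a:] + degree (\<Prod>m\<in>A. [:1, - x m:])"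
    by (rule degree_mult_le)
  also have "\<dots> \<le> 1 + card A"
    by (rule add_mono) (use insert in auto)
  finally show ?case using insert by simp
qed simp

lemma poly_lagrange_sum:
  assumes "l < n"
  shows "poly (lagrange_poly n x l) w = (\<Sum>j<n. coeff (lagrange_poly n x l) j * w ^ j)"
proof -
  have "degree (lagrange_poly n x l) \<le> n - 1"
    unfolding lagrange_poly_def
    using degree_prod_linear[of "{..<n} - {l}" x] assms by simp
  then show ?thesis
    unfolding poly_altdef
    by (intro sum.mono_neutral_left) (use assms in \<open>auto simp: coeff_eq_0\<close>)
qed

lemma det_mat_expand:
  "det (mat n n (\<lambda>(i, j). e i j)) = (\<Sum>\<sigma> | \<sigma> permutes {0..<n}. signof \<sigma> * (\<Prod>i<n. e i (\<sigma> i)))"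
proof -
  have "(\<Prod>i = 0..<n. mat n n (\<lambda>(i, j). e i j) $$ (i, \<sigma> i)) = (\<Prod>i<n. e i (\<sigma> i))"
    if "\<sigma> permutes {0..<n}" for \<sigma>
  proof -
    have "\<sigma> i < n" if "i < n" for i
      using permutes_in_image[OF \<open>\<sigma> permutes {0..<n}\<close>, of i] that by simp
    then show ?thesis by (intro prod.cong) auto
  qed
  then show ?thesis by (subst det_def'[of _ n]) auto
qed

lemma prod_permutes:
  fixes n :: nat
  shows "\<sigma> permutes {0..<n} \<Longrightarrow> (\<Prod>i<n. f (\<sigma> i)) = (\<Prod>i<n. f i :: 'a::comm_monoid_mult)"
proof -
  assume "\<sigma> permutes {0..<n}"
  from prod.permute[OF this, of f] show ?thesis by (simp add: lessThan_atLeast0 comp_def)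
qed

lemma det_mat_scale:
  "det (mat n n (\<lambda>(i, j). \<alpha> i * \<beta> j * e i j))
    = (\<Prod>i<n. \<alpha> i) * (\<Prod>i<n. \<beta> i) * det (mat n n (\<lambda>(i, j). e i j :: 'a::comm_ring_1))"
  unfolding det_mat_expand sum_distrib_left
  by (rule sum.cong) (auto simp: prod.distrib prod_permutes mult_ac)

text \<open>Multiplying by the Vandermonde matrix of the reciprocals evaluates the Lagrange
  polynomials at the nodes 1/x_m. Off the diagonal a factor vanishes, on the diagonal none does, so
  both determinants are nonzero.\<close>

lemma
  fixes x :: "nat \<Rightarrow> 'a::field"
  assumes "inj_on x {..<n}" "\<And>i. i < n \<Longrightarrow> x i \<noteq> 0"
  shows det_lagrange_mat_nonzero: "det (lagrange_mat n x) \<noteq> 0"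
    and vdm_inverse_nonzero: "vdm n (\<lambda>i. 1 / x i) \<noteq> 0"
proof -
  define W where "W = mat n n (\<lambda>(j, m). (1 / x m) ^ j)"
  have W: "W \<in> carrier_mat n n" by (simp add: W_def)
  have e: "(lagrange_mat n x * W) $$ (l, m) = (\<Prod>k\<in>{..<n} - {l}. 1 - x k / x m)"
    if "l < n" "m < n" for l m
  proof -
    have "(lagrange_mat n x * W) $$ (l, m) = (\<Sum>j<n. coeff (lagrange_poly n x l) j * (1 / x m) ^ j)"
      using that by (simp add: lagrange_mat_def W_def scalar_prod_def atLeast0LessThan)
    then show ?thesis using that by (simp add: poly_lagrange_sum[symmetric] poly_lagrange)
  qed
  have "upper_triangular (lagrange_mat n x * W)"
  proof
    fix i j assume ij: "j < i" "i < dim_row (lagrange_mat n x * W)"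
    then have "i < n" "j < n" by (simp_all add: lagrange_mat_def)
    moreover have "(\<Prod>k\<in>{..<n} - {i}. 1 - x k / x j) = 0"
      using ij \<open>j < n\<close> assms(2)[of j] by (intro prod_zero) (auto intro!: bexI[of _ j])
    ultimately show "(lagrange_mat n x * W) $$ (i, j) = 0" by (simp add: e)
  qed
  then have "det (lagrange_mat n x * W) = prod_list (diag_mat (lagrange_mat n x * W))"
    by (rule det_upper_triangular[of _ n]) (use mult_carrier_mat[OF lagrange_mat_carrier W] in auto)
  also have "\<dots> \<noteq> 0"
  proof -
    have "(lagrange_mat n x * W) $$ (l, l) \<noteq> 0" if "l < n" for l
    proof -
      have "x k \<noteq> x l" if "k \<in> {..<n} - {l}" for k
        using that \<open>l < n\<close> assms(1) by (auto dest: inj_onD)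
      then show ?thesis using e[OF that that] assms(2)[OF that] by auto
    qed
    then show ?thesis
      using W by (auto simp: prod_list_zero_iff diag_mat_def lagrange_mat_def)
  qed
  finally have "det (lagrange_mat n x) * det W \<noteq> 0"
    using det_mult[OF lagrange_mat_carrier[of n x] W] by auto
  moreover have "vdm n (\<lambda>i. 1 / x i) = det W"
  proof -
    have "mat n n (\<lambda>(i, j). (1 / x i) ^ j) = transpose_mat W"
      by (rule eq_matI) (simp_all add: W_def)
    then show ?thesis unfolding vdm_def using det_transpose[OF W] by simp
  qed
  ultimately show "det (lagrange_mat n x) \<noteq> 0" "vdm n (\<lambda>i. 1 / x i) \<noteq> 0" by auto
qed

lemma vdm_nonzero:
  fixes x :: "nat \<Rightarrow> 'a::field"
  assumes "inj_on x {..<n}" "\<And>i. i < n \<Longrightarrow> x i \<noteq> 0"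
  shows "vdm n x \<noteq> 0"
proof -
  have "vdm n (\<lambda>i. 1 / (1 / x i)) \<noteq> 0"
    by (rule vdm_inverse_nonzero) (use assms in \<open>auto simp: inj_on_def\<close>)
  then show ?thesis by simp
qed

text \<open>The sum over I is the determinant of M, by multilinearity in the rows. Multiplying M by
  the transposed Lagrange matrix evaluates p_l at z_i and at t z_i. With P_i the product of all 1 -
  x_l z_i, the values are P_i/(1 - x_l z_i) and, once multiplied by \<theta>_i, P_i/(1 - t x_l z_i).
  Inverses are given as a and b so that power series are covered.\<close>

lemma cauchy_shift_identity:
  fixes x z :: "nat \<Rightarrow> 'a::comm_ring_1"
  assumes a: "\<And>i l. i < n \<Longrightarrow> l < n \<Longrightarrow> a i l * (1 - x l * z i) = 1"
    and b: "\<And>i l. i < n \<Longrightarrow> l < n \<Longrightarrow> b i l * (1 - t * x l * z i) = 1"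
  shows "det (lagrange_mat n x) * (\<Sum>I\<in>Pow {..<n}. X ^ card I * vdm n (shift t I z) *
        (\<Prod>i\<in>I. \<Prod>l<n. (1 - x l * z i) * b i l))
    = (\<Prod>i<n. \<Prod>l<n. 1 - x l * z i) * det (mat n n (\<lambda>(i, l). a i l + X * b i l))"
proof -
  define \<theta> where "\<theta> = (\<lambda>i. \<Prod>l<n. (1 - x l * z i) * b i l)"
  define P where "P = (\<lambda>i. \<Prod>l<n. 1 - x l * z i)"
  define M where "M = mat n n (\<lambda>(i, j). z i ^ j * (1 + X * t ^ j * \<theta> i))"
  have "(\<Sum>I\<in>Pow {..<n}. X ^ card I * vdm n (shift t I z) * (\<Prod>i\<in>I. \<theta> i))
      = (\<Sum>\<sigma> | \<sigma> permutes {0..<n}. signof \<sigma> * (\<Sum>I\<in>Pow {..<n}. X ^ card I *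
          (\<Prod>i<n. shift t I z i ^ \<sigma> i) * (\<Prod>i\<in>I. \<theta> i)))"
    unfolding vdm_expand sum_distrib_left sum_distrib_right
    by (subst sum.swap) (intro sum.cong refl, simp add: mult_ac)
  also have "\<dots> = (\<Sum>\<sigma> | \<sigma> permutes {0..<n}. signof \<sigma> * (\<Prod>i<n. z i ^ \<sigma> i * (1 + X * t ^ \<sigma> i * \<theta> i)))"
  proof (rule sum.cong[OF refl])
    fix \<sigma>
    have 1: "X ^ card I * (\<Prod>i<n. shift t I z i ^ \<sigma> i) * (\<Prod>i\<in>I. \<theta> i)
        = (\<Prod>i\<in>I. X * t ^ \<sigma> i * \<theta> i) * (\<Prod>i<n. z i ^ \<sigma> i)" if I: "I \<in> Pow {..<n}" for I
    proof -
      have 2: "(\<Prod>i\<in>I. f i) = (\<Prod>i<n. if i \<in> I then f i else 1)" for f :: "nat \<Rightarrow> 'a"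
        using I by (simp add: prod.If_cases Int_absorb1)
      have 3: "X ^ card I = (\<Prod>i\<in>I. X)" by simp
      show ?thesis unfolding 3
        unfolding 2 prod.distrib[symmetric]
        by (rule prod.cong) (auto simp: shift_def power_mult_distrib)
    qed
    have "(\<Sum>I\<in>Pow {..<n}. X ^ card I * (\<Prod>i<n. shift t I z i ^ \<sigma> i) * (\<Prod>i\<in>I. \<theta> i))
        = (\<Sum>I\<in>Pow {..<n}. (\<Prod>i\<in>I. X * t ^ \<sigma> i * \<theta> i)) * (\<Prod>i<n. z i ^ \<sigma> i)"
      by (simp add: sum_distrib_right 1)
    also have "(\<Sum>I\<in>Pow {..<n}. (\<Prod>i\<in>I. X * t ^ \<sigma> i * \<theta> i)) = (\<Prod>i<n. X * t ^ \<sigma> i * \<theta> i + 1)"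
      by (subst prod_add) auto
    finally show "signof \<sigma> * (\<Sum>I\<in>Pow {..<n}. X ^ card I * (\<Prod>i<n. shift t I z i ^ \<sigma> i) * (\<Prod>i\<in>I. \<theta> i))
        = signof \<sigma> * (\<Prod>i<n. z i ^ \<sigma> i * (1 + X * t ^ \<sigma> i * \<theta> i))"
      by (simp add: prod.distrib add.commute mult.commute)
  qed
  also have "\<dots> = det M" unfolding M_def det_mat_expand ..
  finally have S: "(\<Sum>I\<in>Pow {..<n}. X ^ card I * vdm n (shift t I z) * (\<Prod>i\<in>I. \<theta> i)) = det M" .
  have M: "M \<in> carrier_mat n n" by (simp add: M_def)
  \<comment> \<open>The factor 1 is the trivial column scaling in the pattern of
    \<open>det_mat_scale\<close>.\<close>
  have "M * transpose_mat (lagrange_mat n x) = mat n n (\<lambda>(i, l). P i * 1 * (a i l + X * b i l))"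
  proof (rule eq_matI)
    fix i l assume "i < dim_row (mat n n (\<lambda>(i, l). P i * 1 * (a i l + X * b i l)))"
      "l < dim_col (mat n n (\<lambda>(i, l). P i * 1 * (a i l + X * b i l)))"
    then have il: "i < n" "l < n" by simp_all
    let ?p = "poly (lagrange_poly n x l)"
    have "(M * transpose_mat (lagrange_mat n x)) $$ (i, l)
        = (\<Sum>j<n. z i ^ j * (1 + X * t ^ j * \<theta> i) * coeff (lagrange_poly n x l) j)"
      using il by (simp add: M_def lagrange_mat_def scalar_prod_def atLeast0LessThan)
    also have "\<dots> = ?p (z i) + X * \<theta> i * ?p (t * z i)"
      unfolding poly_lagrange_sum[OF il(2)] sum_distrib_left sum.distrib[symmetric]
      by (rule sum.cong) (simp_all add: algebra_simps power_mult_distrib)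
    also have "?p (z i) = P i * a i l"
    proof -
      have "P i = (1 - x l * z i) * ?p (z i)"
        unfolding P_def poly_lagrange using il by (subst prod.remove[of _ l]) auto
      then have "P i * a i l = (a i l * (1 - x l * z i)) * ?p (z i)" by (simp only: mult_ac)
      then show ?thesis using a[OF il] by simp
    qed
    also have "\<theta> i * ?p (t * z i) = P i * b i l"
    proof -
      have "(\<Prod>m<n. 1 - t * x m * z i) = (1 - t * x l * z i) * ?p (t * z i)"
        unfolding poly_lagrange using il by (subst prod.remove[of _ l]) (auto simp: mult_ac)
      then have "b i l * (\<Prod>m<n. 1 - t * x m * z i) = (b i l * (1 - t * x l * z i)) * ?p (t * z i)"
        by (simp only: mult_ac)
      then have 1: "?p (t * z i) = b i l * (\<Prod>m<n. 1 - t * x m * z i)" using b[OF il] by simp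
      have "\<theta> i * (\<Prod>m<n. 1 - t * x m * z i) = (\<Prod>m<n. (1 - x m * z i) * (b i m * (1 - t * x m * z i)))"
        unfolding \<theta>_def prod.distrib[symmetric] by (simp only: mult_ac)
      also have "\<dots> = P i"
        unfolding P_def by (rule prod.cong) (use b[OF il(1)] in auto)
      finally have 2: "\<theta> i * (\<Prod>m<n. 1 - t * x m * z i) = P i" .
      have "\<theta> i * ?p (t * z i) = (\<theta> i * (\<Prod>m<n. 1 - t * x m * z i)) * b i l"
        unfolding 1 by (simp only: mult_ac)
      then show ?thesis unfolding 2 .
    qed
    then have "X * \<theta> i * ?p (t * z i) = X * (P i * b i l)" by (simp add: mult.assoc)
    finally show "(M * transpose_mat (lagrange_mat n x)) $$ (i, l)
        = mat n n (\<lambda>(i, l). P i * 1 * (a i l + X * b i l)) $$ (i, l)"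
      using il by (simp add: algebra_simps)
  qed (simp_all add: M_def lagrange_mat_def)
  then have "det M * det (transpose_mat (lagrange_mat n x))
      = det (mat n n (\<lambda>(i, l). P i * 1 * (a i l + X * b i l)))"
    using det_mult[OF M, of "transpose_mat (lagrange_mat n x)"] by simp
  then have "det M * det (lagrange_mat n x) = (\<Prod>i<n. P i) * det (mat n n (\<lambda>(i, l). a i l + X * b i l))"
    unfolding det_mat_scale det_transpose[OF lagrange_mat_carrier] by simp
  then show ?thesis
    unfolding S[unfolded \<theta>_def] P_def by (simp add: mult.commute)
qed

lemma coeff_prod_linear_fps:
  fixes y :: "nat \<Rightarrow> 'a::comm_ring_1"
  assumes "finite A"
  shows "coeff (\<Prod>m\<in>A. [:1, - (fps_X * fps_const (y m)):]) j
    = fps_X ^ j * fps_const (coeff (\<Prod>m\<in>A. [:1, - y m:]) j)"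
  using assms
proof (induction A arbitrary: j rule: finite_induct)
  case empty
  then show ?case by (cases j) (simp_all add: coeff_pCons split: nat.splits)
next
  case (insert a A)
  then show ?case
    by (cases j) (simp_all add: algebra_simps flip: fps_const_mult fps_const_sub)
qed

text \<open>Replacing x_l by u x_l, where u is the series variable recording the degree of the
  kernel, multiplies column j by u^j.\<close>

lemma det_lagrange_mat_fps:
  "det (lagrange_mat n (\<lambda>l. fps_X * fps_const (x l)))
    = fps_X ^ (\<Sum>i<n. i) * fps_const (det (lagrange_mat n (x :: nat \<Rightarrow> 'a::comm_ring_1)))"
proof -
  have "det (lagrange_mat n (\<lambda>l. fps_X * fps_const (x l)))
      = det (mat n n (\<lambda>(l, j). 1 * fps_X ^ j * fps_const (coeff (lagrange_poly n x l) j)))"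
    unfolding lagrange_mat_def lagrange_poly_def
    by (rule arg_cong[where f = det], rule cong_mat) (simp_all add: coeff_prod_linear_fps)
  also have "\<dots> = fps_X ^ (\<Sum>i<n. i) * det (mat n n (\<lambda>(l, j). fps_const (coeff (lagrange_poly n x l) j)))"
    unfolding det_mat_scale by (simp add: power_sum)
  also have "det (mat n n (\<lambda>(l, j). fps_const (coeff (lagrange_poly n x l) j)))
      = fps_const (det (lagrange_mat n x))"
  proof -
    have s: "fps_const (sum f A) = (\<Sum>i\<in>A. fps_const (f i))" for f :: "(nat \<Rightarrow> nat) \<Rightarrow> 'a" and A
      by (induction A rule: infinite_finite_induct) (simp_all flip: fps_const_add)
    have p: "fps_const (prod f A) = (\<Prod>i\<in>A. fps_const (f i))" for f :: "nat \<Rightarrow> 'a" and A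
      by (induction A rule: infinite_finite_induct) (simp_all flip: fps_const_mult)
    have o: "fps_const (of_int k :: 'a) = of_int k" for k by (simp add: fps_of_int)
    show ?thesis
      unfolding lagrange_mat_def det_mat_expand s
      by (simp only: p o flip: fps_const_mult)
  qed
  finally show ?thesis .
qed
text \<open>
  The degree \<open>d\<close> part of
  \<open>\<Prod>\<^bsub>l,i\<^esub> (t x\<^sub>l z\<^sub>i; q)\<^sub>\<infinity> / (x\<^sub>l z\<^sub>i; q)\<^sub>\<infinity>\<close>.
\<close>

definition macdonald_kernel :: "'a \<Rightarrow> 'a \<Rightarrow> nat \<Rightarrow> nat \<Rightarrow> (nat \<Rightarrow> 'a) \<Rightarrow> (nat \<Rightarrow> 'a) \<Rightarrow> 'a::field_char_0" where
  "macdonald_kernel q t n d x z = cauchy_sum (\<lambda>c. c)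
     (\<lambda>r. (1 - t ^ r) / (1 - q ^ r) * (\<Sum>l<n. x l ^ r) * (\<Sum>i<n. z i ^ r)) d"

definition kernel_series :: "'a \<Rightarrow> 'a \<Rightarrow> nat \<Rightarrow> (nat \<Rightarrow> 'a) \<Rightarrow> (nat \<Rightarrow> 'a) \<Rightarrow> 'a::field_char_0 fps" where
  "kernel_series q t n x z = Abs_fps (\<lambda>d. macdonald_kernel q t n d x z)"

lemma macdonald_kernel_commute: "macdonald_kernel q t n d x z = macdonald_kernel q t n d z x"
  by (simp add: macdonald_kernel_def mult_ac)

lemma macdonald_kernel_0 [simp]: "macdonald_kernel q t n 0 x z = 1"
  by (simp add: macdonald_kernel_def)

section \<open>The Macdonald kernel under q-shifts\<close>

lemma sum_shift_power:
  assumes "I \<subseteq> {..<n}"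
  shows "(\<Sum>i<n. shift q I z i ^ r) = (\<Sum>i<n. z i ^ r) - (1 - q ^ r) * (\<Sum>i\<in>I. z i ^ r :: 'a::comm_ring_1)"
proof -
  have "(\<Sum>i<n. shift q I z i ^ r) = (\<Sum>i<n. z i ^ r - (if i \<in> I then (1 - q ^ r) * z i ^ r else 0))"
    by (rule sum.cong) (auto simp: shift_def power_mult_distrib algebra_simps)
  also have "\<dots> = (\<Sum>i<n. z i ^ r) - (\<Sum>i\<in>I. (1 - q ^ r) * z i ^ r)"
    using assms by (simp add: sum_subtractf sum.If_cases Int_absorb1)
  finally show ?thesis by (simp add: sum_distrib_left)
qed

text \<open>The infinite products telescope: replacing z_i by q z_i multiplies the kernel by the
  product over l of (1 - x_l z_i)/(1 - t x_l z_i). In the exponent, the factor 1 - q^r of the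
  shifted power sum cancels the denominator and leaves two geometric series, one on each side to
  avoid negative exponents.\<close>

lemma kernel_series_shift:
  fixes x z :: "nat \<Rightarrow> 'a::field_char_0"
  assumes I: "I \<subseteq> {..<n}" and q: "\<And>r. r > 0 \<Longrightarrow> q ^ r \<noteq> 1"
    and b: "\<And>i l. i < n \<Longrightarrow> l < n \<Longrightarrow> b i l * (1 - fps_const t * (fps_X * fps_const (x l)) * fps_const (z i)) = 1"
  shows "kernel_series q t n x (shift q I z) = kernel_series q t n x z *
    (\<Prod>i\<in>I. \<Prod>l<n. (1 - fps_X * fps_const (x l) * fps_const (z i)) * b i l)"
proof -
  let ?c = "\<lambda>r. (1 - t ^ r) / (1 - q ^ r) * (\<Sum>l<n. x l ^ r)"
  let ?g = "\<lambda>r. ?c r * (\<Sum>i<n. z i ^ r)" and ?h = "\<lambda>r. ?c r * (\<Sum>i<n. shift q I z i ^ r)"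
  let ?S = "field_hom.cauchy_series :: (nat \<Rightarrow> 'a) \<Rightarrow> 'a fps"
  let ?A = "\<Prod>i\<in>I. \<Prod>l<n. 1 - fps_X * fps_const (x l) * fps_const (z i)"
  let ?B = "\<Prod>i\<in>I. \<Prod>l<n. 1 - fps_const t * (fps_X * fps_const (x l)) * fps_const (z i)"
  have fin: "finite I" using I finite_subset by auto
  have k: "kernel_series q t n x y = ?S (\<lambda>r. ?c r * (\<Sum>i<n. y i ^ r))" for y
    by (simp add: kernel_series_def macdonald_kernel_def field_hom.cauchy_series_def)
  have "?S (\<lambda>r. ?h r + (\<Sum>i\<in>I. \<Sum>l<n. (x l * z i) ^ r)) = ?S (\<lambda>r. ?g r + (\<Sum>i\<in>I. \<Sum>l<n. (t * x l * z i) ^ r))"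
  proof (rule field_hom.cauchy_series_cong)
    fix r :: nat assume r: "r > 0"
    have "(\<Sum>i\<in>I. \<Sum>l<n. (x l * z i) ^ r) = (\<Sum>l<n. x l ^ r) * (\<Sum>i\<in>I. z i ^ r)"
      by (subst sum.swap) (simp add: power_mult_distrib sum_product)
    moreover have "(\<Sum>i\<in>I. \<Sum>l<n. (t * x l * z i) ^ r) = t ^ r * ((\<Sum>l<n. x l ^ r) * (\<Sum>i\<in>I. z i ^ r))"
      by (subst sum.swap) (simp add: power_mult_distrib sum_product sum_distrib_left mult_ac)
    ultimately show "?h r + (\<Sum>i\<in>I. \<Sum>l<n. (x l * z i) ^ r) = ?g r + (\<Sum>i\<in>I. \<Sum>l<n. (t * x l * z i) ^ r)"
      using q[OF r] unfolding sum_shift_power[OF I] by (simp add: divide_simps) (simp add: algebra_simps)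
  qed
  then have e: "?S ?h * (\<Prod>i\<in>I. \<Prod>l<n. ?S (\<lambda>r. (x l * z i) ^ r))
      = ?S ?g * (\<Prod>i\<in>I. \<Prod>l<n. ?S (\<lambda>r. (t * x l * z i) ^ r))"
    by (simp only: field_hom.cauchy_series_add field_hom.cauchy_series_sum[OF fin]
        field_hom.cauchy_series_sum[OF finite_lessThan])
  have geo: "?S (\<lambda>r. a ^ r) * (1 - fps_const a * fps_X) = 1" for a
    by (rule field_hom.cauchy_series_geometric)
  have A: "(\<Prod>i\<in>I. \<Prod>l<n. ?S (\<lambda>r. (x l * z i) ^ r)) * ?A = 1"
    unfolding prod.distrib[symmetric]
    by (intro prod.neutral ballI)
      (metis (no_types, lifting) geo fps_const_mult mult.assoc mult.commute)
  have B: "(\<Prod>i\<in>I. \<Prod>l<n. ?S (\<lambda>r. (t * x l * z i) ^ r)) * ?B = 1"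
    unfolding prod.distrib[symmetric]
    by (intro prod.neutral ballI)
      (metis (no_types, lifting) geo fps_const_mult mult.assoc mult.commute)
  have b': "?B * (\<Prod>i\<in>I. \<Prod>l<n. b i l) = 1"
    unfolding prod.distrib[symmetric]
    by (intro prod.neutral ballI) (use b I in \<open>auto simp: mult.commute[of _ "b _ _"]\<close>)
  have "?S ?h = ?S ?h * ((\<Prod>i\<in>I. \<Prod>l<n. ?S (\<lambda>r. (x l * z i) ^ r)) * ?A)" unfolding A by simp
  also have "\<dots> = (?S ?h * (\<Prod>i\<in>I. \<Prod>l<n. ?S (\<lambda>r. (x l * z i) ^ r))) * ?A" by (simp only: mult.assoc)
  also have "\<dots> = ?S ?g * (\<Prod>i\<in>I. \<Prod>l<n. ?S (\<lambda>r. (t * x l * z i) ^ r)) * ?A" unfolding e ..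
  also have "\<dots> = ?S ?g * (\<Prod>i\<in>I. \<Prod>l<n. ?S (\<lambda>r. (t * x l * z i) ^ r)) * ?A * (?B * (\<Prod>i\<in>I. \<Prod>l<n. b i l))"
    unfolding b' by simp
  also have "\<dots> = ?S ?g * ((\<Prod>i\<in>I. \<Prod>l<n. ?S (\<lambda>r. (t * x l * z i) ^ r)) * ?B) * (?A * (\<Prod>i\<in>I. \<Prod>l<n. b i l))"
    by (simp only: mult_ac)
  also have "\<dots> = ?S ?g * (?A * (\<Prod>i\<in>I. \<Prod>l<n. b i l))" unfolding B by simp
  finally show ?thesis unfolding k by (simp only: prod.distrib)
qed

lemma fps_const_vdm: "vdm n (\<lambda>i. fps_const (z i)) = fps_const (vdm n (z :: nat \<Rightarrow> 'a::comm_ring_1))"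
proof -
  have s: "fps_const (sum f A) = (\<Sum>i\<in>A. fps_const (f i))" for f :: "(nat \<Rightarrow> nat) \<Rightarrow> 'a" and A
    by (induction A rule: infinite_finite_induct) (simp_all flip: fps_const_add)
  have p: "fps_const (prod f A) = (\<Prod>i\<in>A. fps_const (f i))" for f :: "nat \<Rightarrow> 'a" and A
    by (induction A rule: infinite_finite_induct) (simp_all flip: fps_const_mult)
  have o: "fps_const (of_int k :: 'a) = of_int k" for k by (simp add: fps_of_int)
  show ?thesis
    unfolding vdm_expand s by (simp add: p o fps_const_power flip: fps_const_mult)
qed

lemma shift_fps_const: "shift (fps_const t) I (\<lambda>i. fps_const (z i)) = (\<lambda>i. fps_const (shift t I z i))"
  by (auto simp: shift_def fun_eq_iff)

lemma kernel_shift_sum: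
  fixes x z :: "nat \<Rightarrow> 'a::field_char_0"
  assumes q: "\<And>r. r > 0 \<Longrightarrow> q ^ r \<noteq> 1"
    and a: "\<And>i l. i < n \<Longrightarrow> l < n \<Longrightarrow> a i l * (1 - fps_X * fps_const (x l) * fps_const (z i)) = 1"
    and b: "\<And>i l. i < n \<Longrightarrow> l < n \<Longrightarrow> b i l * (1 - fps_const t * (fps_X * fps_const (x l)) * fps_const (z i)) = 1"
  shows "fps_X ^ (\<Sum>i<n. i) * fps_const (det (lagrange_mat n x)) *
      Abs_fps (\<lambda>d. shift_sum q t n X (macdonald_kernel q t n d x) z)
    = (\<Prod>i<n. \<Prod>l<n. 1 - fps_X * fps_const (x l) * fps_const (z i)) *
      det (mat n n (\<lambda>(i, l). a i l + fps_const X * b i l)) * kernel_series q t n x z"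
proof -
  let ?z = "\<lambda>i. fps_const (z i)" and ?x = "\<lambda>l. fps_X * fps_const (x l)"
  let ?\<theta> = "\<lambda>i. \<Prod>l<n. (1 - fps_X * fps_const (x l) * fps_const (z i)) * b i l"
  have "Abs_fps (\<lambda>d. shift_sum q t n X (macdonald_kernel q t n d x) z)
      = (\<Sum>I\<in>Pow {..<n}. fps_const X ^ card I * vdm n (shift (fps_const t) I ?z) * kernel_series q t n x (shift q I z))"
    by (rule fps_ext)
      (simp add: fps_sum_nth shift_sum_def shift_fps_const fps_const_vdm fps_const_power kernel_series_def)
  also have "\<dots> = (\<Sum>I\<in>Pow {..<n}. fps_const X ^ card I * vdm n (shift (fps_const t) I ?z) *
      (\<Prod>i\<in>I. ?\<theta> i)) * kernel_series q t n x z"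
    unfolding sum_distrib_right
    by (intro sum.cong refl) (subst kernel_series_shift[OF _ q b], auto simp: mult_ac)
  finally have 1: "Abs_fps (\<lambda>d. shift_sum q t n X (macdonald_kernel q t n d x) z)
      = (\<Sum>I\<in>Pow {..<n}. fps_const X ^ card I * vdm n (shift (fps_const t) I ?z) *
          (\<Prod>i\<in>I. ?\<theta> i)) * kernel_series q t n x z" .
  have 2: "det (lagrange_mat n ?x) * (\<Sum>I\<in>Pow {..<n}. fps_const X ^ card I *
      vdm n (shift (fps_const t) I ?z) * (\<Prod>i\<in>I. ?\<theta> i))
    = (\<Prod>i<n. \<Prod>l<n. 1 - ?x l * ?z i) * det (mat n n (\<lambda>(i, l). a i l + fps_const X * b i l))"
    by (rule cauchy_shift_identity) (use a b in auto)
  show ?thesis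
    unfolding 1 det_lagrange_mat_fps[symmetric] mult.assoc[symmetric] 2 by simp
qed

lemma inverse_one_minus_fps:
  fixes c :: "'a::field fps"
  assumes "fps_nth c 0 = 0"
  shows "inverse (1 - c) * (1 - c) = 1"
  by (rule inverse_mult_eq_1) (simp add: assms)

text \<open>Up to Lagrange determinants, \<open>kernel_shift_sum\<close> expresses both sides by a
  determinant that is merely transposed when x and z are exchanged. This plays the part of
  self-adjointness of D(X).\<close>

theorem kernel_shift_sum_symmetric:
  fixes x z :: "nat \<Rightarrow> 'a::field_char_0"
  assumes q: "\<And>r. r > 0 \<Longrightarrow> q ^ r \<noteq> 1"
    and x: "inj_on x {..<n}" "\<And>i. i < n \<Longrightarrow> x i \<noteq> 0"
    and z: "inj_on z {..<n}" "\<And>i. i < n \<Longrightarrow> z i \<noteq> 0"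
  shows "vdm n x * shift_sum q t n X (macdonald_kernel q t n d x) z
    = vdm n z * shift_sum q t n X (macdonald_kernel q t n d z) x"
proof -
  define a where "a = (\<lambda>(x :: nat \<Rightarrow> 'a) (z :: nat \<Rightarrow> 'a) i l.
    inverse (1 - fps_X * fps_const (x l) * fps_const (z i)))"
  define b where "b = (\<lambda>(x :: nat \<Rightarrow> 'a) (z :: nat \<Rightarrow> 'a) i l.
    inverse (1 - fps_const t * (fps_X * fps_const (x l)) * fps_const (z i)))"
  let ?S = "\<lambda>X x z. Abs_fps (\<lambda>d. shift_sum q t n X (macdonald_kernel q t n d x) z)"
  let ?R = "\<lambda>X x z. (\<Prod>i<n. \<Prod>l<n. 1 - fps_X * fps_const (x l) * fps_const (z i)) *
      det (mat n n (\<lambda>(i, l). a x z i l + fps_const X * b x z i l)) * kernel_series q t n x z"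
  let ?N = "fps_X ^ (\<Sum>i<n. i) :: 'a fps"
  have id: "?N * fps_const (det (lagrange_mat n x)) * ?S X x z = ?R X x z" for X x z
    by (rule kernel_shift_sum[OF q])
      (auto simp: a_def b_def intro!: inverse_one_minus_fps)
  have sym: "?R X x z = ?R X z x" for X
  proof -
    have "(\<Prod>i<n. \<Prod>l<n. 1 - fps_X * fps_const (x l) * fps_const (z i))
        = (\<Prod>i<n. \<Prod>l<n. 1 - fps_X * fps_const (z l) * fps_const (x i))"
      by (subst prod.swap) (simp add: mult_ac)
    moreover have "det (mat n n (\<lambda>(i, l). a x z i l + fps_const X * b x z i l))
        = det (mat n n (\<lambda>(i, l). a z x i l + fps_const X * b z x i l))"
    proof -
      have "mat n n (\<lambda>(i, l). a z x i l + fps_const X * b z x i l)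
          = transpose_mat (mat n n (\<lambda>(i, l). a x z i l + fps_const X * b x z i l))"
        by (rule eq_matI) (simp_all add: a_def b_def mult_ac)
      then show ?thesis
        using det_transpose[of "mat n n (\<lambda>(i, l). a x z i l + fps_const X * b x z i l)" n] by simp
    qed
    moreover have "kernel_series q t n x z = kernel_series q t n z x"
      by (simp add: kernel_series_def macdonald_kernel_commute[of q t n _ x z])
    ultimately show ?thesis by simp
  qed
  have main: "fps_const (det (lagrange_mat n x)) * ?S X x z = fps_const (det (lagrange_mat n z)) * ?S X z x" for X
  proof -
    have "?N * (fps_const (det (lagrange_mat n x)) * ?S X x z)
        = ?N * (fps_const (det (lagrange_mat n z)) * ?S X z x)"
      using id[of x X z] id[of z X x] sym[of X] by (simp only: mult.assoc)
    then show ?thesis by simp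
  qed
  have coeff: "det (lagrange_mat n x) * shift_sum q t n X (macdonald_kernel q t n d x) z
      = det (lagrange_mat n z) * shift_sum q t n X (macdonald_kernel q t n d z) x" for X d
    using arg_cong[OF main[of X], of "\<lambda>f. fps_nth f d"] by simp
  have zero: "shift_sum q t n 0 f y = vdm n y * f y" for f y
  proof -
    have "shift_sum q t n 0 f y = (\<Sum>I\<in>{{}}. 0 ^ card I * vdm n (shift t I y) * f (shift q I y))"
      unfolding shift_sum_def
    proof (rule sum.mono_neutral_right)
      show "\<forall>I\<in>Pow {..<n} - {{}}. 0 ^ card I * vdm n (shift t I y) * f (shift q I y) = 0"
        by (auto simp: card_gt_0_iff finite_subset)
    qed auto
    then show ?thesis by (simp add: shift_def)
  qed
  \<comment> \<open>For X = 0 only the empty subset contributes, and in degree 0 the kernel is 1.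
    This special case trades Lagrange determinants for Vandermonde determinants.\<close>
  have v: "det (lagrange_mat n x) * vdm n z = det (lagrange_mat n z) * vdm n x"
    using coeff[of 0 0] by (simp add: zero)
  have nz: "det (lagrange_mat n z) \<noteq> 0" by (rule det_lagrange_mat_nonzero[OF z])
  have "det (lagrange_mat n z) * (vdm n x * shift_sum q t n X (macdonald_kernel q t n d x) z)
      = (det (lagrange_mat n x) * shift_sum q t n X (macdonald_kernel q t n d x) z) * vdm n z"
    unfolding mult.assoc[symmetric] v[symmetric] by (simp only: mult_ac)
  also have "\<dots> = det (lagrange_mat n z) * (vdm n z * shift_sum q t n X (macdonald_kernel q t n d z) x)"
    unfolding coeff by (simp only: mult_ac)
  finally show ?thesis using nz by simp
qed

text \<open>For w = u x_l z_i, a = 1/(1 - w) and b = 1/(1 - t w) one has a - b = w (a - t b), since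
  both differences are multiples of (1 - t) a b. Pulling w out of all rows and columns of the
  determinant gives the two products and u^n, which is the shift of the degree by n.\<close>

theorem kernel_shift_sum_raising:
  fixes x z :: "nat \<Rightarrow> 'a::field_char_0"
  assumes q: "\<And>r. r > 0 \<Longrightarrow> q ^ r \<noteq> 1"
    and x: "inj_on x {..<n}" "\<And>i. i < n \<Longrightarrow> x i \<noteq> 0"
  shows "shift_sum q t n (-1) (macdonald_kernel q t n (d + n) x) z
    = (\<Prod>i<n. x i) * (\<Prod>i<n. z i) * shift_sum q t n (- t) (macdonald_kernel q t n d x) z"
proof -
  define a where "a = (\<lambda>i l. inverse (1 - fps_X * fps_const (x l) * fps_const (z i)))"
  define b where "b = (\<lambda>i l. inverse (1 - fps_const t * (fps_X * fps_const (x l)) * fps_const (z i)))"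
  let ?S = "\<lambda>X. Abs_fps (\<lambda>d. shift_sum q t n X (macdonald_kernel q t n d x) z)"
  let ?D = "\<lambda>X. det (mat n n (\<lambda>(i, l). a i l + fps_const X * b i l))"
  let ?N = "fps_X ^ (\<Sum>i<n. i) * fps_const (det (lagrange_mat n x)) :: 'a fps"
  have a: "a i l * (1 - fps_X * fps_const (x l) * fps_const (z i)) = 1"
    and b: "b i l * (1 - fps_const t * (fps_X * fps_const (x l)) * fps_const (z i)) = 1" for i l
    by (auto simp: a_def b_def intro!: inverse_one_minus_fps)
  have id: "?N * ?S X = (\<Prod>i<n. \<Prod>l<n. 1 - fps_X * fps_const (x l) * fps_const (z i)) * ?D X *
      kernel_series q t n x z" for X
    by (rule kernel_shift_sum[OF q]) (use a b in auto)
  have entry: "a i l + fps_const (-1) * b i l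
      = (fps_X * fps_const (z i)) * fps_const (x l) * (a i l + fps_const (- t) * b i l)" for i l
  proof -
    let ?w = "fps_X * fps_const (x l) * fps_const (z i)"
    let ?t = "fps_const t"
    have b': "b i l * (1 - ?t * ?w) = 1" using b[of i l] by (simp add: mult_ac)
    have "a i l - b i l = a i l * (b i l * (1 - ?t * ?w)) - (a i l * (1 - ?w)) * b i l"
      unfolding b' a by simp
    also have "\<dots> = ?w * ((1 - ?t) * (a i l * b i l))"
      by (simp add: algebra_simps del: fps_const_mult)
    also have "(1 - ?t) * (a i l * b i l)
        = a i l * (b i l * (1 - ?t * ?w)) - ?t * ((a i l * (1 - ?w)) * b i l)"
      by (simp add: algebra_simps del: fps_const_mult)
    also have "\<dots> = a i l - ?t * b i l"
      unfolding b' a by simp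
    finally have "a i l - b i l = ?w * (a i l - ?t * b i l)" .
    then show ?thesis by (simp add: mult_ac flip: fps_const_neg)
  qed
  have "?D (-1) = (\<Prod>i<n. fps_X * fps_const (z i)) * (\<Prod>l<n. fps_const (x l)) * ?D (- t)"
    unfolding entry by (rule det_mat_scale)
  also have "(\<Prod>i<n. fps_X * fps_const (z i)) * (\<Prod>l<n. fps_const (x l))
      = fps_const ((\<Prod>i<n. x i) * (\<Prod>i<n. z i)) * fps_X ^ n"
  proof -
    have p: "fps_const (prod f A) = (\<Prod>i\<in>A. fps_const (f i))" for f :: "nat \<Rightarrow> 'a" and A
      by (induction A rule: infinite_finite_induct) (simp_all flip: fps_const_mult)
    show ?thesis by (simp add: prod.distrib p mult_ac flip: fps_const_mult)
  qed
  finally have "?N * ?S (-1) = ?N * (fps_const ((\<Prod>i<n. x i) * (\<Prod>i<n. z i)) * fps_X ^ n * ?S (- t))"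
    unfolding id[of "-1"] using id[of "- t"] by (simp only: mult_ac)
  moreover have "?N \<noteq> 0" using det_lagrange_mat_nonzero[OF x] by simp
  ultimately have "?S (-1) = fps_const ((\<Prod>i<n. x i) * (\<Prod>i<n. z i)) * (fps_X ^ n * ?S (- t))"
    by (simp add: mult.assoc)
  from arg_cong[OF this, of "\<lambda>f. fps_nth f (d + n)"] show ?thesis
    by (simp add: fps_X_power_mult_nth)
qed


section \<open>The power sum basis\<close>

lemma power_sums_Nil [simp]: "power_sums [] = 1"
  by (simp add: power_sums_def)

lemma power_sums_Cons [simp]: "power_sums (r # \<nu>) = power_sum r * power_sums \<nu>"
  by (simp add: power_sums_def)

lemma scoeff_power_sum_mult:
  assumes r: "r > 0"
  shows "scoeff (power_sum r * F) m = (\<Sum>i | i \<in> Poly_Mapping.keys m \<and> r \<le> Poly_Mapping.lookup m i.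
    scoeff F (m - Poly_Mapping.single i r) :: 'a::comm_ring_1)"
proof -
  let ?I = "{i. i \<in> Poly_Mapping.keys m \<and> r \<le> Poly_Mapping.lookup m i}"
  let ?f = "\<lambda>i. (Poly_Mapping.single i r, m - Poly_Mapping.single i r)"
  have sub: "?f ` ?I \<subseteq> splits m"
    by (auto simp: splits_def intro!: poly_mapping_eqI simp: lookup_add lookup_minus lookup_single when_def)
  have "scoeff (power_sum r * F) m = (\<Sum>(a, b)\<in>?f ` ?I. scoeff (power_sum r) a * scoeff F b)"
    unfolding times_symfun.rep_eq
  proof (rule sum.mono_neutral_right[OF finite_splits sub], rule ballI)
    fix y assume y: "y \<in> splits m - ?f ` ?I"
    obtain a b where ab: "y = (a, b)" by (cases y)
    have "scoeff (power_sum r :: 'a symfun) a = 0"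
    proof (rule ccontr)
      assume "scoeff (power_sum r :: 'a symfun) a \<noteq> 0"
      then obtain i where i: "a = Poly_Mapping.single i r"
        by (auto simp: power_sum.rep_eq split: if_splits)
      have m: "m = Poly_Mapping.single i r + b" using y ab i by (auto simp: splits_def)
      then have "r \<le> Poly_Mapping.lookup m i" by (simp add: lookup_add)
      moreover from this have "i \<in> Poly_Mapping.keys m" using r by (simp add: in_keys_iff)
      moreover have "m - Poly_Mapping.single i r = b" using m by simp
      ultimately have "y \<in> ?f ` ?I" using ab i by (intro image_eqI[of _ _ i]) auto
      then show False using y by simp
    qed
    then show "(case y of (a, b) \<Rightarrow> scoeff (power_sum r) a * scoeff F b) = 0" by (simp add: ab)
  qed
  also have "\<dots> = (\<Sum>i\<in>?I. scoeff F (m - Poly_Mapping.single i r))"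
  proof -
    have "inj_on ?f ?I" by (auto simp: inj_on_def single_eq_single_iff[OF r])
    moreover have "scoeff (power_sum r :: 'a symfun) (Poly_Mapping.single i r) = 1" for i
      by (auto simp: power_sum.rep_eq)
    ultimately show ?thesis by (simp add: sum.reindex)
  qed
  finally show ?thesis .
qed

lemma minus_plus_single:
  fixes m :: mon
  assumes "r \<le> Poly_Mapping.lookup m i"
  shows "m = (m - Poly_Mapping.single i r) + Poly_Mapping.single i r"
  using assms by (intro poly_mapping_eqI) (auto simp: lookup_add lookup_minus lookup_single when_def)

lemma exponents_add_single:
  fixes m :: mon
  assumes "i \<notin> Poly_Mapping.keys m" "r > 0"
  shows "exponents (m + Poly_Mapping.single i r) = add_mset r (exponents m)"
proof -
  have k: "Poly_Mapping.keys (m + Poly_Mapping.single i r) = insert i (Poly_Mapping.keys m)"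
    using assms(2) by (auto simp: keys_add_mon)
  have "image_mset (Poly_Mapping.lookup (m + Poly_Mapping.single i r)) (mset_set (Poly_Mapping.keys m))
      = image_mset (Poly_Mapping.lookup m) (mset_set (Poly_Mapping.keys m))"
    by (rule image_mset_cong) (use assms in \<open>auto simp: lookup_add lookup_single when_def\<close>)
  moreover have "Poly_Mapping.lookup (m + Poly_Mapping.single i r) i = r"
    using assms by (simp add: lookup_add in_keys_iff)
  ultimately show ?thesis
    unfolding exponents_def k using assms by simp
qed

lemma power_sums_scoeff_nonneg:
  "0 \<notin> set \<nu> \<Longrightarrow> scoeff (power_sums \<nu> :: 'a::linordered_field symfun) m \<ge> 0"
proof (induction \<nu> arbitrary: m)
  case (Cons r \<nu>)
  then have "r > 0" "\<And>m. scoeff (power_sums \<nu> :: 'a symfun) m \<ge> 0" by auto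
  then show ?case by (simp add: scoeff_power_sum_mult sum_nonneg)
qed (simp add: one_symfun.rep_eq)

text \<open>Each factor p_r raises a single exponent by r. There are at most as many variables as
  factors, with equality only if every factor meets a fresh variable.\<close>

lemma power_sums_scoeff_nonzero:
  assumes "0 \<notin> set \<nu>" "scoeff (power_sums \<nu> :: 'a::comm_ring_1 symfun) m \<noteq> 0"
  shows "mdeg m = sum_list \<nu> \<and> card (Poly_Mapping.keys m) \<le> length \<nu> \<and>
    (card (Poly_Mapping.keys m) = length \<nu> \<longrightarrow> exponents m = mset \<nu>)"
  using assms
proof (induction \<nu> arbitrary: m)
  case Nil
  then have "m = 0" by (auto simp: one_symfun.rep_eq split: if_splits)
  then show ?case by (simp add: exponents_def)
next
  case (Cons r \<nu>)
  then have r: "r > 0" by auto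
  obtain i where i: "i \<in> Poly_Mapping.keys m" "r \<le> Poly_Mapping.lookup m i"
    "scoeff (power_sums \<nu> :: 'a symfun) (m - Poly_Mapping.single i r) \<noteq> 0"
    using Cons.prems(2) unfolding power_sums_Cons scoeff_power_sum_mult[OF r]
    by (metis (mono_tags, lifting) mem_Collect_eq sum.neutral)
  define m' where "m' = m - Poly_Mapping.single i r"
  have m: "m = m' + Poly_Mapping.single i r" unfolding m'_def by (rule minus_plus_single[OF i(2)])
  have IH: "mdeg m' = sum_list \<nu>" "card (Poly_Mapping.keys m') \<le> length \<nu>"
    "card (Poly_Mapping.keys m') = length \<nu> \<Longrightarrow> exponents m' = mset \<nu>"
    using Cons.IH[of m'] Cons.prems(1) i(3) by (auto simp: m'_def)
  have k: "Poly_Mapping.keys m = insert i (Poly_Mapping.keys m')"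
    using r by (auto simp: m keys_add_mon)
  have c: "card (Poly_Mapping.keys m) \<le> Suc (card (Poly_Mapping.keys m'))"
    unfolding k by (rule card_insert_le_m1) auto
  have "exponents m = add_mset r (mset \<nu>)" if "card (Poly_Mapping.keys m) = Suc (length \<nu>)"
  proof -
    have "i \<notin> Poly_Mapping.keys m'"
      using that IH(2) by (auto simp: k insert_absorb)
    moreover from this have "card (Poly_Mapping.keys m') = length \<nu>"
      using that by (simp add: k)
    ultimately show ?thesis using IH(3) r by (simp add: m exponents_add_single)
  qed
  then show ?case using IH c by (auto simp: m)
qed

text \<open>All coefficients are nonnegative, so nothing cancels and one positive term is
  enough.\<close>

lemma power_sums_scoeff_pos:
  assumes "0 \<notin> set \<nu>" "exponents m = mset \<nu>"
  shows "scoeff (power_sums \<nu> :: 'a::linordered_field symfun) m > 0"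
  using assms
proof (induction \<nu> arbitrary: m)
  case Nil
  then have "Poly_Mapping.keys m = {}"
    by (metis size_exponents card_0_eq finite_keys mset.simps(1) size_empty)
  then have "m = 0" by simp
  then show ?case by (simp add: one_symfun.rep_eq)
next
  case (Cons r \<nu>)
  then have r: "r > 0" by auto
  have "r \<in># exponents m" using Cons.prems(2) by simp
  then obtain i where i: "i \<in> Poly_Mapping.keys m" "Poly_Mapping.lookup m i = r"
    by (auto simp: exponents_def)
  define m' where "m' = m - Poly_Mapping.single i r"
  have m: "m = m' + Poly_Mapping.single i r" unfolding m'_def by (rule minus_plus_single) (simp add: i)
  have "Poly_Mapping.lookup m' i = 0" using i by (simp add: m'_def lookup_minus)
  then have "exponents m = add_mset r (exponents m')"
    unfolding m by (intro exponents_add_single) (auto simp: in_keys_iff r)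
  then have "exponents m' = mset \<nu>" using Cons.prems(2) by simp
  then have "scoeff (power_sums \<nu> :: 'a symfun) m' > 0" using Cons by auto
  then show ?case
    unfolding power_sums_Cons scoeff_power_sum_mult[OF r]
    by (intro sum_pos2[of _ i]) (use i Cons.prems(1) in \<open>auto simp: m'_def intro: power_sums_scoeff_nonneg\<close>)
qed

lemma power_sums_monomial_coeff:
  assumes \<nu>: "is_partition \<nu>" and \<mu>: "is_partition \<mu>"
    and nz: "monomial_coeff (power_sums \<nu> :: 'a::comm_ring_1 symfun) \<mu> \<noteq> 0"
  shows "sum_list \<mu> = sum_list \<nu>" "length \<mu> \<le> length \<nu>" "length \<mu> = length \<nu> \<Longrightarrow> \<mu> = \<nu>"
proof -
  have k: "card (Poly_Mapping.keys (Poly_Mapping.nth \<mu>)) = length \<mu>"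
    using \<mu> by (metis length_partition_of_mon partition_of_nth)
  have z: "0 \<notin> set \<nu>" using \<nu> by (simp add: is_partition_def)
  note * = power_sums_scoeff_nonzero[OF z nz[unfolded monomial_coeff_def]]
  show "sum_list \<mu> = sum_list \<nu>" "length \<mu> \<le> length \<nu>" "length \<mu> = length \<nu> \<Longrightarrow> \<mu> = \<nu>"
    using * k \<mu> \<nu> by (auto simp: mdeg_nth exponents_nth_partition intro: partition_eqI)
qed

lemma power_sums_monomial_coeff_diag:
  "is_partition \<nu> \<Longrightarrow> monomial_coeff (power_sums \<nu> :: 'a::linordered_field symfun) \<nu> > 0"
  unfolding monomial_coeff_def
  by (rule power_sums_scoeff_pos) (auto simp: exponents_nth_partition is_partition_def)

section \<open>Homogeneous components and their two bases\<close>

abbreviation partitions :: "nat list set" where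
  "partitions \<equiv> {\<nu>. is_partition \<nu>}"

definition homogeneous :: "nat \<Rightarrow> 'a::field symfun set" where
  "homogeneous d = symfun.span (monomial_sym ` partitions_of d)"

lemma homogeneousI:
  assumes "\<And>\<mu>. is_partition \<mu> \<Longrightarrow> monomial_coeff F \<mu> \<noteq> 0 \<Longrightarrow> sum_list \<mu> = d"
  shows "F \<in> homogeneous d"
proof -
  have "F = (\<Sum>\<nu>\<in>partitions_of d. sscale (monomial_coeff F \<nu>) (monomial_sym \<nu>))"
    by (rule monomial_expansion[OF finite_partitions_of])
      (use assms in \<open>auto simp: monomial_support_def partitions_of_def\<close>)
  also have "\<dots> \<in> homogeneous d"
    unfolding homogeneous_def
    by (intro symfun.span_sum symfun.span_scale symfun.span_base) auto
  finally show ?thesis .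
qed

lemma homogeneous_monomial_coeff:
  assumes "F \<in> homogeneous d" "is_partition \<mu>" "monomial_coeff F \<mu> \<noteq> 0"
  shows "sum_list \<mu> = d"
proof (rule ccontr)
  assume "sum_list \<mu> \<noteq> d"
  have "monomial_coeff F \<mu> = 0"
    using assms(1) unfolding homogeneous_def
  proof (induction rule: symfun.span_induct_alt)
    case (step c x y)
    then obtain \<nu> where "x = monomial_sym \<nu>" "is_partition \<nu>" "sum_list \<nu> = d"
      by (auto simp: partitions_of_def)
    then show ?case using step \<open>sum_list \<mu> \<noteq> d\<close> assms(2) by (auto simp: monomial_coeff_monomial_sym)
  qed simp
  then show False using assms(3) by simp
qed

lemma homogeneous_scoeff: "F \<in> homogeneous d \<Longrightarrow> scoeff F m \<noteq> 0 \<Longrightarrow> mdeg m = d"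
  using homogeneous_monomial_coeff[of F d "partition_of_mon m"]
  by (simp add: scoeff_eq_monomial_coeff[of F m])

lemma monomial_sym_homogeneous: "is_partition \<nu> \<Longrightarrow> monomial_sym \<nu> \<in> homogeneous (sum_list \<nu>)"
  unfolding homogeneous_def by (rule symfun.span_base) (simp add: partitions_of_def)

lemma power_sums_homogeneous: "is_partition \<nu> \<Longrightarrow> power_sums \<nu> \<in> homogeneous (sum_list \<nu>)"
  by (rule homogeneousI) (rule power_sums_monomial_coeff(1))

text \<open>p_\<nu> is a positive multiple of m_\<nu> plus monomial functions of smaller length;
  induct on the length.\<close>

lemma monomial_sym_in_span_power_sums:
  assumes "is_partition \<nu>"
  shows "(monomial_sym \<nu> :: 'a::linordered_field symfun) \<in> symfun.span (power_sums ` partitions_of (sum_list \<nu>))"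
  using assms
proof (induction "length \<nu>" arbitrary: \<nu> rule: less_induct)
  case less
  let ?d = "sum_list \<nu>" and ?p = "power_sums \<nu> :: 'a symfun"
  have \<nu>: "\<nu> \<in> partitions_of ?d" using less.prems by (simp add: partitions_of_def)
  let ?c = "monomial_coeff ?p"
  have c: "?c \<nu> \<noteq> 0" using power_sums_monomial_coeff_diag[OF less.prems, where 'a = 'a] by simp
  have "?p = (\<Sum>\<mu>\<in>partitions_of ?d. sscale (?c \<mu>) (monomial_sym \<mu>))"
    by (rule monomial_expansion[OF finite_partitions_of])
      (use power_sums_monomial_coeff(1)[OF less.prems] in \<open>auto simp: monomial_support_def partitions_of_def\<close>)
  also have "\<dots> = sscale (?c \<nu>) (monomial_sym \<nu>) + (\<Sum>\<mu>\<in>partitions_of ?d - {\<nu>}. sscale (?c \<mu>) (monomial_sym \<mu>))"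
    by (rule sum.remove) (use \<nu> in auto)
  finally have "sscale (?c \<nu>) (monomial_sym \<nu>) = ?p - (\<Sum>\<mu>\<in>partitions_of ?d - {\<nu>}. sscale (?c \<mu>) (monomial_sym \<mu>))"
    by (simp add: algebra_simps)
  also have "\<dots> \<in> symfun.span (power_sums ` partitions_of ?d)"
  proof (intro symfun.span_diff symfun.span_sum)
    show "?p \<in> symfun.span (power_sums ` partitions_of ?d)"
      by (rule symfun.span_base) (use \<nu> in auto)
    fix \<mu> assume \<mu>: "\<mu> \<in> partitions_of ?d - {\<nu>}"
    show "sscale (?c \<mu>) (monomial_sym \<mu>) \<in> symfun.span (power_sums ` partitions_of ?d)"
    proof (cases "?c \<mu> = 0")
      case False
      then have "length \<mu> < length \<nu>"
        using power_sums_monomial_coeff(2,3)[OF less.prems _ False] \<mu>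
        by (auto simp: partitions_of_def nat_less_le)
      then have "monomial_sym \<mu> \<in> symfun.span (power_sums ` partitions_of (sum_list \<mu>) :: 'a symfun set)"
        using less.hyps[of \<mu>] \<mu> unfolding partitions_of_def by blast
      then show ?thesis using \<mu> by (intro symfun.span_scale) (simp add: partitions_of_def)
    qed (simp add: symfun.span_zero)
  qed
  finally have "sscale (1 / ?c \<nu>) (sscale (?c \<nu>) (monomial_sym \<nu>)) \<in> symfun.span (power_sums ` partitions_of ?d)"
    by (rule symfun.span_scale)
  then show ?case using c by simp
qed

lemma homogeneous_eq_span_power_sums:
  "homogeneous d = (symfun.span (power_sums ` partitions_of d) :: 'a::linordered_field symfun set)"
proof (rule equalityI)
  show "homogeneous d \<subseteq> (symfun.span (power_sums ` partitions_of d) :: 'a symfun set)"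
    unfolding homogeneous_def
  proof (rule symfun.span_minimal[OF _ symfun.subspace_span], clarify)
    fix \<nu> assume "\<nu> \<in> partitions_of d"
    then show "monomial_sym \<nu> \<in> symfun.span (power_sums ` partitions_of d :: 'a symfun set)"
      using monomial_sym_in_span_power_sums[of \<nu>, where 'a = 'a] by (auto simp: partitions_of_def)
  qed
  show "symfun.span (power_sums ` partitions_of d :: 'a symfun set) \<subseteq> homogeneous d"
    unfolding homogeneous_def
  proof (rule symfun.span_minimal[OF _ symfun.subspace_span], clarify)
    fix \<nu> assume "\<nu> \<in> partitions_of d"
    then show "power_sums \<nu> \<in> symfun.span (monomial_sym ` partitions_of d :: 'a symfun set)"
      using power_sums_homogeneous[of \<nu>, where 'a = 'a] by (auto simp: partitions_of_def homogeneous_def)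
  qed
qed

lemma inj_on_power_sums: "inj_on (power_sums :: _ \<Rightarrow> 'a::linordered_field symfun) partitions"
proof (rule inj_onI, clarify)
  fix \<nu> \<mu> assume *: "is_partition \<nu>" "is_partition \<mu>" "power_sums \<nu> = (power_sums \<mu> :: 'a symfun)"
  have a: "monomial_coeff (power_sums \<mu> :: 'a symfun) \<nu> \<noteq> 0"
    using power_sums_monomial_coeff_diag[OF *(1), where 'a = 'a] *(3) by simp
  have b: "monomial_coeff (power_sums \<nu> :: 'a symfun) \<mu> \<noteq> 0"
    using power_sums_monomial_coeff_diag[OF *(2), where 'a = 'a] *(3) by simp
  show "\<nu> = \<mu>"
    using power_sums_monomial_coeff(2,3)[OF *(2,1) a] power_sums_monomial_coeff(2,3)[OF *(1,2) b]
    by auto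
qed

text \<open>Among the partitions with nonzero coefficient take \<kappa> of maximal length. Other
  power sums of at most this length do not contain m_\<kappa>, so the coefficient of m_\<kappa>
  isolates that of p_\<kappa>.\<close>

lemma independent_power_sums: "symfun.independent (power_sums ` partitions :: 'a::linordered_field symfun set)"
  unfolding symfun.independent_explicit_module
proof (intro allI impI)
  fix T :: "'a symfun set" and u :: "'a symfun \<Rightarrow> 'a" and v
  assume T: "finite T" "T \<subseteq> power_sums ` partitions" "(\<Sum>v\<in>T. sscale (u v) v) = 0" and v: "v \<in> T"
  obtain A where A: "A \<subseteq> partitions" "T = power_sums ` A"
    using T(2) by (auto simp: subset_image_iff)
  have inj: "inj_on (power_sums :: _ \<Rightarrow> 'a symfun) A" by (rule inj_on_subset[OF inj_on_power_sums A(1)])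
  have fin: "finite A" using T(1) A(2) inj by (simp add: finite_image_iff)
  let ?c = "\<lambda>\<nu>. u (power_sums \<nu>)"
  have sum0: "(\<Sum>\<nu>\<in>A. sscale (?c \<nu>) (power_sums \<nu>)) = 0"
    using T(3) unfolding A(2) by (simp add: sum.reindex[OF inj])
  have "?c \<nu> = 0" if \<nu>: "\<nu> \<in> A" for \<nu>
  proof (rule ccontr)
    assume "?c \<nu> \<noteq> 0"
    let ?B = "{\<nu> \<in> A. ?c \<nu> \<noteq> 0}"
    have "?B \<noteq> {}" "finite ?B" using \<nu> \<open>?c \<nu> \<noteq> 0\<close> fin by auto
    then have "Max (length ` ?B) \<in> length ` ?B" by (intro Max_in) auto
    then obtain \<kappa> where "\<kappa> \<in> ?B" "length \<kappa> = Max (length ` ?B)" by auto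
    then have \<kappa>: "\<kappa> \<in> ?B" "\<And>\<mu>. \<mu> \<in> ?B \<Longrightarrow> length \<mu> \<le> length \<kappa>"
      using \<open>finite ?B\<close> by auto
    have "(\<Sum>\<mu>\<in>A. ?c \<mu> * monomial_coeff (power_sums \<mu>) \<kappa>) = 0"
      using arg_cong[OF sum0, of "\<lambda>F. monomial_coeff F \<kappa>"] by simp
    also have "(\<Sum>\<mu>\<in>A. ?c \<mu> * monomial_coeff (power_sums \<mu>) \<kappa>)
        = (\<Sum>\<mu>\<in>{\<kappa>}. ?c \<mu> * monomial_coeff (power_sums \<mu>) \<kappa>)"
    proof (rule sum.mono_neutral_right[OF fin])
      show "{\<kappa>} \<subseteq> A" using \<kappa>(1) by auto
      show "\<forall>\<mu>\<in>A - {\<kappa>}. ?c \<mu> * monomial_coeff (power_sums \<mu>) \<kappa> = 0"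
      proof
        fix \<mu> assume \<mu>: "\<mu> \<in> A - {\<kappa>}"
        show "?c \<mu> * monomial_coeff (power_sums \<mu>) \<kappa> = 0"
        proof (rule ccontr)
          assume nz: "?c \<mu> * monomial_coeff (power_sums \<mu>) \<kappa> \<noteq> 0"
          then have "length \<mu> \<le> length \<kappa>" using \<kappa>(2)[of \<mu>] \<mu> by simp
          moreover have "is_partition \<mu>" "is_partition \<kappa>" using \<mu> \<kappa>(1) A(1) by auto
          ultimately show False
            using power_sums_monomial_coeff(2,3)[of \<mu> \<kappa>, where 'a = 'a] nz \<mu> by auto
        qed
      qed
    qed
    finally show False
      using \<kappa>(1) A(1) power_sums_monomial_coeff_diag[of \<kappa>, where 'a = 'a] by auto
  qed
  then show "u v = 0" using v A(2) by auto
qed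

lemma span_power_sums: "symfun.span (power_sums ` partitions) = (UNIV :: 'a::linordered_field symfun set)"
proof (intro equalityI subsetI UNIV_I)
  fix F :: "'a symfun"
  have "F = (\<Sum>\<nu>\<in>monomial_support F. sscale (monomial_coeff F \<nu>) (monomial_sym \<nu>))"
    by (rule monomial_expansion[OF finite_monomial_support]) (auto simp: monomial_support_def)
  also have "\<dots> \<in> symfun.span (power_sums ` partitions)"
  proof (intro symfun.span_sum symfun.span_scale)
    fix \<nu> assume "\<nu> \<in> monomial_support F"
    then have "(monomial_sym \<nu> :: 'a symfun) \<in> symfun.span (power_sums ` partitions_of (sum_list \<nu>))"
      by (intro monomial_sym_in_span_power_sums) (simp add: monomial_support_def)
    then show "(monomial_sym \<nu> :: 'a symfun) \<in> symfun.span (power_sums ` partitions)"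
      by (rule rev_subsetD) (auto intro!: symfun.span_mono simp: partitions_of_def)
  qed
  finally show "F \<in> symfun.span (power_sums ` partitions)" .
qed

section \<open>Coefficients in the power sum basis\<close>

context
  fixes F G :: "'a::linordered_field symfun"
begin

lemma psum_coeff_add [simp]: "psum_coeff (F + G) \<nu> = psum_coeff F \<nu> + psum_coeff G \<nu>"
  unfolding psum_coeff_def
  by (subst symfun.representation_add[OF independent_power_sums]) (simp_all add: span_power_sums)

lemma psum_coeff_sscale [simp]: "psum_coeff (sscale c F) \<nu> = c * psum_coeff F \<nu>"
  unfolding psum_coeff_def
  by (subst symfun.representation_scale[OF independent_power_sums]) (simp_all add: span_power_sums)

lemma psum_coeff_zero [simp]: "psum_coeff (0 :: 'a symfun) \<nu> = 0"
  unfolding psum_coeff_def by (simp add: symfun.representation_zero)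

lemma psum_coeff_power_sums:
  assumes "is_partition \<mu>" "is_partition \<nu>"
  shows "psum_coeff (power_sums \<mu> :: 'a symfun) \<nu> = (if \<nu> = \<mu> then 1 else 0)"
  unfolding psum_coeff_def
  by (subst symfun.representation_basis[OF independent_power_sums])
    (use assms in \<open>auto dest: inj_onD[OF inj_on_power_sums]\<close>)

lemma finite_psum_support [simp]: "finite (psum_support F)"
proof -
  let ?R = "symfun.representation (power_sums ` partitions) F"
  have "finite {v. ?R v \<noteq> 0}" by (rule symfun.finite_representation)
  moreover have "power_sums ` psum_support F \<subseteq> {v. ?R v \<noteq> 0}"
    by (auto simp: psum_support_def psum_coeff_def)
  moreover have "inj_on (power_sums :: _ \<Rightarrow> 'a symfun) (psum_support F)"
    by (rule inj_on_subset[OF inj_on_power_sums]) (auto simp: psum_support_def)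
  ultimately show ?thesis by (metis finite_imageD finite_subset)
qed

lemma psum_expansion:
  assumes "finite A" "psum_support F \<subseteq> A" "A \<subseteq> partitions"
  shows "F = (\<Sum>\<nu>\<in>A. sscale (psum_coeff F \<nu>) (power_sums \<nu>))"
proof -
  let ?R = "symfun.representation (power_sums ` partitions) F"
  have img: "{v. ?R v \<noteq> 0} = power_sums ` psum_support F"
    using symfun.representation_ne_zero[of "power_sums ` partitions" F]
    by (auto simp: psum_support_def psum_coeff_def)
  have inj: "inj_on (power_sums :: _ \<Rightarrow> 'a symfun) (psum_support F)"
    by (rule inj_on_subset[OF inj_on_power_sums]) (auto simp: psum_support_def)
  have "F = (\<Sum>v | ?R v \<noteq> 0. sscale (?R v) v)"
    by (rule symfun.sum_nonzero_representation_eq[symmetric, OF independent_power_sums])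
      (simp add: span_power_sums)
  also have "\<dots> = (\<Sum>\<nu>\<in>psum_support F. sscale (psum_coeff F \<nu>) (power_sums \<nu>))"
    unfolding img sum.reindex[OF inj] by (simp add: psum_coeff_def)
  also have "\<dots> = (\<Sum>\<nu>\<in>A. sscale (psum_coeff F \<nu>) (power_sums \<nu>))"
    by (rule sum.mono_neutral_left) (use assms in \<open>auto simp: psum_support_def\<close>)
  finally show ?thesis .
qed

end

lemma psum_coeff_sum [simp]:
  "psum_coeff (sum f A :: 'a::linordered_field symfun) \<nu> = (\<Sum>a\<in>A. psum_coeff (f a) \<nu>)"
  by (induction A rule: infinite_finite_induct) auto

lemma psum_support_homogeneous:
  fixes F :: "'a::linordered_field symfun"
  assumes "F \<in> homogeneous d"
  shows "psum_support F \<subseteq> partitions_of d"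
proof
  fix \<nu> assume \<nu>: "\<nu> \<in> psum_support F"
  have "psum_coeff F \<nu> = 0" if "\<nu> \<notin> partitions_of d"
    using assms unfolding homogeneous_eq_span_power_sums
  proof (induction rule: symfun.span_induct_alt)
    case (step c x y)
    then obtain \<mu> where "x = power_sums \<mu>" "\<mu> \<in> partitions_of d" by auto
    moreover have "is_partition \<nu>" using \<nu> by (simp add: psum_support_def)
    ultimately show ?case using step that by (auto simp: psum_coeff_power_sums partitions_of_def)
  qed simp
  then show "\<nu> \<in> partitions_of d" using \<nu> by (auto simp: psum_support_def)
qed

lemma psum_expansion_homogeneous:
  fixes F :: "'a::linordered_field symfun"
  assumes "F \<in> homogeneous d"
  shows "F = (\<Sum>\<nu>\<in>partitions_of d. sscale (psum_coeff F \<nu>) (power_sums \<nu>))"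
  by (rule psum_expansion[OF finite_partitions_of])
    (use psum_support_homogeneous[OF assms] in \<open>auto simp: partitions_of_def\<close>)


section \<open>Plethysm\<close>

lemma psum_support_partitions: "psum_support F \<subseteq> partitions"
  by (auto simp: psum_support_def)

locale plethysm_hom = scalar_hom \<iota> for \<iota> :: "'k::linordered_field \<Rightarrow> 'r::comm_ring_1"
begin

lemma plethysm_superset:
  assumes "finite A" "psum_support F \<subseteq> A" "A \<subseteq> partitions"
  shows "plethysm \<iota> e F = (\<Sum>\<nu>\<in>A. \<iota> (psum_coeff F \<nu>) * prod_list (map e \<nu>))"
  unfolding plethysm_def
  by (rule sum.mono_neutral_left) (use assms in \<open>auto simp: psum_support_def hom_zero\<close>)

lemma plethysm_add: "plethysm \<iota> e (F + G) = plethysm \<iota> e F + plethysm \<iota> e G"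
proof -
  let ?A = "psum_support F \<union> psum_support G \<union> psum_support (F + G)"
  have A: "finite ?A" "?A \<subseteq> partitions" using psum_support_partitions by auto
  show ?thesis
    by (subst (1 2 3) plethysm_superset[OF A(1) _ A(2)])
      (auto simp: hom_add distrib_right sum.distrib)
qed

lemma plethysm_sscale: "plethysm \<iota> e (sscale c F) = \<iota> c * plethysm \<iota> e F"
proof -
  let ?A = "psum_support F \<union> psum_support (sscale c F)"
  have A: "finite ?A" "?A \<subseteq> partitions" using psum_support_partitions by auto
  show ?thesis
    by (subst (1 2) plethysm_superset[OF A(1) _ A(2)])
      (auto simp: hom_mult sum_distrib_left mult.assoc)
qed

lemma plethysm_zero: "plethysm \<iota> e 0 = 0"
  by (simp add: plethysm_def psum_support_def)

lemma plethysm_sum: "plethysm \<iota> e (sum f A) = (\<Sum>a\<in>A. plethysm \<iota> e (f a))"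
  by (induction A rule: infinite_finite_induct) (simp_all add: plethysm_zero plethysm_add)

lemma plethysm_power_sums:
  assumes "is_partition \<nu>"
  shows "plethysm \<iota> e (power_sums \<nu>) = prod_list (map e \<nu>)"
proof -
  have "psum_support (power_sums \<nu> :: 'k symfun) = {\<nu>}"
    using assms by (auto simp: psum_support_def psum_coeff_power_sums split: if_splits)
  then show ?thesis using assms by (simp add: plethysm_def psum_coeff_power_sums hom_one)
qed

text \<open>The substitution is carried out inside exp(sum_r c_r p_r / r); both Cauchy kernels are
  of this form.\<close>

lemma plethysm_cauchy_sum:
  "plethysm \<iota> e (\<Sum>\<nu>\<in>partitions_of d. sscale (1 / of_nat (zee \<nu>) * prod_list (map c \<nu>)) (power_sums \<nu>))
    = cauchy_sum \<iota> (\<lambda>r. \<iota> (c r) * e r) d"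
proof -
  have p: "\<iota> (prod_list (map c \<nu>)) = prod_list (map (\<lambda>r. \<iota> (c r)) \<nu>)" for \<nu>
    by (induction \<nu>) (simp_all add: hom_one hom_mult)
  have m: "prod_list (map (\<lambda>r. \<iota> (c r)) \<nu>) * prod_list (map e \<nu>) = prod_list (map (\<lambda>r. \<iota> (c r) * e r) \<nu>)" for \<nu>
    by (induction \<nu>) (simp_all add: mult_ac)
  show ?thesis
    unfolding plethysm_sum cauchy_sum_def plethysm_sscale hom_mult p
    by (rule sum.cong) (simp_all add: plethysm_power_sums partitions_of_def mult.assoc m)
qed

end

lemma sconst_simps:
  "sconst (a + b) = sconst a + sconst b" "sconst (a * b) = sconst a * sconst b" "sconst (1 :: 'a::comm_ring_1) = 1"
proof -
  show "sconst (a + b) = sconst a + sconst b" by (rule symfun_eqI) (simp add: sconst.rep_eq)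
  show "sconst (a * b) = sconst a * sconst b"
    by (subst sscale_eq_sconst_mult[symmetric]) (rule symfun_eqI, simp add: sconst.rep_eq)
  show "sconst (1 :: 'a) = 1" by (rule symfun_eqI) (simp add: sconst.rep_eq one_symfun.rep_eq)
qed

global_interpretation sconst_hom: plethysm_hom "sconst :: 'a::linordered_field \<Rightarrow> 'a symfun"
  by standard (rule sconst_simps)+

global_interpretation sconst2_hom: plethysm_hom "\<lambda>c :: 'a::linordered_field. sconst (sconst c)"
  by standard (simp_all add: sconst_simps)


section \<open>The Macdonald scalar product\<close>

text \<open>As a consequence 1 - q^r and 1 - t^r are nonzero of the same sign, which makes the
  weights of the scalar product positive.\<close>

lemma qq_gt_1: "qq > 1" and tt_gt_1: "tt > 1"
proof -
  have 1: "(0 :: rat poly) < [:1:]" unfolding less_poly_def by (simp add: pos_poly_def)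
  then have "pos_poly ([:0, 1:] - 1 :: rat poly poly)" by (simp add: pos_poly_def one_pCons)
  then have "(1 :: rat poly poly) < [:0, 1:]" unfolding less_poly_def .
  then show "qq > 1" by (simp add: qq_def to_fract_def One_fract_def)

  have "(0 :: rat poly) < [:- 1, 1:]" unfolding less_poly_def by (simp add: pos_poly_def)
  then have "pos_poly ([:[:0, 1:]:] - 1 :: rat poly poly)"
    by (simp add: pos_poly_def one_pCons)
  then have "(1 :: rat poly poly) < [:[:0, 1:]:]" unfolding less_poly_def .
  then show "tt > 1" by (simp add: tt_def to_fract_def One_fract_def)
qed

lemma qq_power_ne_1: "r > 0 \<Longrightarrow> qq ^ r \<noteq> 1" and tt_power_ne_1: "r > 0 \<Longrightarrow> tt ^ r \<noteq> 1"
  using one_less_power[OF qq_gt_1, of r] one_less_power[OF tt_gt_1, of r] by auto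

definition qt_weight :: "nat list \<Rightarrow> qt" where
  "qt_weight \<nu> = of_nat (zee \<nu>) * prod_list (map (\<lambda>r. (1 - qq ^ r) / (1 - tt ^ r)) \<nu>)"

lemma qt_weight_pos:
  assumes "is_partition \<nu>"
  shows "qt_weight \<nu> > 0"
proof -
  have "(1 - qq ^ r) / (1 - tt ^ r) > 0" if "r > 0" for r
    using one_less_power[OF qq_gt_1 that] one_less_power[OF tt_gt_1 that]
    by (intro divide_neg_neg) auto
  moreover have "\<And>r. r \<in> set \<nu> \<Longrightarrow> r > 0" using assms by (rule is_partition_pos)
  ultimately have "prod_list (map (\<lambda>r. (1 - qq ^ r) / (1 - tt ^ r)) \<nu>) > 0"
    by (induction \<nu>) (auto simp del: zero_less_divide_iff times_divide_eq_left intro!: mult_pos_pos)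
  then show ?thesis using zee_pos[OF assms] by (simp add: qt_weight_def)
qed

lemma qt_inner_superset:
  assumes "finite A" "psum_support F \<subseteq> A \<or> psum_support G \<subseteq> A" "A \<subseteq> partitions"
  shows "qt_inner F G = (\<Sum>\<nu>\<in>A. psum_coeff F \<nu> * psum_coeff G \<nu> * qt_weight \<nu>)"
proof -
  have "qt_inner F G = (\<Sum>\<nu>\<in>psum_support F \<inter> psum_support G. psum_coeff F \<nu> * psum_coeff G \<nu> * qt_weight \<nu>)"
    by (simp add: qt_inner_def qt_weight_def mult.assoc)
  also have "\<dots> = (\<Sum>\<nu>\<in>A. psum_coeff F \<nu> * psum_coeff G \<nu> * qt_weight \<nu>)"
    by (rule sum.mono_neutral_left) (use assms in \<open>auto simp: psum_support_def\<close>)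
  finally show ?thesis .
qed

lemma qt_inner_commute: "qt_inner F G = qt_inner G F"
  by (simp add: qt_inner_def Int_commute mult.commute[of "psum_coeff F _"])

lemma qt_inner_support: "qt_inner F G = (\<Sum>\<nu>\<in>psum_support F. psum_coeff F \<nu> * psum_coeff G \<nu> * qt_weight \<nu>)"
  by (rule qt_inner_superset) (simp_all add: psum_support_partitions)

lemma qt_inner_add_right [simp]: "qt_inner F (G + H) = qt_inner F G + qt_inner F H"
  by (simp add: qt_inner_support[of F] algebra_simps sum.distrib)

lemma qt_inner_sscale_right [simp]: "qt_inner F (sscale c G) = c * qt_inner F G"
  by (simp add: qt_inner_support[of F] algebra_simps sum_distrib_left)

lemma qt_inner_zero_right [simp]: "qt_inner F 0 = 0"
  by (simp add: qt_inner_def psum_support_def)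

lemma qt_inner_sum_right [simp]: "qt_inner F (sum f A) = (\<Sum>a\<in>A. qt_inner F (f a))"
  by (induction A rule: infinite_finite_induct) auto

lemma qt_inner_diff_right [simp]: "qt_inner F (G - H) = qt_inner F G - qt_inner F H"
  using qt_inner_add_right[of F "G - H" H] by simp

lemma qt_inner_left [simp]:
  "qt_inner (F + G) H = qt_inner F H + qt_inner G H"
  "qt_inner (F - G) H = qt_inner F H - qt_inner G H"
  "qt_inner (sscale c F) H = c * qt_inner F H"
  "qt_inner (sum f A) H = (\<Sum>a\<in>A. qt_inner (f a) H)"
  "qt_inner 0 H = 0"
  by (simp_all add: qt_inner_commute[of _ H])

lemma qt_inner_power_sums:
  assumes "is_partition \<mu>"
  shows "qt_inner F (power_sums \<mu>) = psum_coeff F \<mu> * qt_weight \<mu>"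
proof -
  have "psum_support (power_sums \<mu> :: qt symfun) \<subseteq> {\<mu>}"
    using assms by (auto simp: psum_support_def psum_coeff_power_sums split: if_splits)
  then show ?thesis
    using assms by (subst qt_inner_superset[of "{\<mu>}"]) (auto simp: psum_coeff_power_sums)
qed

lemma qt_inner_pos:
  assumes "F \<noteq> 0"
  shows "qt_inner F F > 0"
proof -
  have ne: "psum_support F \<noteq> {}"
    using assms psum_expansion[OF finite_psum_support subset_refl psum_support_partitions, of F]
    by auto
  have "qt_inner F F = (\<Sum>\<nu>\<in>psum_support F. psum_coeff F \<nu> * psum_coeff F \<nu> * qt_weight \<nu>)"
    by (rule qt_inner_support)
  also have "\<dots> > 0"
  proof (rule sum_pos)
    fix \<nu> assume "\<nu> \<in> psum_support F"
    then have "psum_coeff F \<nu> \<noteq> 0" "qt_weight \<nu> > 0"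
      by (simp_all add: psum_support_def qt_weight_pos)
    then show "psum_coeff F \<nu> * psum_coeff F \<nu> * qt_weight \<nu> > 0"
      using zero_less_power2[of "psum_coeff F \<nu>"] mult_pos_pos[of "psum_coeff F \<nu> * psum_coeff F \<nu>" "qt_weight \<nu>"]
      unfolding power2_eq_square by simp
  qed (use ne in auto)
  finally show ?thesis .
qed

lemma qt_inner_homogeneous:
  assumes "F \<in> homogeneous d" "G \<in> homogeneous e" "d \<noteq> e"
  shows "qt_inner F G = 0"
proof -
  have "psum_support F \<inter> psum_support G = {}"
    using psum_support_homogeneous[OF assms(1)] psum_support_homogeneous[OF assms(2)] assms(3)
    by (auto simp: partitions_of_def)
  then show ?thesis by (simp add: qt_inner_def)
qed


section \<open>Orthogonal bases\<close>

definition lower_partitions :: "nat list \<Rightarrow> nat list set" where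
  "lower_partitions \<nu> =
     {\<mu>. is_partition \<mu> \<and> sum_list \<mu> = sum_list \<nu> \<and> partition_key \<mu> < partition_key \<nu>}"

lemma dominated_lower_partitions:
  "is_partition \<mu> \<Longrightarrow> is_partition \<nu> \<Longrightarrow> dominated \<mu> \<nu> \<Longrightarrow> \<mu> \<in> lower_partitions \<nu>"
  using dominated_key_less[of \<nu> \<mu>] by (auto simp: lower_partitions_def dominated_def)

lemma dominated_trans: "dominated \<mu> \<nu> \<Longrightarrow> dominated \<nu> \<kappa> \<Longrightarrow> \<mu> \<noteq> \<kappa> \<Longrightarrow> dominated \<mu> \<kappa>"
  by (auto simp: dominated_def intro: order_trans)

text \<open>Weaker than \<open>macdonald_family\<close>: triangularity is required for the total
  order \<open>partition_key\<close>, which is what Gram-Schmidt delivers. Triangularity for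
  dominance is recovered in \<open>dominance_triangular\<close>.\<close>

locale orthogonal_basis =
  fixes P :: "nat list \<Rightarrow> qt symfun"
  assumes triangular: "is_partition \<nu> \<Longrightarrow>
      P \<nu> - monomial_sym \<nu> \<in> symfun.span (monomial_sym ` lower_partitions \<nu>)"
    and orthogonal: "is_partition \<nu> \<Longrightarrow> is_partition \<mu> \<Longrightarrow> \<nu> \<noteq> \<mu> \<Longrightarrow> qt_inner (P \<nu>) (P \<mu>) = 0"
begin

lemma coeff_diff_nonzero:
  assumes "is_partition \<nu>" "is_partition \<mu>" "monomial_coeff (P \<nu> - monomial_sym \<nu>) \<mu> \<noteq> 0"
  shows "\<mu> \<in> lower_partitions \<nu>"
proof (rule ccontr)
  assume \<mu>: "\<mu> \<notin> lower_partitions \<nu>"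
  have "monomial_coeff F \<mu> = 0" if "F \<in> symfun.span (monomial_sym ` lower_partitions \<nu>)"
    for F :: "qt symfun"
    using that
  proof (induction rule: symfun.span_induct_alt)
    case (step c x y)
    then obtain \<kappa> where "x = monomial_sym \<kappa>" "\<kappa> \<in> lower_partitions \<nu>" by auto
    then show ?case
      using step.IH \<mu> assms(2) by (auto simp: lower_partitions_def monomial_coeff_monomial_sym)
  qed simp
  then show False using assms(3) triangular[OF assms(1)] by blast
qed

lemma coeff_diag: "is_partition \<nu> \<Longrightarrow> monomial_coeff (P \<nu>) \<nu> = 1"
  using coeff_diff_nonzero[of \<nu> \<nu>] by (auto simp: lower_partitions_def monomial_coeff_monomial_sym)

lemma coeff_nonzero:
  assumes "is_partition \<nu>" "is_partition \<mu>" "monomial_coeff (P \<nu>) \<mu> \<noteq> 0"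
  shows "sum_list \<mu> = sum_list \<nu>" "partition_key \<mu> \<le> partition_key \<nu>"
proof -
  have "\<mu> = \<nu> \<or> \<mu> \<in> lower_partitions \<nu>"
    using coeff_diff_nonzero[of \<nu> \<mu>] assms by (cases "\<mu> = \<nu>") (auto simp: monomial_coeff_monomial_sym)
  then show "sum_list \<mu> = sum_list \<nu>" "partition_key \<mu> \<le> partition_key \<nu>"
    by (auto simp: lower_partitions_def)
qed

lemma nonzero: "is_partition \<nu> \<Longrightarrow> P \<nu> \<noteq> 0"
  using coeff_diag[of \<nu>] by auto

lemma norm_pos: "is_partition \<nu> \<Longrightarrow> qt_inner (P \<nu>) (P \<nu>) > 0"
  by (rule qt_inner_pos) (rule nonzero)

lemma homogeneous: "is_partition \<nu> \<Longrightarrow> P \<nu> \<in> homogeneous (sum_list \<nu>)"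
  by (rule homogeneousI) (rule coeff_nonzero(1))

lemma coeff_length: "is_partition \<nu> \<Longrightarrow> scoeff (P \<nu>) m \<noteq> 0 \<Longrightarrow> length \<nu> \<le> card (Poly_Mapping.keys m)"
  using coeff_nonzero(2)[of \<nu> "partition_of_mon m"] partition_key_le_length[of "partition_of_mon m" \<nu>]
  by (simp add: scoeff_eq_monomial_coeff[of "P \<nu>" m])

lemma evl_zero:
  assumes "is_partition \<nu>" "n < length \<nu>"
  shows "evl n x (P \<nu>) = 0"
proof -
  have "scoeff (P \<nu>) m = 0" if "Poly_Mapping.keys m \<subseteq> {..<n}" for m
    using coeff_length[OF assms(1), of m] card_mono[OF _ that] assms(2) by force
  then show ?thesis unfolding evl_def by (intro sum.neutral) auto
qed

text \<open>Inversion of a unitriangular system, by induction on the number of smaller partitions of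
  the same size.\<close>

lemma monomial_in_span:
  assumes "is_partition \<nu>"
  shows "monomial_sym \<nu> \<in> symfun.span (P ` {\<kappa> \<in> partitions_of (sum_list \<nu>). partition_key \<kappa> \<le> partition_key \<nu>})"
  using assms
proof (induction "card {\<mu> \<in> partitions_of (sum_list \<nu>). partition_key \<mu> < partition_key \<nu>}"
    arbitrary: \<nu> rule: less_induct)
  case less
  let ?T = "P ` {\<kappa> \<in> partitions_of (sum_list \<nu>). partition_key \<kappa> \<le> partition_key \<nu>}"
  have "symfun.span (monomial_sym ` lower_partitions \<nu>) \<subseteq> symfun.span ?T"
  proof (rule symfun.span_minimal[OF _ symfun.subspace_span], clarify)
    fix \<mu> assume \<mu>: "\<mu> \<in> lower_partitions \<nu>"
    have "card {\<kappa> \<in> partitions_of (sum_list \<mu>). partition_key \<kappa> < partition_key \<mu>}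
        < card {\<kappa> \<in> partitions_of (sum_list \<nu>). partition_key \<kappa> < partition_key \<nu>}"
    proof (rule psubset_card_mono)
      show "finite {\<kappa> \<in> partitions_of (sum_list \<nu>). partition_key \<kappa> < partition_key \<nu>}" by simp
    qed (use \<mu> in \<open>auto simp: lower_partitions_def partitions_of_def\<close>)
    then have "monomial_sym \<mu>
        \<in> symfun.span (P ` {\<kappa> \<in> partitions_of (sum_list \<mu>). partition_key \<kappa> \<le> partition_key \<mu>})"
      using less.hyps[of \<mu>] \<mu> unfolding lower_partitions_def by blast
    then show "monomial_sym \<mu> \<in> symfun.span ?T"
      by (rule rev_subsetD)
        (use \<mu> in \<open>intro symfun.span_mono image_mono, auto simp: lower_partitions_def partitions_of_def\<close>)
  qed
  then have 1: "P \<nu> - monomial_sym \<nu> \<in> symfun.span ?T"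
    using triangular[OF less.prems] by blast
  have 2: "P \<nu> \<in> symfun.span ?T"
    by (rule symfun.span_base) (use less.prems in \<open>auto simp: partitions_of_def\<close>)
  have "P \<nu> - (P \<nu> - monomial_sym \<nu>) \<in> symfun.span ?T" by (rule symfun.span_diff[OF 2 1])
  moreover have "P \<nu> - (P \<nu> - monomial_sym \<nu>) = monomial_sym \<nu>" by (simp add: algebra_simps)
  ultimately show ?case by (simp only:)
qed

lemma homogeneous_span: "F \<in> homogeneous d \<Longrightarrow> F \<in> symfun.span (P ` partitions_of d)"
proof -
  have "homogeneous d \<subseteq> symfun.span (P ` partitions_of d)"
    unfolding homogeneous_def
  proof (rule symfun.span_minimal[OF _ symfun.subspace_span], clarify)
    fix \<nu> assume \<nu>: "\<nu> \<in> partitions_of d"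
    then have "monomial_sym \<nu> \<in> symfun.span (P ` {\<kappa> \<in> partitions_of (sum_list \<nu>). partition_key \<kappa> \<le> partition_key \<nu>})"
      by (intro monomial_in_span) (simp add: partitions_of_def)
    then show "monomial_sym \<nu> \<in> symfun.span (P ` partitions_of d)"
      by (rule rev_subsetD) (use \<nu> in \<open>intro symfun.span_mono image_mono, auto simp: partitions_of_def\<close>)
  qed
  then show "F \<in> homogeneous d \<Longrightarrow> F \<in> symfun.span (P ` partitions_of d)" by blast
qed

lemma inner_sum_P:
  assumes "finite A" "A \<subseteq> partitions" "\<mu> \<in> A"
  shows "(\<Sum>\<nu>\<in>A. c \<nu> * qt_inner (P \<nu>) (P \<mu>)) = c \<mu> * qt_inner (P \<mu>) (P \<mu>)"
proof -
  have "(\<Sum>\<nu>\<in>A. c \<nu> * qt_inner (P \<nu>) (P \<mu>)) = (\<Sum>\<nu>\<in>{\<mu>}. c \<nu> * qt_inner (P \<nu>) (P \<mu>))"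
    by (rule sum.mono_neutral_right[OF assms(1)]) (use assms orthogonal in auto)
  then show ?thesis by simp
qed

lemma expansion:
  assumes F: "F \<in> homogeneous d"
  shows "F = (\<Sum>\<nu>\<in>partitions_of d. sscale (qt_inner F (P \<nu>) / qt_inner (P \<nu>) (P \<nu>)) (P \<nu>))"
proof -
  \<comment> \<open>The remainder lies in the span of the P's and is orthogonal to it, hence to
    itself; positivity makes it 0.\<close>
  let ?R = "F - (\<Sum>\<nu>\<in>partitions_of d. sscale (qt_inner F (P \<nu>) / qt_inner (P \<nu>) (P \<nu>)) (P \<nu>))"
  have *: "qt_inner ?R (P \<mu>) = 0" if \<mu>: "\<mu> \<in> partitions_of d" for \<mu>
  proof -
    have "qt_inner (P \<mu>) (P \<mu>) \<noteq> 0"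
      using norm_pos[of \<mu>] \<mu> by (auto simp: partitions_of_def)
    moreover have "partitions_of d \<subseteq> partitions" by (auto simp: partitions_of_def)
    ultimately show ?thesis
      using inner_sum_P[OF finite_partitions_of _ \<mu>, of "\<lambda>\<nu>. qt_inner F (P \<nu>) / qt_inner (P \<nu>) (P \<nu>)"]
      by simp
  qed
  have "?R \<in> symfun.span (P ` partitions_of d)"
    by (intro symfun.span_diff[OF homogeneous_span[OF F]] symfun.span_sum symfun.span_scale symfun.span_base imageI)
  moreover have "qt_inner ?R G = 0" if "G \<in> symfun.span (P ` partitions_of d)" for G
    using that
  proof (induction rule: symfun.span_induct_alt)
    case (step c x y)
    then obtain \<mu> where "x = P \<mu>" "\<mu> \<in> partitions_of d" by auto
    then show ?case using step.IH *[of \<mu>] by (simp del: qt_inner_left)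
  qed simp
  ultimately have "qt_inner ?R ?R = 0" by blast
  then have "?R = 0" using qt_inner_pos[of ?R] by force
  then show ?thesis by simp
qed

text \<open>The left side pairs with every P_\<mu> to \<alpha>(P_\<mu>), because the power sums are
  orthogonal with squared norm \<open>qt_weight\<close>; its expansion in the P's is the right side.
  It is the two-alphabet kernel with the functional \<alpha>, later an evaluation, applied in one
  alphabet.\<close>

lemma reproducing_kernel:
  assumes add: "\<And>F G. \<alpha> (F + G) = \<alpha> F + \<alpha> G" and scale: "\<And>c F. \<alpha> (sscale c F) = c * \<alpha> F"
  shows "(\<Sum>\<nu>\<in>partitions_of d. sscale (\<alpha> (power_sums \<nu>) / qt_weight \<nu>) (power_sums \<nu>))
    = (\<Sum>\<nu>\<in>partitions_of d. sscale (\<alpha> (P \<nu>) / qt_inner (P \<nu>) (P \<nu>)) (P \<nu>))"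
proof -
  let ?K = "\<Sum>\<nu>\<in>partitions_of d. sscale (\<alpha> (power_sums \<nu>) / qt_weight \<nu>) (power_sums \<nu>)"
  have zero: "\<alpha> 0 = 0" using add[of 0 0] by simp
  have sum: "\<alpha> (sum f A) = (\<Sum>a\<in>A. \<alpha> (f a))" for f :: "nat list \<Rightarrow> _" and A
    by (induction A rule: infinite_finite_induct) (simp_all add: zero add)
  have "?K \<in> homogeneous d"
    unfolding homogeneous_eq_span_power_sums
    by (intro symfun.span_sum symfun.span_scale symfun.span_base) auto
  then have "?K = (\<Sum>\<mu>\<in>partitions_of d. sscale (qt_inner ?K (P \<mu>) / qt_inner (P \<mu>) (P \<mu>)) (P \<mu>))"
    by (rule expansion)
  moreover
  have "qt_inner ?K (P \<mu>) = \<alpha> (P \<mu>)" if \<mu>: "\<mu> \<in> partitions_of d" for \<mu>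
  proof -
    have "\<alpha> (power_sums \<nu>) / qt_weight \<nu> * qt_inner (power_sums \<nu>) (P \<mu>)
        = \<alpha> (sscale (psum_coeff (P \<mu>) \<nu>) (power_sums \<nu>))" if "\<nu> \<in> partitions_of d" for \<nu>
    proof -
      have "is_partition \<nu>" using that by (simp add: partitions_of_def)
      then show ?thesis
        using qt_weight_pos[of \<nu>] by (simp add: qt_inner_commute[of _ "P \<mu>"] qt_inner_power_sums scale)
    qed
    then have "qt_inner ?K (P \<mu>) = \<alpha> (\<Sum>\<nu>\<in>partitions_of d. sscale (psum_coeff (P \<mu>) \<nu>) (power_sums \<nu>))"
      by (simp add: sum)
    also have "(\<Sum>\<nu>\<in>partitions_of d. sscale (psum_coeff (P \<mu>) \<nu>) (power_sums \<nu>)) = P \<mu>"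
      by (rule psum_expansion_homogeneous[symmetric])
        (use homogeneous[of \<mu>] \<mu> in \<open>auto simp: partitions_of_def\<close>)
    finally show ?thesis .
  qed
  then have "(\<Sum>\<mu>\<in>partitions_of d. sscale (qt_inner ?K (P \<mu>) / qt_inner (P \<mu>) (P \<mu>)) (P \<mu>))
      = (\<Sum>\<mu>\<in>partitions_of d. sscale (\<alpha> (P \<mu>) / qt_inner (P \<mu>) (P \<mu>)) (P \<mu>))"
    by (intro sum.cong refl) (simp only:)
  ultimately show ?thesis by (rule trans)
qed

lemma macdonald_kernel_expansion:
  "macdonald_kernel qq tt n d x z
    = (\<Sum>\<nu>\<in>partitions_of d. evl n x (P \<nu>) * evl n z (P \<nu>) / qt_inner (P \<nu>) (P \<nu>))"
proof -
  let ?K = "\<Sum>\<nu>\<in>partitions_of d. sscale (evl n z (power_sums \<nu>) / qt_weight \<nu>) (power_sums \<nu>)"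
  have "1 / of_nat (zee \<nu>) * prod_list (map (\<lambda>r. (1 - tt ^ r) / (1 - qq ^ r) * (\<Sum>l<n. x l ^ r) * (\<Sum>i<n. z i ^ r)) \<nu>)
      = evl n z (power_sums \<nu>) / qt_weight \<nu> * evl n x (power_sums \<nu>)" if "\<nu> \<in> partitions_of d" for \<nu>
  proof -
    have \<nu>: "0 \<notin> set \<nu>" using that by (simp add: partitions_of_def is_partition_def)
    have "prod_list (map (\<lambda>r. (1 - tt ^ r) / (1 - qq ^ r) * (\<Sum>l<n. x l ^ r) * (\<Sum>i<n. z i ^ r)) \<nu>)
        = evl n z (power_sums \<nu>) * evl n x (power_sums \<nu>) / prod_list (map (\<lambda>r. (1 - qq ^ r) / (1 - tt ^ r)) \<nu>)"
      unfolding evl_power_sums[OF \<nu>] using \<nu>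
    proof (induction \<nu>)
      case (Cons r \<nu>)
      then have r: "r > 0" by auto
      then show ?case using Cons qq_power_ne_1[OF r] tt_power_ne_1[OF r] by simp
    qed simp
    then show ?thesis by (simp add: qt_weight_def)
  qed
  then have "macdonald_kernel qq tt n d x z = evl n x ?K"
    by (simp add: macdonald_kernel_def cauchy_sum_def)
  also have "?K = (\<Sum>\<nu>\<in>partitions_of d. sscale (evl n z (P \<nu>) / qt_inner (P \<nu>) (P \<nu>)) (P \<nu>))"
    by (rule reproducing_kernel) simp_all
  finally show ?thesis by (simp add: mult_ac)
qed

end

lemma gram_schmidt:
  assumes "finite A"
  shows "\<exists>P. (\<forall>\<nu>\<in>A. P \<nu> - monomial_sym \<nu> \<in> symfun.span (monomial_sym ` {\<mu> \<in> A. partition_key \<mu> < partition_key \<nu>})) \<and>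
    (\<forall>\<nu>\<in>A. \<forall>\<mu>\<in>A. \<nu> \<noteq> \<mu> \<longrightarrow> qt_inner (P \<nu>) (P \<mu>) = 0)"
  using assms
proof (induction A rule: finite_ranking_induct[where f = partition_key])
  case (insert x S)
  then obtain P where P1: "\<And>\<nu>. \<nu> \<in> S \<Longrightarrow> P \<nu> - monomial_sym \<nu> \<in> symfun.span (monomial_sym ` {\<mu> \<in> S. partition_key \<mu> < partition_key \<nu>})"
    and P2: "\<And>\<nu> \<mu>. \<nu> \<in> S \<Longrightarrow> \<mu> \<in> S \<Longrightarrow> \<nu> \<noteq> \<mu> \<Longrightarrow> qt_inner (P \<nu>) (P \<mu>) = 0" by blast
  show ?case
  proof (cases "x \<in> S")
    case True
    then show ?thesis using P1 P2 by (auto simp: insert_absorb intro!: exI[of _ P])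
  next
    case False
    define R where "R = (\<Sum>a\<in>S. sscale (qt_inner (monomial_sym x) (P a) / qt_inner (P a) (P a)) (P a))"
    define P' where "P' = P(x := monomial_sym x - R)"
    have S: "P' \<nu> = P \<nu>" if "\<nu> \<in> S" for \<nu> using that False by (auto simp: P'_def)
    have x: "P' x = monomial_sym x - R" by (simp add: P'_def)
    have less: "partition_key \<nu> < partition_key x" if "\<nu> \<in> S" for \<nu>
      using insert.hyps(2)[OF that] that False by (metis order.not_eq_order_implies_strict partition_key_inj)
    have inS: "P a \<in> symfun.span (monomial_sym ` S)" if a: "a \<in> S" for a
    proof -
      have "P a - monomial_sym a \<in> symfun.span (monomial_sym ` S)"
        using P1[OF a] by (rule rev_subsetD) (intro symfun.span_mono, auto)
      then have "(P a - monomial_sym a) + monomial_sym a \<in> symfun.span (monomial_sym ` S)"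
        by (rule symfun.span_add) (use a in \<open>auto intro: symfun.span_base\<close>)
      then show ?thesis by simp
    qed
    have "P' \<nu> - monomial_sym \<nu> \<in> symfun.span (monomial_sym ` {\<mu> \<in> insert x S. partition_key \<mu> < partition_key \<nu>})"
      if \<nu>: "\<nu> \<in> insert x S" for \<nu>
    proof (cases "\<nu> = x")
      case True
      have "{\<mu> \<in> insert x S. partition_key \<mu> < partition_key x} = S" using less by auto
      moreover have "- R \<in> symfun.span (monomial_sym ` S)"
        unfolding R_def by (intro symfun.span_neg symfun.span_sum symfun.span_scale inS)
      ultimately show ?thesis using True x by simp
    next
      case False
      then show ?thesis using P1[of \<nu>] \<nu> S
        by (auto intro: rev_subsetD[OF _ symfun.span_mono])
    qed
    moreover have *: "qt_inner (P' x) (P a) = 0" if a: "a \<in> S" for a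
    proof -
      have "(\<Sum>b\<in>S. qt_inner (monomial_sym x) (P b) / qt_inner (P b) (P b) * qt_inner (P b) (P a))
          = (\<Sum>b\<in>{a}. qt_inner (monomial_sym x) (P b) / qt_inner (P b) (P b) * qt_inner (P b) (P a))"
        by (rule sum.mono_neutral_right[OF insert.hyps(1)]) (use a P2 in auto)
      \<comment> \<open>If a norm in the denominator were 0, positivity would give P a = 0, and the
        value 0 of the quotient is the right one.\<close>
      moreover have "qt_inner (monomial_sym x) (P a) = 0" if "qt_inner (P a) (P a) = 0"
        using qt_inner_pos[of "P a"] that by force
      ultimately show ?thesis by (auto simp: x R_def)
    qed
    moreover have "qt_inner (P' \<nu>) (P' \<mu>) = 0" if "\<nu> \<in> insert x S" "\<mu> \<in> insert x S" "\<nu> \<noteq> \<mu>" for \<nu> \<mu>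
      using that P2[of \<nu> \<mu>] S *[of \<mu>] *[of \<nu>] qt_inner_commute[of "P \<nu>" "P' x"]
      by (cases "\<nu> = x"; cases "\<mu> = x") auto
    ultimately show ?thesis by (intro exI[of _ P']) blast
  qed
qed simp

text \<open>Gram-Schmidt is run in each degree separately; different degrees are orthogonal because
  their power sum supports are disjoint.\<close>

lemma orthogonal_basis_exists: "\<exists>P. orthogonal_basis P"
proof -
  have "\<forall>d. \<exists>P. \<forall>\<nu>\<in>partitions_of d. P \<nu> - monomial_sym \<nu>
        \<in> symfun.span (monomial_sym ` {\<mu> \<in> partitions_of d. partition_key \<mu> < partition_key \<nu>})
      \<and> (\<forall>\<mu>\<in>partitions_of d. \<nu> \<noteq> \<mu> \<longrightarrow> qt_inner (P \<nu>) (P \<mu>) = 0)"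
    using gram_schmidt[OF finite_partitions_of] by blast
  from choice[OF this] obtain P where P: "\<And>d \<nu>. \<nu> \<in> partitions_of d \<Longrightarrow> P d \<nu> - monomial_sym \<nu>
        \<in> symfun.span (monomial_sym ` {\<mu> \<in> partitions_of d. partition_key \<mu> < partition_key \<nu>})"
      "\<And>d \<nu> \<mu>. \<nu> \<in> partitions_of d \<Longrightarrow> \<mu> \<in> partitions_of d \<Longrightarrow> \<nu> \<noteq> \<mu> \<Longrightarrow> qt_inner (P d \<nu>) (P d \<mu>) = 0"
    by blast
  let ?P = "\<lambda>\<nu>. P (sum_list \<nu>) \<nu>"
  have low: "lower_partitions \<nu> = {\<mu> \<in> partitions_of (sum_list \<nu>). partition_key \<mu> < partition_key \<nu>}" for \<nu>
    by (auto simp: lower_partitions_def partitions_of_def)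
  have hom: "?P \<nu> \<in> homogeneous (sum_list \<nu>)" if \<nu>: "is_partition \<nu>" for \<nu>
  proof -
    have "?P \<nu> - monomial_sym \<nu> \<in> homogeneous (sum_list \<nu>)"
      unfolding homogeneous_def
      using P(1)[of \<nu> "sum_list \<nu>"] \<nu>
      by (auto simp: partitions_of_def intro: rev_subsetD[OF _ symfun.span_mono])
    then have "(?P \<nu> - monomial_sym \<nu>) + monomial_sym \<nu> \<in> homogeneous (sum_list \<nu>)"
      using monomial_sym_homogeneous[OF \<nu>] unfolding homogeneous_def by (rule symfun.span_add)
    then show ?thesis by simp
  qed
  have "orthogonal_basis ?P"
  proof
    fix \<nu> assume "is_partition \<nu>"
    then show "?P \<nu> - monomial_sym \<nu> \<in> symfun.span (monomial_sym ` lower_partitions \<nu>)"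
      unfolding low using P(1)[of \<nu> "sum_list \<nu>"] by (simp add: partitions_of_def)
  next
    fix \<nu> \<mu> assume "is_partition \<nu>" "is_partition \<mu>" "\<nu> \<noteq> \<mu>"
    then show "qt_inner (?P \<nu>) (?P \<mu>) = 0"
      using P(2)[of \<nu> "sum_list \<nu>" \<mu>] qt_inner_homogeneous[OF hom hom]
      by (cases "sum_list \<nu> = sum_list \<mu>") (auto simp: partitions_of_def)
  qed
  then show ?thesis by blast
qed


section \<open>The Macdonald operators are diagonal\<close>

definition eigenvalue :: "nat \<Rightarrow> qt \<Rightarrow> nat list \<Rightarrow> qt" where
  "eigenvalue n X \<nu> = (\<Prod>i<n. 1 + X * tt ^ (n - 1 - i) * qq ^ nth_part \<nu> i)"

lemma tt_qq_monomial: "tt ^ a * qq ^ b = to_fract (monom (monom 1 a) b)"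
proof -
  have p: "to_fract x ^ k = to_fract (x ^ k)" for x :: "rat poly poly" and k
    by (induction k) simp_all
  have "[:[:0, 1:]:] ^ a = [:monom (1 :: rat) a:]"
    by (induction a) (simp_all add: one_pCons monom_Suc)
  moreover have "[:0, 1:] ^ b = (monom 1 b :: rat poly poly)"
    by (simp add: monom_altdef)
  ultimately show ?thesis
    by (simp add: tt_def qq_def p smult_monom flip: to_fract_mult)
qed

lemma tt_qq_inj: "tt ^ a * qq ^ b = tt ^ c * qq ^ e \<Longrightarrow> a = c \<and> b = e"
  unfolding tt_qq_monomial by (auto simp: monom_eq_iff')

lemma qq_nonzero [simp]: "qq \<noteq> 0" and tt_nonzero [simp]: "tt \<noteq> 0"
  using qq_gt_1 tt_gt_1 by auto

lemma partition_eq_nth_part: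
  assumes "is_partition \<kappa>" "is_partition \<nu>" "\<And>i. nth_part \<kappa> i = nth_part \<nu> i"
  shows "\<kappa> = \<nu>"
proof -
  have *: "length \<kappa> \<le> length \<nu>" if "is_partition \<kappa>" "is_partition \<nu>" "\<And>i. nth_part \<kappa> i = nth_part \<nu> i" for \<kappa> \<nu>
  proof (rule ccontr)
    assume "\<not> length \<kappa> \<le> length \<nu>"
    then have "nth_part \<kappa> (length \<nu>) \<in> set \<kappa>" by (simp add: nth_part_def)
    then show False using that by (simp add: is_partition_def nth_part_def)
  qed
  have len: "length \<kappa> = length \<nu>" using *[of \<kappa> \<nu>] *[of \<nu> \<kappa>] assms by simp
  show ?thesis
    by (rule nth_equalityI[OF len]) (use assms(3) len in \<open>simp add: nth_part_def split: if_splits\<close>, metis)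
qed

text \<open>As a polynomial in X, the eigenvalue vanishes exactly at the -1/(t^(n-1-i) q^(\<nu>_i)).
  In such a root the power of t names the index i and the power of q the part.\<close>

lemma eigenvalue_inj:
  assumes \<kappa>: "is_partition \<kappa>" "length \<kappa> \<le> n" and \<nu>: "is_partition \<nu>" "length \<nu> \<le> n"
    and eq: "\<And>X. eigenvalue n X \<kappa> = eigenvalue n X \<nu>"
  shows "\<kappa> = \<nu>"
proof (rule partition_eq_nth_part[OF \<kappa>(1) \<nu>(1)])
  fix i
  show "nth_part \<kappa> i = nth_part \<nu> i"
  proof (cases "i < n")
    case True
    let ?c = "tt ^ (n - 1 - i) * qq ^ nth_part \<nu> i"
    have "eigenvalue n (- 1 / ?c) \<nu> = 0"
      unfolding eigenvalue_def using True by (auto intro!: bexI[of _ i])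
    then have "eigenvalue n (- 1 / ?c) \<kappa> = 0" using eq by simp
    then obtain j where j: "j < n" "1 + (- 1 / ?c) * tt ^ (n - 1 - j) * qq ^ nth_part \<kappa> j = 0"
      unfolding eigenvalue_def prod_zero_iff[OF finite_lessThan] by blast
    then have "tt ^ (n - 1 - j) * qq ^ nth_part \<kappa> j = ?c" by (simp add: field_simps)
    then have "n - 1 - j = n - 1 - i" "nth_part \<kappa> j = nth_part \<nu> i" using tt_qq_inj by blast+
    moreover from this(1) have "j = i" using j(1) True by linarith
    ultimately show ?thesis by simp
  qed (use \<kappa>(2) \<nu>(2) in \<open>simp add: nth_part_def\<close>)
qed

lemma shift_sum_linear:
  "shift_sum q t n X (\<lambda>y. \<Sum>l\<in>L. c l * f l y) x = (\<Sum>l\<in>L. c l * shift_sum q t n X (f l) x)"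
  unfolding shift_sum_def sum_distrib_left
  by (subst sum.swap) (intro sum.cong refl, simp add: mult_ac)

definition point :: "(nat \<Rightarrow> nat) \<Rightarrow> nat \<Rightarrow> qt" where
  "point x = (\<lambda>i. of_nat (x i))"

lemma point_generic:
  assumes "x \<in> generic_points n"
  shows "inj_on (point x) {..<n}" "\<And>i. i < n \<Longrightarrow> point x i \<noteq> 0"
  using assms by (auto simp: generic_points_def point_def inj_on_def)

context orthogonal_basis
begin

abbreviation w_eigen :: "nat \<Rightarrow> qt \<Rightarrow> (nat \<Rightarrow> nat) \<Rightarrow> mon \<Rightarrow> qt" where
  "w_eigen n X \<equiv> (\<lambda>\<sigma> m. \<Prod>i<n. 1 + X * tt ^ \<sigma> i * qq ^ Poly_Mapping.lookup m i)"

lemma degree_bound: "is_partition \<nu> \<Longrightarrow> scoeff (P \<nu>) m \<noteq> 0 \<Longrightarrow> mdeg m \<le> sum_list \<nu>"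
  using homogeneous_scoeff[OF homogeneous] by auto

lemma alternant_coeff_key:
  assumes "is_partition l" "is_partition \<nu>" "length \<nu> \<le> n" "alternant_coeff n D w (P l) \<nu> \<noteq> 0"
  shows "partition_key \<nu> \<le> partition_key l"
proof -
  obtain \<mu> where \<mu>: "is_partition \<mu>" "monomial_coeff (P l) \<mu> \<noteq> 0" "\<mu> = \<nu> \<or> dominated \<nu> \<mu>"
    using alternant_coeff_nonzero[OF assms(2,3,4)] by blast
  have "partition_key \<nu> \<le> partition_key \<mu>" using \<mu>(3) dominated_key_less[OF \<mu>(1), of \<nu>] by auto
  also have "\<dots> \<le> partition_key l" by (rule coeff_nonzero(2)[OF assms(1) \<mu>(1,2)])
  finally show ?thesis .
qed

lemma w_eigen_flip:
  "is_partition \<nu> \<Longrightarrow> w_eigen n X (flip n) (Poly_Mapping.nth \<nu>) = eigenvalue n X \<nu>"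
  unfolding eigenvalue_def
  by (rule prod.cong) (auto simp: flip_def nth.rep_eq nth_default_def nth_part_def)

lemma alternant_coeff_eigen:
  assumes l: "is_partition l" "length l \<le> n" "sum_list l = d"
    and eigen: "\<And>x. x \<in> generic_points n \<Longrightarrow> shift_sum qq tt n X (\<lambda>y. evl n y (P l)) (point x)
      = eigenvalue n X l * (vdm n (point x) * evl n (point x) (P l))"
  shows "alternant_coeff n d (w_eigen n X) (P l) \<nu> = eigenvalue n X l * alternant_coeff n d (\<lambda>_ _. 1) (P l) \<nu>"
  using alternant_coeffs_eq[of "{l}" P d n "\<lambda>_. 1" qq tt X "\<lambda>_. eigenvalue n X l" \<nu>]
    eigen degree_bound[OF l(1)] l(3) by (simp add: point_def)

text \<open>Expand the kernel in \<open>kernel_shift_sum_symmetric\<close> as a sum over l of P_l(x)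
  P_l(z)/<P_l, P_l> and compare the coefficients of z^(\<nu>+\<delta>). Induct downwards along
  \<open>partition_key\<close>: terms with l above \<nu> agree by induction, those with l below have
  no such coefficient, so the term l = \<nu> is isolated and yields the equation in x.\<close>

theorem eigen:
  assumes "is_partition \<nu>" "length \<nu> \<le> n" "x \<in> generic_points n"
  shows "shift_sum qq tt n X (\<lambda>y. evl n y (P \<nu>)) (point x)
    = eigenvalue n X \<nu> * (vdm n (point x) * evl n (point x) (P \<nu>))"
  using assms
proof (induction "card {\<mu> \<in> partitions_of (sum_list \<nu>). partition_key \<nu> < partition_key \<mu>}"
    arbitrary: \<nu> x rule: less_induct)
  case less
  define d where "d = sum_list \<nu>"
  define s where "s = (signof (flip n) :: qt)"
  define u where "u = (\<lambda>l. vdm n (point x) * evl n (point x) (P l) / qt_inner (P l) (P l))"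
  define v where "v = (\<lambda>l. shift_sum qq tt n X (\<lambda>y. evl n y (P l)) (point x) / qt_inner (P l) (P l))"
  let ?A = "\<lambda>l. alternant_coeff n d (\<lambda>_ _. 1) (P l) \<nu>"
  let ?B = "\<lambda>l. alternant_coeff n d (w_eigen n X) (P l) \<nu>"
  have \<nu>: "\<nu> \<in> partitions_of d" using less.prems by (simp add: d_def partitions_of_def)
  have "s \<noteq> 0" by (simp add: s_def sign_def)
  have bound: "mdeg m \<le> d" if "l \<in> partitions_of d" "scoeff (P l) m \<noteq> 0" for l m
    using degree_bound[of l m] that by (simp add: partitions_of_def)
  have kernel: "macdonald_kernel qq tt n d y z = (\<Sum>l\<in>partitions_of d. evl n y (P l) / qt_inner (P l) (P l) * evl n z (P l))" for y z
    by (simp add: macdonald_kernel_expansion)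
  have eq: "(\<Sum>l\<in>partitions_of d. u l * ?B l) = (\<Sum>l\<in>partitions_of d. v l * ?A l)"
  proof (rule alternant_coeffs_eq[OF finite_partitions_of bound])
    fix z assume z: "z \<in> generic_points n"
    have 1: "vdm n (point x) * shift_sum qq tt n X (macdonald_kernel qq tt n d (point x)) (point z)
        = vdm n (point z) * shift_sum qq tt n X (macdonald_kernel qq tt n d (point z)) (point x)"
      by (rule kernel_shift_sum_symmetric[OF qq_power_ne_1 point_generic[OF less.prems(3)] point_generic[OF z]])
    have 2: "macdonald_kernel qq tt n d (point x)
        = (\<lambda>z. \<Sum>l\<in>partitions_of d. evl n (point x) (P l) / qt_inner (P l) (P l) * evl n z (P l))"
      by (simp add: kernel fun_eq_iff)
    have 3: "macdonald_kernel qq tt n d (point z)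
        = (\<lambda>x. \<Sum>l\<in>partitions_of d. evl n (point z) (P l) / qt_inner (P l) (P l) * evl n x (P l))"
      by (simp add: kernel fun_eq_iff)
    have "vdm n (point x) * (\<Sum>l\<in>partitions_of d. evl n (point x) (P l) / qt_inner (P l) (P l) *
          shift_sum qq tt n X (\<lambda>y. evl n y (P l)) (point z))
        = vdm n (point z) * (\<Sum>l\<in>partitions_of d. evl n (point z) (P l) / qt_inner (P l) (P l) *
          shift_sum qq tt n X (\<lambda>y. evl n y (P l)) (point x))"
      using 1 unfolding 2 3 shift_sum_linear .
    then show "(\<Sum>l\<in>partitions_of d. u l * shift_sum qq tt n X (\<lambda>y. evl n y (P l)) (\<lambda>i. of_nat (z i)))
        = (\<Sum>l\<in>partitions_of d. v l * (vdm n (\<lambda>i. of_nat (z i)) * evl n (\<lambda>i. of_nat (z i)) (P l)))"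
      unfolding u_def v_def sum_distrib_left by (simp add: mult_ac point_def)
  qed
  have max: "\<not> dominated \<nu> \<mu>" if "is_partition \<mu>" "monomial_coeff (P \<nu>) \<mu> \<noteq> 0" for \<mu>
    using coeff_nonzero(2)[OF less.prems(1) that] dominated_key_less[OF that(1), of \<nu>] by auto
  have lead: "alternant_coeff n d w (P \<nu>) \<nu> = s * w (flip n) (Poly_Mapping.nth \<nu>)" for w
    using alternant_coeff_leading[of \<nu> n d "P \<nu>" w, OF less.prems(1,2) _ max] coeff_diag[OF less.prems(1)]
    by (simp add: d_def s_def)
  have A: "?A \<nu> = s" and B: "?B \<nu> = s * eigenvalue n X \<nu>"
    unfolding lead w_eigen_flip[OF less.prems(1)] by simp_all
  have others: "u l * ?B l = v l * ?A l" if l: "l \<in> partitions_of d - {\<nu>}" for l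
  proof (cases "partition_key \<nu> < partition_key l")
    case True
    have lp: "is_partition l" "sum_list l = d" using l by (auto simp: partitions_of_def)
    have len: "length l \<le> n"
      using partition_key_le_length[OF less_imp_le[OF True]] less.prems(2) by linarith
    have "card {\<mu> \<in> partitions_of (sum_list l). partition_key l < partition_key \<mu>}
        < card {\<mu> \<in> partitions_of (sum_list \<nu>). partition_key \<nu> < partition_key \<mu>}"
    proof (rule psubset_card_mono)
      show "finite {\<mu> \<in> partitions_of (sum_list \<nu>). partition_key \<nu> < partition_key \<mu>}" by simp
    qed (use True lp in \<open>auto simp: d_def partitions_of_def\<close>)
    then have IH: "shift_sum qq tt n X (\<lambda>y. evl n y (P l)) (point z)
        = eigenvalue n X l * (vdm n (point z) * evl n (point z) (P l))" if "z \<in> generic_points n" for z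
      using less.hyps[of l z] lp(1) len that by blast
    show ?thesis
      using alternant_coeff_eigen[OF lp(1) len lp(2) IH] IH[OF less.prems(3)]
      by (simp add: u_def v_def)
  next
    case False
    then have "\<not> partition_key \<nu> \<le> partition_key l"
      using l by (metis Diff_iff insertI1 order.not_eq_order_implies_strict partition_key_inj)
    then have "?A l = 0" "?B l = 0"
      using alternant_coeff_key[of l \<nu> n d] l less.prems by (auto simp: partitions_of_def)
    then show ?thesis by simp
  qed
  have "(\<Sum>l\<in>partitions_of d - {\<nu>}. u l * ?B l) = (\<Sum>l\<in>partitions_of d - {\<nu>}. v l * ?A l)"
    by (rule sum.cong[OF refl others])
  then have "u \<nu> * ?B \<nu> = v \<nu> * ?A \<nu>"
    using eq \<nu> by (simp add: sum.remove[OF finite_partitions_of \<nu>])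
  then have "u \<nu> * eigenvalue n X \<nu> = v \<nu>" using A B \<open>s \<noteq> 0\<close> by simp
  then show ?case
    using norm_pos[OF less.prems(1)] by (simp add: u_def v_def field_simps)
qed

text \<open>Of the partitions occurring in P_\<nu> that equal or dominate \<mu>, take \<kappa> with
  maximal key. Nothing in P_\<nu> dominates \<kappa>, so the leading alternant coefficient at
  \<kappa> shows that \<kappa> and \<nu> have the same eigenvalues; hence \<kappa> = \<nu>. As many
  variables as the size d suffice, since partitions of d have at most d parts.\<close>

theorem dominance_triangular:
  assumes \<nu>: "is_partition \<nu>" and \<mu>: "is_partition \<mu>" "monomial_coeff (P \<nu>) \<mu> \<noteq> 0"
  shows "\<mu> = \<nu> \<or> dominated \<mu> \<nu>"
proof -
  define d where "d = sum_list \<nu>"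
  let ?S = "{\<kappa> \<in> partitions_of d. monomial_coeff (P \<nu>) \<kappa> \<noteq> 0 \<and> (\<kappa> = \<mu> \<or> dominated \<mu> \<kappa>)}"
  have len: "length \<kappa> \<le> d" if "\<kappa> \<in> partitions_of d" for \<kappa>
    using that length_le_sum_list[of \<kappa>] by (auto simp: partitions_of_def is_partition_def)
  have "\<mu> \<in> ?S" using \<mu> coeff_nonzero(1)[OF \<nu> \<mu>] by (simp add: d_def partitions_of_def)
  moreover have "finite ?S" by simp
  ultimately have "Max (partition_key ` ?S) \<in> partition_key ` ?S" by (intro Max_in) auto
  then obtain \<kappa> where \<kappa>: "\<kappa> \<in> ?S" "partition_key \<kappa> = Max (partition_key ` ?S)" by auto
  have \<kappa>max: "partition_key \<rho> \<le> partition_key \<kappa>" if "\<rho> \<in> ?S" for \<rho>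
    using \<kappa>(2) that \<open>finite ?S\<close> by simp
  have \<kappa>p: "is_partition \<kappa>" "sum_list \<kappa> = d" using \<kappa>(1) by (auto simp: partitions_of_def)
  have max: "\<not> dominated \<kappa> \<rho>" if \<rho>: "is_partition \<rho>" "monomial_coeff (P \<nu>) \<rho> \<noteq> 0" for \<rho>
  proof
    assume dom: "dominated \<kappa> \<rho>"
    then have less: "partition_key \<kappa> < partition_key \<rho>" by (rule dominated_key_less[OF \<rho>(1)])
    have "\<rho> = \<mu> \<or> dominated \<mu> \<rho>"
      using \<kappa>(1) dom dominated_trans[of \<mu> \<kappa> \<rho>] by auto
    then have "\<rho> \<in> ?S" using \<rho> coeff_nonzero(1)[OF \<nu> \<rho>] by (simp add: d_def partitions_of_def)
    then show False using \<kappa>max[of \<rho>] less by auto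
  qed
  have ev: "eigenvalue d X \<kappa> = eigenvalue d X \<nu>" for X
  proof -
    have "alternant_coeff d d (w_eigen d X) (P \<nu>) \<kappa>
        = eigenvalue d X \<nu> * alternant_coeff d d (\<lambda>_ _. 1) (P \<nu>) \<kappa>"
      by (rule alternant_coeff_eigen[OF \<nu>])
        (use eigen[OF \<nu>] len[of \<nu>] \<nu> in \<open>auto simp: d_def partitions_of_def\<close>)
    moreover have "alternant_coeff d d w (P \<nu>) \<kappa> = signof (flip d) * monomial_coeff (P \<nu>) \<kappa> * w (flip d) (Poly_Mapping.nth \<kappa>)" for w
      by (rule alternant_coeff_leading) (use \<kappa>p len[of \<kappa>] \<kappa>(1) max in auto)
    ultimately show ?thesis
      using \<kappa>(1) w_eigen_flip[OF \<kappa>p(1), where n = d and X = X] by (simp add: sign_def split: if_splits)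
  qed
  have "\<kappa> = \<nu>"
    by (rule eigenvalue_inj[of \<kappa> d \<nu>])
      (use \<kappa>p len[of \<kappa>] len[of \<nu>] \<kappa>(1) \<nu> ev in \<open>auto simp: d_def partitions_of_def\<close>)
  then show ?thesis using \<kappa>(1) by auto
qed

lemma macdonald_family: "macdonald_family P"
  unfolding macdonald_family_def
proof (intro conjI allI impI)
  fix \<nu> assume \<nu>: "is_partition \<nu>"
  let ?F = "P \<nu> - monomial_sym \<nu>"
  have supp: "dominated \<mu> \<nu>" if "\<mu> \<in> monomial_support ?F" for \<mu>
    using that dominance_triangular[OF \<nu>, of \<mu>] coeff_diag[OF \<nu>]
    by (auto simp: monomial_support_def monomial_coeff_monomial_sym[OF _ \<nu>] \<nu> split: if_splits)
  have "?F = (\<Sum>\<mu>\<in>monomial_support ?F. sscale (monomial_coeff ?F \<mu>) (monomial_sym \<mu>))"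
    by (rule monomial_expansion[OF finite_monomial_support]) (auto simp: monomial_support_def)
  also have "\<dots> \<in> symfun.span (monomial_sym ` {\<mu>. is_partition \<mu> \<and> dominated \<mu> \<nu>})"
    by (intro symfun.span_sum symfun.span_scale symfun.span_base imageI)
      (use supp in \<open>auto simp: monomial_support_def\<close>)
  finally show "?F \<in> symfun.span (monomial_sym ` {\<mu>. is_partition \<mu> \<and> dominated \<mu> \<nu>})" .
qed (rule orthogonal)

section \<open>Uniqueness of the Macdonald family\<close>

lemma orthogonal_monomial:
  assumes "is_partition \<nu>" "\<mu> \<in> lower_partitions \<nu>"
  shows "qt_inner (P \<nu>) (monomial_sym \<mu>) = 0"
proof -
  have \<mu>: "is_partition \<mu>" "partition_key \<mu> < partition_key \<nu>"
    using assms(2) by (auto simp: lower_partitions_def)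
  have "qt_inner (P \<nu>) F = 0"
    if "F \<in> symfun.span (P ` {\<kappa> \<in> partitions_of (sum_list \<mu>). partition_key \<kappa> \<le> partition_key \<mu>})" for F
    using that
  proof (induction rule: symfun.span_induct_alt)
    case (step c x y)
    then obtain \<kappa> where "x = P \<kappa>" "is_partition \<kappa>" "partition_key \<kappa> \<le> partition_key \<mu>"
      by (auto simp: partitions_of_def)
    moreover from this(3) have "\<nu> \<noteq> \<kappa>" using \<mu>(2) by auto
    ultimately show ?case using step.IH orthogonal[OF assms(1), of \<kappa>] by simp
  qed simp
  then show ?thesis using monomial_in_span[OF \<mu>(1)] by blast
qed

end

text \<open>The difference lies in the span of the lower monomial functions, to which both members
  are orthogonal; so it is orthogonal to itself.\<close>

lemma orthogonal_basis_unique: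
  assumes "orthogonal_basis P" "orthogonal_basis R" "is_partition \<nu>"
  shows "P \<nu> = R \<nu>"
proof -
  interpret P: orthogonal_basis P by fact
  interpret R: orthogonal_basis R by fact
  have "(P \<nu> - monomial_sym \<nu>) - (R \<nu> - monomial_sym \<nu>) \<in> symfun.span (monomial_sym ` lower_partitions \<nu>)"
    by (intro symfun.span_diff P.triangular R.triangular assms(3))
  then have D: "P \<nu> - R \<nu> \<in> symfun.span (monomial_sym ` lower_partitions \<nu>)" by simp
  have "qt_inner (P \<nu> - R \<nu>) F = 0" if "F \<in> symfun.span (monomial_sym ` lower_partitions \<nu>)" for F
    using that
  proof (induction rule: symfun.span_induct_alt)
    case (step c x y)
    then show ?case
      using P.orthogonal_monomial[OF assms(3)] R.orthogonal_monomial[OF assms(3)] by auto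
  qed simp
  then have "qt_inner (P \<nu> - R \<nu>) (P \<nu> - R \<nu>) = 0" using D by blast
  then show ?thesis using qt_inner_pos[of "P \<nu> - R \<nu>"] by force
qed

lemma macdonald_family_orthogonal_basis:
  assumes "macdonald_family P"
  shows "orthogonal_basis P"
proof
  fix \<nu> assume \<nu>: "is_partition \<nu>"
  then have "P \<nu> - monomial_sym \<nu> \<in> symfun.span (monomial_sym ` {\<mu>. is_partition \<mu> \<and> dominated \<mu> \<nu>})"
    using assms unfolding macdonald_family_def by blast
  then show "P \<nu> - monomial_sym \<nu> \<in> symfun.span (monomial_sym ` lower_partitions \<nu>)"
    by (rule rev_subsetD) (intro symfun.span_mono image_mono, use \<nu> dominated_lower_partitions in auto)
qed (use assms in \<open>auto simp: macdonald_family_def\<close>)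

text \<open>Resolves the definite description: P is itself a Macdonald family, and every Macdonald
  family, being triangular for dominance, is triangular for the total order.\<close>

lemma macdonald_P_eq:
  assumes "orthogonal_basis P" "is_partition \<nu>"
  shows "macdonald_P \<nu> = P \<nu>"
  unfolding macdonald_P_def
proof (rule the_equality)
  show "\<exists>P'. macdonald_family P' \<and> P \<nu> = P' \<nu>"
    using orthogonal_basis.macdonald_family[OF assms(1)] by blast
  fix F assume "\<exists>P'. macdonald_family P' \<and> F = P' \<nu>"
  then show "F = P \<nu>"
    using orthogonal_basis_unique[OF macdonald_family_orthogonal_basis assms(1)] assms(2) by blast
qed

global_interpretation mac: orthogonal_basis macdonald_P
proof -
  obtain P where P: "orthogonal_basis P" using orthogonal_basis_exists by blast
  show "orthogonal_basis macdonald_P"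
  proof
    fix \<nu> assume "is_partition \<nu>"
    then show "macdonald_P \<nu> - monomial_sym \<nu> \<in> symfun.span (monomial_sym ` lower_partitions \<nu>)"
      using orthogonal_basis.triangular[OF P] macdonald_P_eq[OF P] by simp
  next
    fix \<nu> \<mu> assume "is_partition \<nu>" "is_partition \<mu>" "\<nu> \<noteq> \<mu>"
    then show "qt_inner (macdonald_P \<nu>) (macdonald_P \<mu>) = 0"
      using orthogonal_basis.orthogonal[OF P] macdonald_P_eq[OF P] by simp
  qed
qed


section \<open>Adding and removing columns\<close>

lemma length_add_column [simp]: "length (add_column n \<nu>) = n"
  by (simp add: add_column_def)

lemma nth_part_add_column: "nth_part (add_column n \<nu>) i = (if i < n then nth_part \<nu> i + 1 else 0)"
  by (simp add: nth_part_def add_column_def)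

lemma nth_part_mono:
  assumes "is_partition \<nu>" "i \<le> j"
  shows "nth_part \<nu> j \<le> nth_part \<nu> i"
  using assms sorted_wrt_nth_less[of "(\<ge>)" \<nu> i j]
  by (cases "i = j") (auto simp: nth_part_def is_partition_def)

lemma is_partition_add_column: "is_partition \<nu> \<Longrightarrow> is_partition (add_column n \<nu>)"
  by (auto simp: is_partition_def add_column_def sorted_wrt_iff_nth_less
      intro!: nth_part_mono[unfolded is_partition_def])

lemma sum_list_eq_sum_nth_part: "length \<nu> \<le> n \<Longrightarrow> sum_list \<nu> = (\<Sum>i<n. nth_part \<nu> i)"
  by (simp add: sum_nth_part)

lemma sum_list_add_column: "length \<nu> \<le> n \<Longrightarrow> sum_list (add_column n \<nu>) = sum_list \<nu> + n"
  unfolding sum_list_eq_sum_nth_part[of "add_column n \<nu>" n, simplified]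
  by (simp add: nth_part_add_column sum_list_eq_sum_nth_part sum_Suc)

text \<open>For a partition the zeros created by the subtraction stand at the end, so
  \<open>takeWhile\<close> removes exactly these.\<close>

definition remove_column :: "nat list \<Rightarrow> nat list" where
  "remove_column \<mu> = takeWhile (\<lambda>x. 0 < x) (map (\<lambda>x. x - 1) \<mu>)"

lemma nth_part_remove_column:
  assumes "is_partition \<mu>"
  shows "nth_part (remove_column \<mu>) i = nth_part \<mu> i - 1"
proof (cases "i < length (remove_column \<mu>)")
  case True
  then have "i < length \<mu>" using length_takeWhile_le[of "\<lambda>x. 0 < x" "map (\<lambda>x. x - 1) \<mu>"]
    by (simp add: remove_column_def)
  then show ?thesis
    using True by (simp add: nth_part_def remove_column_def takeWhile_nth)
next
  case False
  let ?l = "length (remove_column \<mu>)"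
  have "nth_part \<mu> i - 1 = 0"
  proof (cases "i < length \<mu>")
    case True
    then have l: "?l < length \<mu>" using False by simp
    then have "\<not> 0 < map (\<lambda>x. x - 1) \<mu> ! ?l"
      using nth_length_takeWhile[of "\<lambda>x. 0 < x" "map (\<lambda>x. x - 1) \<mu>"] by (simp add: remove_column_def)
    then have "nth_part \<mu> ?l - 1 = 0" using l by (simp add: nth_part_def)
    moreover have "nth_part \<mu> i \<le> nth_part \<mu> ?l" using nth_part_mono[OF assms] False by simp
    ultimately show ?thesis by simp
  qed (simp add: nth_part_def)
  then show ?thesis using False by (simp add: nth_part_def)
qed

lemma length_remove_column: "length (remove_column \<mu>) \<le> length \<mu>"
  using length_takeWhile_le[of "\<lambda>x. 0 < x" "map (\<lambda>x. x - 1) \<mu>"] by (simp add: remove_column_def)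

lemma is_partition_remove_column:
  assumes "is_partition \<mu>"
  shows "is_partition (remove_column \<mu>)"
proof -
  have "sorted_wrt (\<ge>) (map (\<lambda>x. x - 1) \<mu>)"
    using assms by (auto simp: is_partition_def sorted_wrt_map intro: sorted_wrt_mono_rel[of _ "(\<ge>)"])
  then have "sorted_wrt (\<ge>) (remove_column \<mu>)"
    unfolding remove_column_def by (metis sorted_wrt_append takeWhile_dropWhile_id)
  moreover have "0 \<notin> set (remove_column \<mu>)"
    unfolding remove_column_def by (metis less_irrefl set_takeWhileD)
  ultimately show ?thesis by (simp add: is_partition_def)
qed

lemma nth_part_pos: "is_partition \<mu> \<Longrightarrow> i < length \<mu> \<Longrightarrow> nth_part \<mu> i > 0"
  by (simp add: nth_part_def is_partition_pos)

lemma add_remove_column: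
  assumes "is_partition \<mu>"
  shows "add_column (length \<mu>) (remove_column \<mu>) = \<mu>"
proof (rule partition_eq_nth_part)
  fix i
  show "nth_part (add_column (length \<mu>) (remove_column \<mu>)) i = nth_part \<mu> i"
    using nth_part_pos[OF assms, of i]
    by (auto simp: nth_part_add_column nth_part_remove_column[OF assms]) (simp add: nth_part_def)
qed (use assms in \<open>auto intro: is_partition_add_column is_partition_remove_column\<close>)

lemma remove_add_column:
  assumes "is_partition \<nu>" "length \<nu> \<le> n"
  shows "remove_column (add_column n \<nu>) = \<nu>"
proof (rule partition_eq_nth_part)
  fix i
  show "nth_part (remove_column (add_column n \<nu>)) i = nth_part \<nu> i"
    unfolding nth_part_remove_column[OF is_partition_add_column[OF assms(1)]]
    using assms(2) by (simp add: nth_part_add_column) (simp add: nth_part_def)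
qed (use assms in \<open>auto intro: is_partition_add_column is_partition_remove_column\<close>)

text \<open>A nonempty partition is its first column, of height \<open>length \<mu>\<close>,
  prepended to the rest, which is smaller in size and no longer.\<close>

lemma partition_column_induct [consumes 1, case_names Nil column]:
  assumes "is_partition \<mu>" "Q []"
    and "\<And>n \<nu>. is_partition \<nu> \<Longrightarrow> length \<nu> \<le> n \<Longrightarrow> n > 0 \<Longrightarrow> Q \<nu> \<Longrightarrow> Q (add_column n \<nu>)"
  shows "Q \<mu>"
  using assms(1)
proof (induction "sum_list \<mu>" arbitrary: \<mu> rule: less_induct)
  case less
  show ?case
  proof (cases "\<mu> = []")
    case False
    let ?\<nu> = "remove_column \<mu>"
    have \<nu>: "is_partition ?\<nu>" "length ?\<nu> \<le> length \<mu>"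
      using less.prems by (simp_all add: is_partition_remove_column length_remove_column)
    have "sum_list \<mu> = sum_list ?\<nu> + length \<mu>"
      using sum_list_add_column[OF \<nu>(2)] add_remove_column[OF less.prems] by simp
    then have "sum_list ?\<nu> < sum_list \<mu>" using False by simp
    then have "Q ?\<nu>" using less.hyps \<nu>(1) by blast
    then have "Q (add_column (length \<mu>) ?\<nu>)" using assms(3)[OF \<nu>] False by simp
    then show ?thesis using add_remove_column[OF less.prems] by simp
  qed (use assms(2) in simp)
qed

lemma add_column_bij:
  "bij_betw (add_column n) {\<nu> \<in> partitions_of d. length \<nu> \<le> n} {\<mu> \<in> partitions_of (d + n). length \<mu> = n}"
proof (rule bij_betw_byWitness[where f' = remove_column])
  show "\<forall>a\<in>{\<nu> \<in> partitions_of d. length \<nu> \<le> n}. remove_column (add_column n a) = a"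
    by (auto simp: partitions_of_def remove_add_column)
  show "\<forall>a\<in>{\<mu> \<in> partitions_of (d + n). length \<mu> = n}. add_column n (remove_column a) = a"
    by (auto simp: partitions_of_def add_remove_column)
  show "add_column n ` {\<nu> \<in> partitions_of d. length \<nu> \<le> n} \<subseteq> {\<mu> \<in> partitions_of (d + n). length \<mu> = n}"
    by (auto simp: partitions_of_def is_partition_add_column sum_list_add_column)
  show "remove_column ` {\<mu> \<in> partitions_of (d + n). length \<mu> = n} \<subseteq> {\<nu> \<in> partitions_of d. length \<nu> \<le> n}"
  proof clarify
    fix \<mu> assume "\<mu> \<in> partitions_of (d + length \<mu>)" "n = length \<mu>"
    then have \<mu>: "is_partition \<mu>" "sum_list \<mu> = d + length \<mu>" by (simp_all add: partitions_of_def)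
    have "sum_list \<mu> = sum_list (remove_column \<mu>) + length \<mu>"
      using sum_list_add_column[OF length_remove_column, of \<mu>] add_remove_column[OF \<mu>(1)] by simp
    then show "remove_column \<mu> \<in> partitions_of d \<and> length (remove_column \<mu>) \<le> length \<mu>"
      using \<mu> by (simp add: partitions_of_def is_partition_remove_column length_remove_column)
  qed
qed

lemma eigenvalue_add_column: "eigenvalue n X (add_column n \<nu>) = eigenvalue n (X * qq) \<nu>"
  unfolding eigenvalue_def by (rule prod.cong) (simp_all add: nth_part_add_column mult_ac)

text \<open>The factor with i = n - 1 is 1 - t^0 q^0.\<close>

lemma eigenvalue_minus_one:
  assumes "length \<nu> < n"
  shows "eigenvalue n (- 1) \<nu> = 0"
  unfolding eigenvalue_def
  by (rule prod_zero) (use assms in \<open>auto simp: nth_part_def intro!: bexI[of _ "n - 1"]\<close>)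

lemma one_minus_tt_qq_nonzero: "a + b > 0 \<Longrightarrow> 1 - tt ^ a * qq ^ b \<noteq> 0"
  using tt_qq_inj[of 0 0 a b] by auto

lemma eigenvalue_add_column_nonzero: "eigenvalue n (- 1) (add_column n \<nu>) \<noteq> 0"
proof -
  have "1 + - 1 * tt ^ (n - 1 - i) * qq ^ nth_part (add_column n \<nu>) i \<noteq> 0" if "i < n" for i
    using one_minus_tt_qq_nonzero[of "n - 1 - i" "nth_part (add_column n \<nu>) i"] that
    by (simp add: nth_part_add_column)
  then show ?thesis unfolding eigenvalue_def by (simp add: prod_zero_iff)
qed


section \<open>Multiplication by the elementary symmetric function\<close>

lemma homogeneous_mult:
  assumes "F \<in> homogeneous d" "G \<in> homogeneous e"
  shows "F * G \<in> homogeneous (d + e)"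
proof (rule homogeneousI)
  fix \<mu> assume \<mu>: "is_partition \<mu>" "monomial_coeff (F * G) \<mu> \<noteq> 0"
  then obtain y where y: "y \<in> splits (Poly_Mapping.nth \<mu>)" "(case y of (a, b) \<Rightarrow> scoeff F a * scoeff G b) \<noteq> 0"
    unfolding monomial_coeff_def times_symfun.rep_eq by (meson sum.neutral)
  obtain a b where ab: "y = (a, b)" by (cases y)
  with y have *: "a + b = Poly_Mapping.nth \<mu>" "scoeff F a \<noteq> 0" "scoeff G b \<noteq> 0" by (auto simp: splits_def)
  then have "mdeg (Poly_Mapping.nth \<mu>) = d + e"
    using homogeneous_scoeff[OF assms(1)] homogeneous_scoeff[OF assms(2)] by (metis mdeg_add)
  then show "sum_list \<mu> = d + e" using \<mu>(1) by (simp add: mdeg_nth)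
qed

abbreviation elementary :: "nat \<Rightarrow> 'a::zero_neq_one symfun" where
  "elementary n \<equiv> monomial_sym (replicate n 1)"

lemma elementary_exponents:
  assumes "Poly_Mapping.keys m \<subseteq> {..<n}" "exponents m = mset (replicate n 1)"
  shows "m = Poly_Mapping.nth (replicate n 1)"
proof (rule poly_mapping_eqI)
  fix i
  have "card (Poly_Mapping.keys m) = n" using assms(2) by (metis size_exponents size_mset length_replicate)
  then have k: "Poly_Mapping.keys m = {..<n}"
    by (intro card_subset_eq assms(1)) auto
  have "Poly_Mapping.lookup m i = 1" if "i < n"
  proof -
    have "i \<in> Poly_Mapping.keys m" using k that by simp
    then have "Poly_Mapping.lookup m i \<in># exponents m" by (auto simp: exponents_def)
    then show ?thesis unfolding assms(2) by (auto split: if_splits)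
  qed
  moreover have "Poly_Mapping.lookup m i = 0" if "\<not> i < n"
    using k that by (metis in_keys_iff lessThan_iff)
  ultimately show "Poly_Mapping.lookup m i = Poly_Mapping.lookup (Poly_Mapping.nth (replicate n 1)) i"
    by (simp add: nth.rep_eq nth_default_def)
qed

lemma is_partition_replicate_1: "is_partition (replicate n 1)"
  by (auto simp: is_partition_def sorted_wrt_iff_nth_less)

lemma evl_elementary: "evl n x (elementary n) = (\<Prod>i<n. x i :: 'a::comm_ring_1)"
proof -
  let ?e = "Poly_Mapping.nth (replicate n (1 :: nat))"
  have e: "exponents ?e = mset (replicate n 1)"
    by (rule exponents_nth_partition[OF is_partition_replicate_1])
  have "{m. Poly_Mapping.keys m \<subseteq> {..<n} \<and> scoeff (elementary n :: 'a symfun) m \<noteq> 0} = {?e}"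
  proof (intro equalityI subsetI)
    fix m assume "m \<in> {m. Poly_Mapping.keys m \<subseteq> {..<n} \<and> scoeff (elementary n :: 'a symfun) m \<noteq> 0}"
    then show "m \<in> {?e}" using elementary_exponents[of m n] by (auto simp: monomial_sym.rep_eq split: if_splits)
  next
    fix m assume "m \<in> {?e}"
    then show "m \<in> {m. Poly_Mapping.keys m \<subseteq> {..<n} \<and> scoeff (elementary n :: 'a symfun) m \<noteq> 0}"
      using e by (auto simp: monomial_sym.rep_eq keys_nth_eq simp del: keys_nth)
  qed
  moreover have "scoeff (elementary n :: 'a symfun) ?e = 1" using e by (simp add: monomial_sym.rep_eq)
  ultimately show ?thesis
    by (simp add: evl_def mon_eval_def nth.rep_eq nth_default_def)
qed

context orthogonal_basis
begin

text \<open>Among the indices with nonzero coefficient the one with maximal key, \<kappa>, is the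
  only one whose P contains m_\<kappa>, and in n variables that coefficient is still
  visible.\<close>

lemma independent:
  assumes "finite L" "\<And>l. l \<in> L \<Longrightarrow> is_partition l \<and> length l \<le> n"
    and zero: "\<And>x. x \<in> generic_points n \<Longrightarrow> (\<Sum>l\<in>L. c l * evl n (point x) (P l)) = 0"
    and l: "l \<in> L"
  shows "c l = 0"
proof (rule ccontr)
  assume "c l \<noteq> 0"
  let ?B = "{l \<in> L. c l \<noteq> 0}"
  have "?B \<noteq> {}" "finite ?B" using l \<open>c l \<noteq> 0\<close> assms(1) by auto
  then have "Max (partition_key ` ?B) \<in> partition_key ` ?B" by (intro Max_in) auto
  then obtain \<kappa> where \<kappa>: "\<kappa> \<in> ?B" "partition_key \<kappa> = Max (partition_key ` ?B)" by auto
  have max: "partition_key \<mu> \<le> partition_key \<kappa>" if "\<mu> \<in> ?B" for \<mu>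
    using \<kappa>(2) that \<open>finite ?B\<close> by simp
  have \<kappa>p: "is_partition \<kappa>" "length \<kappa> \<le> n" using \<kappa>(1) assms(2) by auto
  let ?F = "\<Sum>l\<in>L. sscale (c l) (P l)"
  have "monomial_coeff ?F \<kappa> = 0"
    by (rule evl_zero_imp_monomial_coeff[OF _ \<kappa>p]) (use zero in \<open>simp add: point_def\<close>)
  moreover have "monomial_coeff ?F \<kappa> = (\<Sum>l\<in>{\<kappa>}. c l * monomial_coeff (P l) \<kappa>)"
    unfolding monomial_coeff_simps
  proof (rule sum.mono_neutral_right[OF assms(1)])
    show "{\<kappa>} \<subseteq> L" using \<kappa>(1) by auto
    show "\<forall>\<mu>\<in>L - {\<kappa>}. c \<mu> * monomial_coeff (P \<mu>) \<kappa> = 0"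
    proof
      fix \<mu> assume \<mu>: "\<mu> \<in> L - {\<kappa>}"
      show "c \<mu> * monomial_coeff (P \<mu>) \<kappa> = 0"
      proof (rule ccontr)
        assume nz: "c \<mu> * monomial_coeff (P \<mu>) \<kappa> \<noteq> 0"
        then have "partition_key \<mu> \<le> partition_key \<kappa>" using max[of \<mu>] \<mu> by simp
        moreover have "partition_key \<kappa> \<le> partition_key \<mu>"
          using coeff_nonzero(2)[of \<mu> \<kappa>] nz \<mu> assms(2) \<kappa>p by auto
        ultimately have "partition_key \<mu> = partition_key \<kappa>" by simp
        then show False using \<mu> by simp
      qed
    qed
  qed
  ultimately show False using \<kappa>(1) coeff_diag[OF \<kappa>p(1)] by simp
qed

lemma eigen':
  assumes "is_partition \<nu>" "x \<in> generic_points n"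
  shows "shift_sum qq tt n X (\<lambda>y. evl n y (P \<nu>)) (point x)
    = eigenvalue n X \<nu> * (vdm n (point x) * evl n (point x) (P \<nu>))"
proof (cases "length \<nu> \<le> n")
  case False
  then show ?thesis using assms(1) by (simp add: evl_zero shift_sum_def)
qed (use assms eigen in blast)

lemma shift_sum_expansion:
  assumes "F \<in> homogeneous d" "x \<in> generic_points n"
  shows "shift_sum qq tt n X (\<lambda>y. evl n y F) (point x) = (\<Sum>\<nu>\<in>partitions_of d.
    qt_inner F (P \<nu>) / qt_inner (P \<nu>) (P \<nu>) * (eigenvalue n X \<nu> * (vdm n (point x) * evl n (point x) (P \<nu>))))"
proof -
  have "(\<lambda>y. evl n y F) = (\<lambda>y. \<Sum>\<nu>\<in>partitions_of d. qt_inner F (P \<nu>) / qt_inner (P \<nu>) (P \<nu>) * evl n y (P \<nu>))"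
    by (subst expansion[OF assms(1)]) simp
  then have "shift_sum qq tt n X (\<lambda>y. evl n y F) (point x) = (\<Sum>\<nu>\<in>partitions_of d.
      qt_inner F (P \<nu>) / qt_inner (P \<nu>) (P \<nu>) * shift_sum qq tt n X (\<lambda>y. evl n y (P \<nu>)) (point x))"
    by (simp only: shift_sum_linear)
  also have "\<dots> = (\<Sum>\<nu>\<in>partitions_of d.
    qt_inner F (P \<nu>) / qt_inner (P \<nu>) (P \<nu>) * (eigenvalue n X \<nu> * (vdm n (point x) * evl n (point x) (P \<nu>))))"
    by (rule sum.cong[OF refl]) (simp add: eigen' assms(2) partitions_of_def)
  finally show ?thesis .
qed

lemma sum_restrict_length:
  "(\<Sum>\<nu>\<in>partitions_of d. c \<nu> * evl n x (P \<nu>)) = (\<Sum>\<nu> | \<nu> \<in> partitions_of d \<and> length \<nu> \<le> n. c \<nu> * evl n x (P \<nu>))"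
  by (rule sum.mono_neutral_right[OF finite_partitions_of])
    (auto simp: partitions_of_def, metis evl_zero not_le)

text \<open>The shift by q^I multiplies the product of the variables by q^|I|, so e_n turns D(X)
  into D(Xq). Therefore e_n P_\<nu> has the eigenvalues of \<nu> with a column prepended, and
  separation of eigenvalues makes it a multiple of that P. Leading coefficients show the multiple to
  be 1.\<close>

theorem multiply_column:
  assumes \<nu>: "is_partition \<nu>" "length \<nu> \<le> n" and x: "x \<in> generic_points n"
  shows "(\<Prod>i<n. point x i) * evl n (point x) (P \<nu>) = evl n (point x) (P (add_column n \<nu>))"
proof -
  define d where "d = n + sum_list \<nu>"
  define \<kappa> where "\<kappa> = add_column n \<nu>"
  define F where "F = elementary n * P \<nu>"
  define c where "c = (\<lambda>\<mu>. qt_inner F (P \<mu>) / qt_inner (P \<mu>) (P \<mu>))"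
  have \<kappa>p: "is_partition \<kappa>" "length \<kappa> \<le> n" "sum_list \<kappa> = d"
    using \<nu> by (simp_all add: \<kappa>_def d_def is_partition_add_column sum_list_add_column)
  have F: "F \<in> homogeneous d"
    unfolding F_def d_def
    using homogeneous_mult[OF monomial_sym_homogeneous[OF is_partition_replicate_1] homogeneous[OF \<nu>(1)], of n]
    by (simp add: sum_list_replicate)
  have finL: "finite {\<mu>. \<mu> \<in> partitions_of d \<and> length \<mu> \<le> n}" by simp
  have evF: "evl n y F = (\<Prod>i<n. y i) * evl n y (P \<nu>)" for y
    by (simp only: F_def evl_mult evl_elementary)
  have F_exp: "evl n y F = (\<Sum>\<mu> | \<mu> \<in> partitions_of d \<and> length \<mu> \<le> n. c \<mu> * evl n y (P \<mu>))" for y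
  proof -
    have "evl n y F = (\<Sum>\<mu>\<in>partitions_of d. c \<mu> * evl n y (P \<mu>))"
      by (subst expansion[OF F]) (simp add: c_def)
    then show ?thesis by (simp only: sum_restrict_length)
  qed
  have c0: "c \<mu> * (eigenvalue n X \<mu> - eigenvalue n X \<kappa>) = 0"
    if \<mu>: "\<mu> \<in> partitions_of d" "length \<mu> \<le> n" for \<mu> X
  proof (rule independent[where L = "{\<mu>. \<mu> \<in> partitions_of d \<and> length \<mu> \<le> n}" and n = n and l = \<mu>
        and c = "\<lambda>\<mu>. c \<mu> * (eigenvalue n X \<mu> - eigenvalue n X \<kappa>)"])
    fix y assume y: "y \<in> generic_points n"
    have V: "vdm n (point y) \<noteq> 0" by (rule vdm_nonzero) (use point_generic[OF y] in auto)
    have pr: "(\<Prod>i<n. shift qq I (point y) i) = qq ^ card I * (\<Prod>i<n. point y i)" if "I \<in> Pow {..<n}" for I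
    proof -
      have "(\<Prod>i<n. shift qq I (point y) i) = (\<Prod>i<n. (if i \<in> I then qq else 1) * point y i)"
        by (rule prod.cong) (auto simp: shift_def)
      also have "\<dots> = qq ^ card I * (\<Prod>i<n. point y i)"
        using that by (simp add: prod.distrib prod.If_cases Int_absorb1)
      finally show ?thesis .
    qed
    have "shift_sum qq tt n X (\<lambda>y. evl n y F) (point y)
        = (\<Prod>i<n. point y i) * shift_sum qq tt n (X * qq) (\<lambda>y. evl n y (P \<nu>)) (point y)"
      unfolding shift_sum_def sum_distrib_left
      by (rule sum.cong) (simp_all add: evF pr power_mult_distrib mult_ac)
    also have "\<dots> = eigenvalue n X \<kappa> * (vdm n (point y) * evl n (point y) F)"
      by (simp add: eigen' \<nu> y eigenvalue_add_column \<kappa>_def evF)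
    finally have "shift_sum qq tt n X (\<lambda>y. evl n y F) (point y)
        = eigenvalue n X \<kappa> * (vdm n (point y) * evl n (point y) F)" .
    moreover have "shift_sum qq tt n X (\<lambda>y. evl n y F) (point y)
        = vdm n (point y) * (\<Sum>\<mu>\<in>partitions_of d. (c \<mu> * eigenvalue n X \<mu>) * evl n (point y) (P \<mu>))"
      unfolding shift_sum_expansion[OF F y] c_def sum_distrib_left
      by (rule sum.cong) simp_all
    ultimately have "vdm n (point y) * (\<Sum>\<mu> | \<mu> \<in> partitions_of d \<and> length \<mu> \<le> n. (c \<mu> * eigenvalue n X \<mu>) * evl n (point y) (P \<mu>))
        = vdm n (point y) * (eigenvalue n X \<kappa> * evl n (point y) F)"
      unfolding sum_restrict_length[of "\<lambda>\<mu>. c \<mu> * eigenvalue n X \<mu>" n "point y" d, symmetric]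
      by (simp add: mult_ac)
    then have "(\<Sum>\<mu> | \<mu> \<in> partitions_of d \<and> length \<mu> \<le> n. (c \<mu> * eigenvalue n X \<mu>) * evl n (point y) (P \<mu>))
        = eigenvalue n X \<kappa> * evl n (point y) F"
      using V by simp
    then show "(\<Sum>\<mu> | \<mu> \<in> partitions_of d \<and> length \<mu> \<le> n. c \<mu> * (eigenvalue n X \<mu> - eigenvalue n X \<kappa>) * evl n (point y) (P \<mu>)) = 0"
      unfolding F_exp by (simp add: sum_distrib_left algebra_simps sum_subtractf)
  qed (use \<mu> finL in \<open>auto simp: partitions_of_def\<close>)
  have c_zero: "c \<mu> = 0" if \<mu>: "\<mu> \<in> partitions_of d" "length \<mu> \<le> n" "\<mu> \<noteq> \<kappa>" for \<mu>
  proof (rule ccontr)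
    assume "c \<mu> \<noteq> 0"
    then have "eigenvalue n X \<mu> = eigenvalue n X \<kappa>" for X using c0[OF \<mu>(1,2), of X] by simp
    then have "\<mu> = \<kappa>"
      by (intro eigenvalue_inj[of \<mu> n \<kappa>]) (use \<mu> \<kappa>p in \<open>auto simp: partitions_of_def\<close>)
    then show False using \<mu>(3) by simp
  qed
  have evF\<kappa>: "evl n y F = c \<kappa> * evl n y (P \<kappa>)" for y
  proof -
    have "evl n y F = (\<Sum>\<mu>\<in>{\<kappa>}. c \<mu> * evl n y (P \<mu>))"
      unfolding F_exp
      by (rule sum.mono_neutral_right[OF finL]) (use \<kappa>p c_zero in \<open>auto simp: partitions_of_def\<close>)
    then show ?thesis by simp
  qed
  have "monomial_coeff (F - sscale (c \<kappa>) (P \<kappa>)) \<kappa> = 0"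
    by (rule evl_zero_imp_monomial_coeff[OF _ \<kappa>p(1,2)]) (simp add: evF\<kappa>)
  then have "monomial_coeff F \<kappa> = c \<kappa>" using coeff_diag[OF \<kappa>p(1)] by simp
  \<comment> \<open>In n variables e_n has a single monomial, so the leading monomial splits in only
    one way.\<close>
  moreover have "monomial_coeff F \<kappa> = 1"
  proof -
    let ?e = "Poly_Mapping.nth (replicate n (1 :: nat))"
    have ek: "Poly_Mapping.nth \<kappa> = ?e + Poly_Mapping.nth \<nu>"
      by (rule poly_mapping_eqI)
        (use \<nu>(2) in \<open>auto simp: lookup_add nth.rep_eq nth_default_def \<kappa>_def add_column_def nth_part_def\<close>)
    have e1: "scoeff (elementary n :: qt symfun) ?e = 1"
      using exponents_nth_partition[OF is_partition_replicate_1, of n] by (simp add: monomial_sym.rep_eq)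
    have "monomial_coeff F \<kappa> = (\<Sum>(a, b)\<in>splits (Poly_Mapping.nth \<kappa>). scoeff (elementary n) a * scoeff (P \<nu>) b)"
      by (simp add: monomial_coeff_def F_def times_symfun.rep_eq)
    also have "\<dots> = (\<Sum>(a, b)\<in>{(?e, Poly_Mapping.nth \<nu>)}. scoeff (elementary n) a * scoeff (P \<nu>) b)"
    proof (rule sum.mono_neutral_right)
      show "{(?e, Poly_Mapping.nth \<nu>)} \<subseteq> splits (Poly_Mapping.nth \<kappa>)" by (simp add: splits_def ek)
      show "\<forall>y\<in>splits (Poly_Mapping.nth \<kappa>) - {(?e, Poly_Mapping.nth \<nu>)}.
          (case y of (a, b) \<Rightarrow> scoeff (elementary n) a * scoeff (P \<nu>) b) = 0"
      proof
        fix y assume y: "y \<in> splits (Poly_Mapping.nth \<kappa>) - {(?e, Poly_Mapping.nth \<nu>)}"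
        obtain a b where ab: "y = (a, b)" by (cases y)
        have s: "a + b = Poly_Mapping.nth \<kappa>" using y ab by (simp add: splits_def)
        have "Poly_Mapping.keys a \<subseteq> Poly_Mapping.keys (Poly_Mapping.nth \<kappa>)"
          unfolding s[symmetric] keys_add_mon by auto
        also have "\<dots> \<subseteq> {..<n}" using \<kappa>p(2) by (auto simp: keys_nth_eq simp del: keys_nth)
        finally have k: "Poly_Mapping.keys a \<subseteq> {..<n}" .
        have "scoeff (elementary n :: qt symfun) a = 0"
        proof (rule ccontr)
          assume "scoeff (elementary n :: qt symfun) a \<noteq> 0"
          then have "a = ?e" using elementary_exponents[OF k] by (auto simp: monomial_sym.rep_eq split: if_splits)
          then have "b = Poly_Mapping.nth \<nu>" using s unfolding ek by simp
          then show False using y ab \<open>a = ?e\<close> by simp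
        qed
        then show "(case y of (a, b) \<Rightarrow> scoeff (elementary n) a * scoeff (P \<nu>) b) = 0" by (simp add: ab)
      qed
    qed simp
    also have "\<dots> = 1" using e1 coeff_diag[OF \<nu>(1)] by (simp add: monomial_coeff_def)
    finally show ?thesis .
  qed
  ultimately have "evl n (point x) F = evl n (point x) (P \<kappa>)" unfolding evF\<kappa> by simp
  then show ?thesis by (simp add: evF \<kappa>_def)
qed

text \<open>Expand both sides of \<open>kernel_shift_sum_raising\<close> in products P_\<mu>(x)
  P_\<mu>(z). For X = -1 only partitions of length exactly n survive; on the other side the factors
  e_n(x) e_n(z) prepend a column. Then compare coefficients.\<close>

theorem norm_add_column:
  assumes \<nu>: "is_partition \<nu>" "length \<nu> \<le> n"
  shows "eigenvalue n (- tt) \<nu> * qt_inner (P (add_column n \<nu>)) (P (add_column n \<nu>))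
    = eigenvalue n (- 1) (add_column n \<nu>) * qt_inner (P \<nu>) (P \<nu>)"
proof -
  define d where "d = sum_list \<nu>"
  let ?L = "{\<mu>. \<mu> \<in> partitions_of d \<and> length \<mu> \<le> n}"
  let ?M = "{\<mu>. \<mu> \<in> partitions_of (d + n) \<and> length \<mu> = n}"
  let ?N = "\<lambda>\<mu>. qt_inner (P \<mu>) (P \<mu>)"
  let ?a = "add_column n"
  have finM: "finite ?M" by simp
  define D where "D = (\<lambda>\<mu>. eigenvalue n (- 1) (?a \<mu>) / ?N (?a \<mu>) - eigenvalue n (- tt) \<mu> / ?N \<mu>)"
  have kern: "macdonald_kernel qq tt n e (point x) = (\<lambda>z. \<Sum>\<mu>\<in>partitions_of e. evl n (point x) (P \<mu>) / ?N \<mu> * evl n z (P \<mu>))" for e x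
    by (simp add: macdonald_kernel_expansion fun_eq_iff)
  have main: "(\<Sum>\<mu>\<in>?L. D \<mu> * evl n (point x) (P (?a \<mu>)) * evl n (point z) (P (?a \<mu>))) = 0"
    if x: "x \<in> generic_points n" and z: "z \<in> generic_points n" for x z
  proof -
    let ?e = "\<lambda>x. (\<Prod>i<n. point x i)"
    have V: "vdm n (point z) \<noteq> 0" by (rule vdm_nonzero) (use point_generic[OF z] in auto)
    have SS: "shift_sum qq tt n X (macdonald_kernel qq tt n e (point x)) (point z)
        = vdm n (point z) * (\<Sum>\<mu>\<in>partitions_of e. evl n (point x) (P \<mu>) / ?N \<mu> * eigenvalue n X \<mu> * evl n (point z) (P \<mu>))" for X e
      unfolding kern shift_sum_linear sum_distrib_left
      by (rule sum.cong) (simp_all add: eigen' z partitions_of_def)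
    have "shift_sum qq tt n (- 1) (macdonald_kernel qq tt n (d + n) (point x)) (point z)
        = ?e x * ?e z * shift_sum qq tt n (- tt) (macdonald_kernel qq tt n d (point x)) (point z)"
      by (rule kernel_shift_sum_raising[OF qq_power_ne_1 point_generic[OF x]])
    then have "(\<Sum>\<mu>\<in>partitions_of (d + n). evl n (point x) (P \<mu>) / ?N \<mu> * eigenvalue n (- 1) \<mu> * evl n (point z) (P \<mu>))
        = ?e x * ?e z * (\<Sum>\<mu>\<in>partitions_of d. evl n (point x) (P \<mu>) / ?N \<mu> * eigenvalue n (- tt) \<mu> * evl n (point z) (P \<mu>))"
      unfolding SS using V by simp
    also have "(\<Sum>\<mu>\<in>partitions_of (d + n). evl n (point x) (P \<mu>) / ?N \<mu> * eigenvalue n (- 1) \<mu> * evl n (point z) (P \<mu>))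
        = (\<Sum>\<mu>\<in>?M. evl n (point x) (P \<mu>) / ?N \<mu> * eigenvalue n (- 1) \<mu> * evl n (point z) (P \<mu>))"
    proof (rule sum.mono_neutral_right[OF finite_partitions_of])
      show "\<forall>\<mu>\<in>partitions_of (d + n) - ?M. evl n (point x) (P \<mu>) / ?N \<mu> * eigenvalue n (- 1) \<mu> * evl n (point z) (P \<mu>) = 0"
      proof
        fix \<mu> assume "\<mu> \<in> partitions_of (d + n) - ?M"
        then have "is_partition \<mu>" "length \<mu> < n \<or> n < length \<mu>" by (auto simp: partitions_of_def)
        then show "evl n (point x) (P \<mu>) / ?N \<mu> * eigenvalue n (- 1) \<mu> * evl n (point z) (P \<mu>) = 0"
          using eigenvalue_minus_one[of \<mu> n] evl_zero[of \<mu> n] by auto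
      qed
    qed auto
    also have "\<dots> = (\<Sum>\<mu>\<in>?L. evl n (point x) (P (?a \<mu>)) / ?N (?a \<mu>) * eigenvalue n (- 1) (?a \<mu>) * evl n (point z) (P (?a \<mu>)))"
      by (rule sum.reindex_bij_betw[OF add_column_bij, symmetric])
    also have "?e x * ?e z * (\<Sum>\<mu>\<in>partitions_of d. evl n (point x) (P \<mu>) / ?N \<mu> * eigenvalue n (- tt) \<mu> * evl n (point z) (P \<mu>))
        = (\<Sum>\<mu>\<in>?L. (?e x * evl n (point x) (P \<mu>)) / ?N \<mu> * eigenvalue n (- tt) \<mu> * (?e z * evl n (point z) (P \<mu>)))"
      unfolding sum_restrict_length sum_distrib_left by (rule sum.cong) (simp_all add: mult_ac)
    also have "\<dots> = (\<Sum>\<mu>\<in>?L. evl n (point x) (P (?a \<mu>)) / ?N \<mu> * eigenvalue n (- tt) \<mu> * evl n (point z) (P (?a \<mu>)))"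
      by (rule sum.cong) (auto simp: multiply_column x z partitions_of_def)
    finally show ?thesis
      unfolding D_def by (simp add: algebra_simps sum_subtractf)
  qed
  have L: "\<mu> \<in> ?L \<Longrightarrow> is_partition (?a \<mu>) \<and> length (?a \<mu>) \<le> n" for \<mu>
    by (simp add: partitions_of_def is_partition_add_column)
  have inj: "inj_on ?a ?L" using add_column_bij[of n d] by (auto simp: bij_betw_def)
  have re: "(\<Sum>l\<in>?a ` ?L. D (remove_column l) * evl n y (P l) * evl n z (P l))
      = (\<Sum>\<mu>\<in>?L. D \<mu> * evl n y (P (?a \<mu>)) * evl n z (P (?a \<mu>)))" for y z
    unfolding sum.reindex[OF inj] comp_def
    by (rule sum.cong) (auto simp: remove_add_column partitions_of_def)
  \<comment> \<open>Coefficients are compared in z with x fixed, and only afterwards in x.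
    \<open>remove_column\<close> recovers the index of D from that of P.\<close>
  have x0: "D \<nu> * evl n (point x) (P (?a \<nu>)) = 0" if x: "x \<in> generic_points n" for x
  proof -
    have "D (remove_column (?a \<nu>)) * evl n (point x) (P (?a \<nu>)) = 0"
    proof (rule independent[where L = "?a ` ?L" and n = n and l = "?a \<nu>"
          and c = "\<lambda>l. D (remove_column l) * evl n (point x) (P l)"])
      show "finite (?a ` ?L)" by simp
      show "is_partition l \<and> length l \<le> n" if "l \<in> ?a ` ?L" for l using that L by blast
      show "(\<Sum>l\<in>?a ` ?L. D (remove_column l) * evl n (point x) (P l) * evl n (point z) (P l)) = 0"
        if "z \<in> generic_points n" for z
        unfolding re by (rule main[OF x that])
      show "?a \<nu> \<in> ?a ` ?L" using \<nu> by (simp add: d_def partitions_of_def)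
    qed
    then show ?thesis by (simp add: remove_add_column \<nu>)
  qed
  have "D \<nu> = 0"
    by (rule independent[of "{?a \<nu>}" n "\<lambda>_. D \<nu>" "?a \<nu>"])
      (use x0 \<nu> in \<open>auto simp: is_partition_add_column\<close>)
  then have "eigenvalue n (- 1) (?a \<nu>) / ?N (?a \<nu>) = eigenvalue n (- tt) \<nu> / ?N \<nu>" by (simp add: D_def)
  moreover have "?N (?a \<nu>) \<noteq> 0" "?N \<nu> \<noteq> 0"
    using norm_pos[OF is_partition_add_column[OF \<nu>(1)], of n] norm_pos[OF \<nu>(1)] by auto
  ultimately show ?thesis by (simp add: field_simps)
qed

end


section \<open>The integral form\<close>

lemma col_length_eq: "length \<nu> \<le> n \<Longrightarrow> col_length \<nu> j = card {i. i < n \<and> j < nth_part \<nu> i}"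
  unfolding col_length_def by (rule arg_cong[where f = card]) (auto simp: nth_part_def split: if_splits)

lemma col_length_add_column:
  assumes "length \<nu> \<le> n"
  shows "col_length (add_column n \<nu>) 0 = n" "col_length (add_column n \<nu>) (Suc j) = col_length \<nu> j"
  using assms
  by (simp_all add: col_length_eq[of "add_column n \<nu>" n] col_length_eq[of \<nu> n] nth_part_add_column
      cong: conj_cong)

lemma finite_cells: "finite (cells \<nu>)"
proof -
  have "cells \<nu> = (SIGMA i:{..<length \<nu>}. {..<\<nu> ! i})" by (auto simp: cells_def)
  then show ?thesis by simp
qed

text \<open>In the new first column, cell i has arm \<nu>_i and leg n - i - 1, which gives the
  factors of the eigenvalue. The old cells move one step to the right and keep arm and leg.\<close>

lemma hook_poly_add_column:
  assumes "is_partition \<nu>" "length \<nu> \<le> n"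
  shows "hook_poly (add_column n \<nu>) = hook_poly \<nu> * eigenvalue n (- tt) \<nu>"
proof -
  let ?\<kappa> = "add_column n \<nu>"
  let ?w = "\<lambda>\<nu> s. 1 - qq ^ arm_length \<nu> s * tt ^ (leg_length \<nu> s + 1)"
  let ?A = "(\<lambda>i. (i, 0)) ` {..<n}" and ?B = "(\<lambda>(i, j). (i, Suc j)) ` cells \<nu>"
  have cells: "cells ?\<kappa> = ?A \<union> ?B"
  proof (intro equalityI subsetI)
    fix s assume s: "s \<in> cells ?\<kappa>"
    obtain i j where ij: "s = (i, j)" by (cases s)
    have *: "i < n" "j < nth_part \<nu> i + 1" using s by (auto simp: ij cells_def add_column_def)
    show "s \<in> ?A \<union> ?B"
    proof (cases j)
      case (Suc k)
      then have "k < nth_part \<nu> i" using * by simp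
      then have "(i, k) \<in> cells \<nu>" by (auto simp: cells_def nth_part_def split: if_splits)
      then show ?thesis by (force simp: ij Suc)
    qed (use * in \<open>simp add: ij\<close>)
  next
    fix s assume "s \<in> ?A \<union> ?B"
    then show "s \<in> cells ?\<kappa>"
      using assms(2) by (auto simp: cells_def add_column_def nth_part_def)
  qed
  have "hook_poly ?\<kappa> = prod (?w ?\<kappa>) ?A * prod (?w ?\<kappa>) ?B"
    unfolding hook_poly_def cells by (rule prod.union_disjoint) (auto simp: finite_cells)
  also have "prod (?w ?\<kappa>) ?A = (\<Prod>i<n. 1 - qq ^ nth_part \<nu> i * tt ^ (n - i - 1 + 1))"
    by (subst prod.reindex)
      (auto simp: inj_on_def arm_length_def leg_length_def nth_part_add_column col_length_add_column[OF assms(2)])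
  also have "\<dots> = eigenvalue n (- tt) \<nu>"
    unfolding eigenvalue_def by (rule prod.cong) (simp_all add: mult_ac Suc_diff_Suc flip: power_Suc)
  also have "prod (?w ?\<kappa>) ?B = (\<Prod>s\<in>cells \<nu>. ?w ?\<kappa> ((\<lambda>(i, j). (i, Suc j)) s))"
    by (subst prod.reindex) (auto simp: inj_on_def)
  also have "\<dots> = hook_poly \<nu>"
    unfolding hook_poly_def
  proof (rule prod.cong[OF refl])
    fix s assume "s \<in> cells \<nu>"
    then obtain i j where s: "s = (i, j)" "i < n" "i < length \<nu>" "j < \<nu> ! i"
      using assms(2) by (auto simp: cells_def)
    then show "?w ?\<kappa> ((\<lambda>(i, j). (i, Suc j)) s) = ?w \<nu> s"
      by (simp add: arm_length_def leg_length_def nth_part_add_column col_length_add_column[OF assms(2)])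
  qed
  finally show ?thesis by (simp add: mult.commute)
qed

lemma hook_poly_nonzero: "hook_poly \<nu> \<noteq> 0"
proof -
  have "1 - qq ^ a * tt ^ (l + 1) \<noteq> 0" for a l
    using one_minus_tt_qq_nonzero[of "l + 1" a] by (simp add: mult.commute)
  then show ?thesis unfolding hook_poly_def prod_zero_iff[OF finite_cells] by blast
qed

text \<open>The constant \<open>\<kappa>\<^sub>\<nu> = \<langle>J\<^sub>\<nu>, P\<^sub>\<nu>\<rangle>\<close>.\<close>

definition integral_norm :: "nat list \<Rightarrow> qt" where
  "integral_norm \<nu> = hook_poly \<nu> * qt_inner (macdonald_P \<nu>) (macdonald_P \<nu>)"

lemma integral_norm_nonzero: "is_partition \<nu> \<Longrightarrow> integral_norm \<nu> \<noteq> 0"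
  using mac.norm_pos[of \<nu>] hook_poly_nonzero[of \<nu>] by (simp add: integral_norm_def)

text \<open>The eigenvalue at X = -t gained by the hook polynomial is the one in the denominator of
  the norm ratio, so only the eigenvalue at X = -1 remains.\<close>

lemma integral_norm_add_column:
  assumes "is_partition \<nu>" "length \<nu> \<le> n"
  shows "integral_norm (add_column n \<nu>) = integral_norm \<nu> * eigenvalue n (- 1) (add_column n \<nu>)"
  using mac.norm_add_column[OF assms]
  by (simp add: integral_norm_def hook_poly_add_column[OF assms] mult.assoc)


section \<open>Specialization at q = 0\<close>

text \<open>No pole at q = 0. These elements form the local ring on which \<open>at_q0\<close> is a
  ring homomorphism.\<close>

definition regular :: "qt \<Rightarrow> bool" where
  "regular c \<longleftrightarrow> (\<exists>a b. poly b 0 \<noteq> 0 \<and> c = Fract a b)"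

lemma regularE:
  assumes "regular c"
  obtains a b where "poly b 0 \<noteq> 0" "b \<noteq> 0" "c = Fract a b" "at_q0 c = Fract [:poly a 0:] [:poly b 0:]"
proof -
  obtain a b where *: "poly b 0 \<noteq> 0" "c = Fract a b" using assms by (auto simp: regular_def)
  then show thesis by (intro that[of b a]) (auto simp: at_q0_Fract)
qed

lemma regular_Fract: "poly b 0 \<noteq> 0 \<Longrightarrow> regular (Fract a b)"
  by (auto simp: regular_def)

lemma regular_to_fract [simp]: "regular (to_fract p)"
  and at_q0_to_fract: "at_q0 (to_fract p) = to_fract [:poly p 0:]"
  using regular_Fract[of 1 p] at_q0_Fract[of 1 p]
  by (simp_all add: to_fract_def one_pCons)

lemma regular_add [simp]: "regular c \<Longrightarrow> regular d \<Longrightarrow> regular (c + d)"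
  and at_q0_add: "regular c \<Longrightarrow> regular d \<Longrightarrow> at_q0 (c + d) = at_q0 c + at_q0 d"
proof -
  assume "regular c" "regular d"
  obtain a b where c: "poly b 0 \<noteq> 0" "b \<noteq> 0" "c = Fract a b" "at_q0 c = Fract [:poly a 0:] [:poly b 0:]"
    using regularE[OF \<open>regular c\<close>] by blast
  obtain e f where d: "poly f 0 \<noteq> 0" "f \<noteq> 0" "d = Fract e f" "at_q0 d = Fract [:poly e 0:] [:poly f 0:]"
    using regularE[OF \<open>regular d\<close>] by blast
  have s: "c + d = Fract (a * f + e * b) (b * f)" using c d by simp
  have p: "poly (b * f) 0 \<noteq> 0" using c d by simp
  show "regular (c + d)" unfolding s by (rule regular_Fract[OF p])
  show "at_q0 (c + d) = at_q0 c + at_q0 d"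
    unfolding s at_q0_Fract[OF p] using c d by (simp add: mult_ac)
qed

lemma regular_mult [simp]: "regular c \<Longrightarrow> regular d \<Longrightarrow> regular (c * d)"
  and at_q0_mult: "regular c \<Longrightarrow> regular d \<Longrightarrow> at_q0 (c * d) = at_q0 c * at_q0 d"
proof -
  assume "regular c" "regular d"
  obtain a b where c: "poly b 0 \<noteq> 0" "b \<noteq> 0" "c = Fract a b" "at_q0 c = Fract [:poly a 0:] [:poly b 0:]"
    using regularE[OF \<open>regular c\<close>] by blast
  obtain e f where d: "poly f 0 \<noteq> 0" "f \<noteq> 0" "d = Fract e f" "at_q0 d = Fract [:poly e 0:] [:poly f 0:]"
    using regularE[OF \<open>regular d\<close>] by blast
  have s: "c * d = Fract (a * e) (b * f)" using c d by simp
  have p: "poly (b * f) 0 \<noteq> 0" using c d by simp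
  show "regular (c * d)" unfolding s by (rule regular_Fract[OF p])
  show "at_q0 (c * d) = at_q0 c * at_q0 d"
    unfolding s at_q0_Fract[OF p] using c d by (simp add: mult_ac)
qed

lemma regular_inverse:
  assumes "regular c" "at_q0 c \<noteq> 0"
  shows "regular (inverse c)" "at_q0 (inverse c) = inverse (at_q0 c)"
proof -
  obtain a b where c: "poly b 0 \<noteq> 0" "b \<noteq> 0" "c = Fract a b" "at_q0 c = Fract [:poly a 0:] [:poly b 0:]"
    using regularE[OF assms(1)] by blast
  have a: "poly a 0 \<noteq> 0" using assms(2) c by (auto simp: fract_collapse)
  have i: "inverse c = Fract b a" using c by simp
  show "regular (inverse c)" unfolding i by (rule regular_Fract[OF a])
  show "at_q0 (inverse c) = inverse (at_q0 c)"
    unfolding i at_q0_Fract[OF a] using c by simp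
qed

lemma regular_0 [simp]: "regular 0" and regular_1 [simp]: "regular 1" and at_q0_1 [simp]: "at_q0 1 = 1"
  using regular_to_fract[of 0] regular_to_fract[of 1] at_q0_to_fract[of 1] by (simp_all add: one_pCons[symmetric])

lemma regular_minus [simp]: "regular c \<Longrightarrow> regular (- c)"
  and at_q0_minus: "regular c \<Longrightarrow> at_q0 (- c) = - at_q0 c"
proof -
  have mone: "[:- 1 :: rat poly:] = - 1" by (simp add: one_pCons)
  have m: "regular (- 1)" "at_q0 (- 1) = - 1"
    using regular_to_fract[of "- 1"] at_q0_to_fract[of "- 1"] mone by simp_all
  assume c: "regular c"
  show "regular (- c)" using regular_mult[OF m(1) c] by simp
  show "at_q0 (- c) = - at_q0 c" using at_q0_mult[OF m(1) c] m(2) by simp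
qed

lemma regular_diff [simp]: "regular c \<Longrightarrow> regular d \<Longrightarrow> regular (c - d)"
  and at_q0_diff: "regular c \<Longrightarrow> regular d \<Longrightarrow> at_q0 (c - d) = at_q0 c - at_q0 d"
  using regular_add[of c "- d"] at_q0_add[of c "- d"] by (simp_all add: at_q0_minus)

lemma regular_of_nat [simp]: "regular (of_nat n)" and at_q0_of_nat [simp]: "at_q0 (of_nat n) = of_nat n"
proof -
  have "regular (of_nat n) \<and> at_q0 (of_nat n) = of_nat n"
    by (induction n) (simp_all add: at_q0_add)
  then show "regular (of_nat n)" "at_q0 (of_nat n) = of_nat n" by auto
qed

lemma regular_of_int [simp]: "regular (of_int n)" and at_q0_of_int [simp]: "at_q0 (of_int n) = of_int n"
  by (cases n; simp add: at_q0_minus at_q0_diff)+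

lemma regular_power [simp]: "regular c \<Longrightarrow> regular (c ^ n)"
  and at_q0_power: "regular c \<Longrightarrow> at_q0 (c ^ n) = at_q0 c ^ n"
proof -
  assume c: "regular c"
  then have "regular (c ^ n) \<and> at_q0 (c ^ n) = at_q0 c ^ n"
    by (induction n) (simp_all add: at_q0_mult)
  then show "regular (c ^ n)" "at_q0 (c ^ n) = at_q0 c ^ n" by auto
qed

lemma regular_sum [simp]: "(\<And>i. i \<in> A \<Longrightarrow> regular (f i)) \<Longrightarrow> regular (sum f A)"
  and at_q0_sum: "(\<And>i. i \<in> A \<Longrightarrow> regular (f i)) \<Longrightarrow> at_q0 (sum f A) = (\<Sum>i\<in>A. at_q0 (f i))"
proof -
  assume "\<And>i. i \<in> A \<Longrightarrow> regular (f i)"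
  then have "regular (sum f A) \<and> at_q0 (sum f A) = (\<Sum>i\<in>A. at_q0 (f i))"
    by (induction A rule: infinite_finite_induct) (simp_all add: at_q0_add)
  then show "regular (sum f A)" "at_q0 (sum f A) = (\<Sum>i\<in>A. at_q0 (f i))" by auto
qed

lemma regular_prod [simp]: "(\<And>i. i \<in> A \<Longrightarrow> regular (f i)) \<Longrightarrow> regular (prod f A)"
  and at_q0_prod: "(\<And>i. i \<in> A \<Longrightarrow> regular (f i)) \<Longrightarrow> at_q0 (prod f A) = (\<Prod>i\<in>A. at_q0 (f i))"
proof -
  assume "\<And>i. i \<in> A \<Longrightarrow> regular (f i)"
  then have "regular (prod f A) \<and> at_q0 (prod f A) = (\<Prod>i\<in>A. at_q0 (f i))"
    by (induction A rule: infinite_finite_induct) (simp_all add: at_q0_mult)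
  then show "regular (prod f A)" "at_q0 (prod f A) = (\<Prod>i\<in>A. at_q0 (f i))" by auto
qed

lemma regular_tt [simp]: "regular tt" and at_q0_tt [simp]: "at_q0 tt = tt"
  and regular_qq [simp]: "regular qq" and at_q0_qq [simp]: "at_q0 qq = 0"
  by (simp_all add: tt_def qq_def at_q0_to_fract)

lemma clear_denominators:
  fixes c :: "'i \<Rightarrow> qt"
  assumes "finite A"
  shows "\<exists>d. d \<noteq> 0 \<and> (\<forall>a\<in>A. \<exists>g. to_fract d * c a = to_fract g)"
  using assms
proof (induction A rule: finite_induct)
  case (insert x A)
  then obtain d where d: "d \<noteq> 0" "\<forall>a\<in>A. \<exists>g. to_fract d * c a = to_fract g" by blast
  obtain e f where ef: "c x = Fract e f" "f \<noteq> 0" by (cases "c x") auto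
  have "\<exists>g. to_fract (d * f) * c a = to_fract g" if a: "a \<in> insert x A" for a
  proof (cases "a = x")
    case True
    have "to_fract (d * f) * c a = to_fract (d * e)"
      using ef True by (simp add: Fract_conv_to_fract)
    then show ?thesis by blast
  next
    case False
    then obtain g where "to_fract d * c a = to_fract g" using a d by blast
    then have "to_fract (d * f) * c a = to_fract (f * g)" by (simp add: mult_ac)
    then show ?thesis by blast
  qed
  then show ?case using d ef by (intro exI[of _ "d * f"]) auto
qed (auto intro: exI[of _ 1])

text \<open>Take a common denominator of minimal degree in q. If it does not vanish at q = 0, all
  values are regular. If it does, some numerator does not, for otherwise a factor q could be
  cancelled throughout; the denominator then serves as B.\<close>

lemma regular_or_rescale:
  fixes c :: "'i \<Rightarrow> qt"
  assumes "finite A"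
  obtains "\<And>a. a \<in> A \<Longrightarrow> regular (c a)"
  | B where "regular B" "at_q0 B = 0" "\<And>a. a \<in> A \<Longrightarrow> regular (B * c a)" "\<exists>a\<in>A. at_q0 (B * c a) \<noteq> 0"
proof -
  let ?Q = "\<lambda>d. d \<noteq> 0 \<and> (\<forall>a\<in>A. \<exists>g. to_fract d * c a = to_fract g)"
  obtain d0 where "?Q d0" using clear_denominators[OF assms] by blast
  then obtain d where d: "?Q d" "\<And>e. ?Q e \<Longrightarrow> degree d \<le> degree e"
    using ex_has_least_nat[of ?Q d0 degree] by blast
  from d(1) obtain g where g: "\<And>a. a \<in> A \<Longrightarrow> to_fract d * c a = to_fract (g a)" by metis
  have dvd: "\<exists>k. p = [:0, 1:] * k" if "poly p 0 = 0" for p :: "rat poly poly"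
    using that by (cases p) auto
  show thesis
  proof (cases "poly d 0 = 0")
    case False
    have "regular (c a)" if "a \<in> A" for a
    proof -
      have "c a = Fract (g a) d"
        using g[OF that] d(1) by (simp add: Fract_conv_to_fract field_simps)
      then show ?thesis using regular_Fract[OF False] by simp
    qed
    then show ?thesis by (rule that(1))
  next
    case True
    have "\<exists>a\<in>A. poly (g a) 0 \<noteq> 0"
    proof (rule ccontr)
      assume "\<not> (\<exists>a\<in>A. poly (g a) 0 \<noteq> 0)"
      then have gz: "\<exists>k. g a = [:0, 1:] * k" if "a \<in> A" for a using that dvd by blast
      obtain e where e: "d = [:0, 1:] * e" using dvd[OF True] by blast
      have e0: "e \<noteq> 0" using d(1) e by auto
      have "\<exists>k. to_fract e * c a = to_fract k" if a: "a \<in> A" for a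
      proof -
        obtain k where k: "g a = [:0, 1:] * k" using gz[OF a] by blast
        have "qq * (to_fract e * c a) = qq * to_fract k"
          using g[OF a] unfolding e k by (simp only: to_fract_mult mult.assoc qq_def)
        then show ?thesis by auto
      qed
      then have "degree d \<le> degree e" using d(2) e0 by blast
      then show False using e e0 by (simp add: degree_mult_eq)
    qed
    then show ?thesis
      by (intro that(2)[of "to_fract d"]) (use g True in \<open>auto simp: at_q0_to_fract\<close>)
  qed
qed


section \<open>Specialization of evaluations\<close>

definition specialize :: "qt symfun \<Rightarrow> qt symfun" where
  "specialize = map_coeffs at_q0"

lemma scoeff_specialize [simp]: "scoeff (specialize F) m = at_q0 (scoeff F m)"
  by (simp add: specialize_def scoeff_map_coeffs)

lemma regular_evl:
  assumes "\<And>m. regular (scoeff F m)" "\<And>i. regular (y i)"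
  shows "regular (evl n y F)" "at_q0 (evl n y F) = evl n (\<lambda>i. at_q0 (y i)) (specialize F)"
proof -
  obtain D where D: "\<And>m. scoeff F m \<noteq> 0 \<Longrightarrow> mdeg m \<le> D" using obtain_degree_bound[of F] by blast
  have 1: "evl n y F = (\<Sum>m\<in>mons n D. scoeff F m * mon_eval n y m)"
    by (rule evl_mons) (rule D)
  have 2: "evl n (\<lambda>i. at_q0 (y i)) (specialize F) = (\<Sum>m\<in>mons n D. at_q0 (scoeff F m) * mon_eval n (\<lambda>i. at_q0 (y i)) m)"
    by (subst evl_mons[of _ D]) (use D in force)+
  have m: "regular (mon_eval n y m)" "at_q0 (mon_eval n y m) = mon_eval n (\<lambda>i. at_q0 (y i)) m" for m
    using assms(2) by (simp_all add: mon_eval_def at_q0_prod at_q0_power)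
  show "regular (evl n y F)" unfolding 1 using assms(1) m by simp
  show "at_q0 (evl n y F) = evl n (\<lambda>i. at_q0 (y i)) (specialize F)"
    unfolding 1 2 using assms(1) m by (simp add: at_q0_sum at_q0_mult)
qed

lemma regular_vdm:
  assumes "\<And>i. regular (y i)"
  shows "regular (vdm n y)" "at_q0 (vdm n y) = vdm n (\<lambda>i. at_q0 (y i))"
  unfolding vdm_expand using assms
  by (simp_all add: at_q0_sum at_q0_mult at_q0_prod at_q0_power)

lemma regular_shift:
  "regular (shift qq I (point x) i)" "at_q0 (shift qq I (point x) i) = shift 0 I (point x) i"
  "regular (shift tt I (point x) i)" "at_q0 (shift tt I (point x) i) = shift tt I (point x) i"
  by (simp_all add: shift_def point_def at_q0_mult)

lemma regular_point [simp]: "regular (point x i)" "at_q0 (point x i) = point x i"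
  by (simp_all add: point_def)

lemma at_q0_shift_sum:
  assumes F: "\<And>m. regular (scoeff F m)"
  shows "at_q0 (shift_sum qq tt n (- 1) (\<lambda>y. evl n y F) (point x))
    = shift_sum 0 tt n (- 1) (\<lambda>y. evl n y (specialize F)) (point x)"
  unfolding shift_sum_def
  by (simp add: at_q0_sum at_q0_mult at_q0_power at_q0_minus regular_evl[OF F] regular_shift regular_vdm)

text \<open>For q = 0 a nonempty I sets some variable to 0, and every monomial of F in the n
  variables contains all of them.\<close>

lemma shift_sum_at_zero:
  assumes "\<And>m. Poly_Mapping.keys m \<subset> {..<n} \<Longrightarrow> scoeff F m = 0"
  shows "shift_sum 0 t n X (\<lambda>y. evl n y F) x = vdm n x * evl n x (F :: qt symfun)"
proof -
  have "evl n (shift 0 I x) F = 0" if I: "I \<subseteq> {..<n}" "I \<noteq> {}" for I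
    unfolding evl_def
  proof (rule sum.neutral, rule ballI)
    fix m assume m: "m \<in> {m. Poly_Mapping.keys m \<subseteq> {..<n} \<and> scoeff F m \<noteq> 0}"
    then have k: "Poly_Mapping.keys m = {..<n}" using assms[of m] by auto
    obtain i where i: "i \<in> I" "i < n" using I by auto
    then have "Poly_Mapping.lookup m i \<noteq> 0" using k by (metis in_keys_iff lessThan_iff)
    then have "shift 0 I x i ^ Poly_Mapping.lookup m i = 0" using i by (simp add: shift_def)
    then have "mon_eval n (shift 0 I x) m = 0"
      unfolding mon_eval_def using i(2) by (intro prod_zero) auto
    then show "scoeff F m * mon_eval n (shift 0 I x) m = 0" by simp
  qed
  then have "shift_sum 0 t n X (\<lambda>y. evl n y F) x
      = (\<Sum>I\<in>{{}}. X ^ card I * vdm n (shift t I x) * evl n (shift 0 I x) F)"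
    unfolding shift_sum_def by (intro sum.mono_neutral_right) auto
  then show ?thesis by (simp add: shift_def)
qed

lemma macdonald_P_Nil [simp]: "macdonald_P [] = 1"
proof -
  have "lower_partitions [] = {}"
  proof (rule equals0I)
    fix \<nu> assume \<nu>: "\<nu> \<in> lower_partitions []"
    then have "\<nu> \<in> partitions_of 0" by (simp add: lower_partitions_def partitions_of_def)
    then have "\<nu> = []" unfolding partitions_of_0 by simp
    then show False using \<nu> by (simp add: lower_partitions_def)
  qed
  then have "macdonald_P [] - monomial_sym [] = 0"
    using mac.triangular[of "[]"] by (simp add: is_partition_def)
  moreover have "(monomial_sym [] :: qt symfun) = 1"
  proof (rule symfun_eqI)
    fix m :: mon
    have "exponents m = {#} \<longleftrightarrow> m = 0"
      by (simp add: exponents_def mset_set_empty_iff)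
    then show "scoeff (monomial_sym [] :: qt symfun) m = scoeff 1 m"
      by (simp add: monomial_sym.rep_eq one_symfun.rep_eq)
  qed
  ultimately show ?thesis by simp
qed

text \<open>
  If \<open>P\<^sub>\<nu>\<close> did not specialize, a rescaled multiple would have a nonzero specialization \<open>F\<^sub>0\<close>.  Restrict
  \<open>F\<^sub>0\<close> to the least number \<open>n\<close> of variables in which it does not vanish.  For \<open>n = l(\<nu>)\<close> this contradicts
  the factorization by the first column; for \<open>n > l(\<nu>)\<close> it contradicts the eigenvalue equation with
  \<open>X = -1\<close>, whose eigenvalue is 0 and in which only the term \<open>I = {}\<close> survives at \<open>q = 0\<close>.
\<close>

theorem regular_macdonald_P: "is_partition \<nu> \<Longrightarrow> regular (scoeff (macdonald_P \<nu>) m)"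
proof (induction \<nu> arbitrary: m rule: partition_column_induct)
  case Nil
  then show ?case by (simp add: one_symfun.rep_eq)
next
  case (column k \<nu>)
  define \<kappa> where "\<kappa> = add_column k \<nu>"
  have \<kappa>: "is_partition \<kappa>" "length \<kappa> = k" using column by (simp_all add: \<kappa>_def is_partition_add_column)
  define A where "A = partitions_of (sum_list \<kappa>)"
  have finA: "finite A" by (simp add: A_def)
  have inA: "partition_of_mon m \<in> A" if "scoeff (macdonald_P \<kappa>) m \<noteq> 0" for m
    using mac.coeff_nonzero(1)[OF \<kappa>(1), of "partition_of_mon m"] that
    by (simp add: A_def partitions_of_def scoeff_eq_monomial_coeff[of _ m])
  consider "\<And>a. a \<in> A \<Longrightarrow> regular (monomial_coeff (macdonald_P \<kappa>) a)"
    | B where "regular B" "at_q0 B = 0" "\<And>a. a \<in> A \<Longrightarrow> regular (B * monomial_coeff (macdonald_P \<kappa>) a)"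
      "\<exists>a\<in>A. at_q0 (B * monomial_coeff (macdonald_P \<kappa>) a) \<noteq> 0"
    using regular_or_rescale[OF finA, of "monomial_coeff (macdonald_P \<kappa>)"] by metis
  then have "regular (scoeff (macdonald_P \<kappa>) m)"
  proof cases
    case 1
    then show ?thesis
      using inA[of m] by (cases "scoeff (macdonald_P \<kappa>) m = 0") (auto simp: scoeff_eq_monomial_coeff[of _ m])
  next
    case (2 B)
    define F where "F = sscale B (macdonald_P \<kappa>)"
    define F0 where "F0 = specialize F"
    have regF: "regular (scoeff F m)" for m
      using 2(3)[of "partition_of_mon m"] inA[of m]
      by (cases "scoeff (macdonald_P \<kappa>) m = 0") (simp_all add: F_def scoeff_eq_monomial_coeff[of _ m])
    have F0_coeff: "monomial_coeff F0 \<mu> = at_q0 (B * monomial_coeff (macdonald_P \<kappa>) \<mu>)" for \<mu>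
      by (simp add: F0_def F_def monomial_coeff_def)
    obtain \<mu>0 where "is_partition \<mu>0" "monomial_coeff F0 \<mu>0 \<noteq> 0"
      using 2(4) by (auto simp: F0_coeff A_def partitions_of_def)
    then obtain \<mu> where \<mu>: "is_partition \<mu>" "monomial_coeff F0 \<mu> \<noteq> 0"
      and min: "\<And>\<rho>. is_partition \<rho> \<Longrightarrow> monomial_coeff F0 \<rho> \<noteq> 0 \<Longrightarrow> length \<mu> \<le> length \<rho>"
      using ex_has_least_nat[of "\<lambda>\<mu>. is_partition \<mu> \<and> monomial_coeff F0 \<mu> \<noteq> 0" \<mu>0 length] by blast
    define n where "n = length \<mu>"
    have "monomial_coeff (macdonald_P \<kappa>) \<mu> \<noteq> 0" using \<mu>(2) by (auto simp: F0_coeff)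
    then have kn: "k \<le> n"
      using mac.coeff_nonzero(2)[OF \<kappa>(1) \<mu>(1)] partition_key_le_length \<kappa>(2) by (auto simp: n_def)
    have "evl n (point x) F0 = 0" if x: "x \<in> generic_points n" for x
    proof -
      have ev: "evl n (point x) F0 = at_q0 (evl n (point x) F)"
        using regular_evl(2)[OF regF, of "point x" n] by (simp add: F0_def)
      show ?thesis
      proof (cases "n = k")
        case True
        have "evl n (point x) F = B * ((\<Prod>i<n. point x i) * evl n (point x) (macdonald_P \<nu>))"
          using mac.multiply_column[OF column(1,2), of x] x True by (simp add: F_def \<kappa>_def)
        also have "at_q0 \<dots> = 0"
          using 2(1,2) regular_evl(1)[OF column(4), of "point x" n] by (simp add: at_q0_mult)
        finally show ?thesis using ev by simp
      next
        case False
        have coeff0: "scoeff F0 m = 0" if "Poly_Mapping.keys m \<subset> {..<n}" for m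
        proof (rule ccontr)
          assume "scoeff F0 m \<noteq> 0"
          then have "n \<le> card (Poly_Mapping.keys m)"
            using min[of "partition_of_mon m"] by (simp add: n_def scoeff_eq_monomial_coeff[of _ m])
          moreover have "card (Poly_Mapping.keys m) < n"
            using psubset_card_mono[OF _ that] by simp
          ultimately show False by simp
        qed
        have "shift_sum qq tt n (- 1) (\<lambda>y. evl n y F) (point x)
            = B * shift_sum qq tt n (- 1) (\<lambda>y. evl n y (macdonald_P \<kappa>)) (point x)"
          by (simp add: F_def shift_sum_def sum_distrib_left mult_ac)
        also have "\<dots> = 0"
          using mac.eigen'[OF \<kappa>(1) x] eigenvalue_minus_one[of \<kappa> n] kn False \<kappa>(2) by simp
        finally have "shift_sum 0 tt n (- 1) (\<lambda>y. evl n y F0) (point x) = 0"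
          using at_q0_shift_sum[OF regF, of n x] by (simp add: F0_def)
        then have "vdm n (point x) * evl n (point x) F0 = 0"
          using shift_sum_at_zero[of n F0 tt "- 1" "point x"] coeff0 by simp
        moreover have "vdm n (point x) \<noteq> 0" by (rule vdm_nonzero) (use point_generic[OF x] in auto)
        ultimately show ?thesis by simp
      qed
    qed
    then have "monomial_coeff F0 \<mu> = 0"
      by (intro evl_zero_imp_monomial_coeff[of n]) (simp_all add: point_def \<mu> n_def)
    then show ?thesis using \<mu>(2) by simp
  qed
  then show ?case by (simp add: \<kappa>_def)
qed

lemma regular_hook_poly: "regular (hook_poly \<nu>)"
  unfolding hook_poly_def by simp

text \<open>Each prepended column contributes factors 1 - t^a q^b with b \<ge> 1, as all parts of
  the enlarged partition are positive; these become 1 at q = 0.\<close>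

lemma integral_norm_specialize:
  assumes "is_partition \<nu>"
  shows "regular (integral_norm \<nu>) \<and> at_q0 (integral_norm \<nu>) = 1"
  using assms
proof (induction rule: partition_column_induct)
  case Nil
  have "qt_inner 1 (power_sums []) = 1"
    using psum_coeff_power_sums[of "[]" "[]", where 'a = qt]
    by (subst qt_inner_power_sums) (simp_all add: is_partition_def qt_weight_def zee_def)
  then show ?case by (simp add: integral_norm_def hook_poly_def cells_def)
next
  case (column n \<nu>)
  have "regular (1 + - 1 * tt ^ (n - 1 - i) * qq ^ nth_part (add_column n \<nu>) i)"
    "at_q0 (1 + - 1 * tt ^ (n - 1 - i) * qq ^ nth_part (add_column n \<nu>) i) = 1" if "i < n" for i
    using that by (simp_all add: nth_part_add_column at_q0_diff at_q0_mult at_q0_power)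
  then have "regular (eigenvalue n (- 1) (add_column n \<nu>))" "at_q0 (eigenvalue n (- 1) (add_column n \<nu>)) = 1"
    unfolding eigenvalue_def by (simp_all add: at_q0_prod)
  then show ?case
    using column by (simp add: integral_norm_add_column at_q0_mult)
qed

abbreviation hall_littlewood_P :: "nat list \<Rightarrow> qt symfun" where
  "hall_littlewood_P \<nu> \<equiv> specialize (macdonald_P \<nu>)"

text \<open>The eigenvalue of D(-1) is 0 below length n and specializes to 1 at length n; beyond
  length n the function itself vanishes. So the operator becomes a projection.\<close>

lemma hall_littlewood_shift_sum:
  assumes \<nu>: "is_partition \<nu>" and x: "x \<in> generic_points n"
  shows "shift_sum 0 tt n (- 1) (\<lambda>y. evl n y (hall_littlewood_P \<nu>)) (point x)
    = (if length \<nu> = n then vdm n (point x) * evl n (point x) (hall_littlewood_P \<nu>) else 0)"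
proof -
  have reg: "regular (scoeff (macdonald_P \<nu>) m)" for m by (rule regular_macdonald_P[OF \<nu>])
  have "shift_sum 0 tt n (- 1) (\<lambda>y. evl n y (hall_littlewood_P \<nu>)) (point x)
      = at_q0 (eigenvalue n (- 1) \<nu> * (vdm n (point x) * evl n (point x) (macdonald_P \<nu>)))"
    using at_q0_shift_sum[OF reg, of n x] mac.eigen'[OF \<nu> x, of "- 1"] by simp
  also have "\<dots> = (if length \<nu> = n then vdm n (point x) * evl n (point x) (hall_littlewood_P \<nu>) else 0)"
  proof -
    have r: "regular (vdm n (point x))" "regular (evl n (point x) (macdonald_P \<nu>))"
      "at_q0 (vdm n (point x)) = vdm n (point x)"
      "at_q0 (evl n (point x) (macdonald_P \<nu>)) = evl n (point x) (hall_littlewood_P \<nu>)"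
      using regular_vdm[of "point x" n] regular_evl[OF reg, of "point x" n] by simp_all
    consider "length \<nu> < n" | "n < length \<nu>" | "length \<nu> = n" by linarith
    then show ?thesis
    proof cases
      case 3
      have "regular (1 + - 1 * tt ^ (n - 1 - i) * qq ^ nth_part \<nu> i)"
        "at_q0 (1 + - 1 * tt ^ (n - 1 - i) * qq ^ nth_part \<nu> i) = 1" if "i < n" for i
        using nth_part_pos[OF \<nu>, of i] 3 that by (simp_all add: at_q0_diff at_q0_mult at_q0_power)
      then have "regular (eigenvalue n (- 1) \<nu>)" "at_q0 (eigenvalue n (- 1) \<nu>) = 1"
        unfolding eigenvalue_def by (simp_all add: at_q0_prod)
      then show ?thesis using 3 r by (simp add: at_q0_mult)
    qed (simp_all add: eigenvalue_minus_one mac.evl_zero \<nu>)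
  qed
  finally show ?thesis .
qed

lemma hall_littlewood_multiply_column:
  assumes "is_partition \<nu>" "length \<nu> \<le> n" "x \<in> generic_points n"
  shows "(\<Prod>i<n. point x i) * evl n (point x) (hall_littlewood_P \<nu>)
    = evl n (point x) (hall_littlewood_P (add_column n \<nu>))"
proof -
  have "at_q0 (evl n (point x) (macdonald_P \<mu>)) = evl n (point x) (hall_littlewood_P \<mu>)
      \<and> regular (evl n (point x) (macdonald_P \<mu>))" if "is_partition \<mu>" for \<mu>
    using regular_evl[OF regular_macdonald_P[OF that], of "point x" n] by simp
  then show ?thesis
    using arg_cong[OF mac.multiply_column[OF assms], of at_q0] assms(1)
    by (simp add: is_partition_add_column at_q0_mult at_q0_prod)
qed

lemma hall_littlewood_evl_zero:
  assumes "is_partition \<nu>" "n < length \<nu>"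
  shows "evl n y (hall_littlewood_P \<nu>) = 0"
proof -
  have "scoeff (macdonald_P \<nu>) m = 0" if "Poly_Mapping.keys m \<subseteq> {..<n}" for m
    using mac.coeff_length[OF assms(1), of m] card_mono[OF _ that] assms(2) by force
  then show ?thesis unfolding evl_def by (intro sum.neutral) auto
qed


section \<open>Expansions of the Cauchy kernels\<close>

text \<open>The degree \<open>d\<close> parts of \<open>\<Omega>[XZ]\<close> and \<open>\<Omega>[XZ/(1-q)]\<close>, where \<open>Z = z\<^sub>0 + \<dots> + z\<^bsub>n-1\<^esub>\<close>.\<close>

definition omega :: "nat \<Rightarrow> (nat \<Rightarrow> qt) \<Rightarrow> nat \<Rightarrow> qt symfun" where
  "omega n z = cauchy_sum sconst (\<lambda>r. sconst (\<Sum>i<n. z i ^ r) * power_sum r)"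

definition omega_q :: "nat \<Rightarrow> (nat \<Rightarrow> qt) \<Rightarrow> nat \<Rightarrow> qt symfun" where
  "omega_q n z = cauchy_sum sconst (\<lambda>r. sconst ((\<Sum>i<n. z i ^ r) / (1 - qq ^ r)) * power_sum r)"

lemma over_one_minus_t_add: "over_one_minus_t (F + G) = over_one_minus_t F + over_one_minus_t G"
  and over_one_minus_t_sscale: "over_one_minus_t (sscale c F) = sscale c (over_one_minus_t F)"
  and over_one_minus_t_sum: "over_one_minus_t (sum f A) = (\<Sum>a\<in>A. over_one_minus_t (f a))"
  unfolding over_one_minus_t_def sconst_hom.plethysm_add sconst_hom.plethysm_sscale
    sconst_hom.plethysm_sum sscale_eq_sconst_mult[symmetric] by (rule refl)+

lemma over_one_minus_t_cauchy:
  "over_one_minus_t (\<Sum>\<nu>\<in>partitions_of d. sscale (1 / of_nat (zee \<nu>) * prod_list (map (\<lambda>r. c r * (1 - tt ^ r)) \<nu>)) (power_sums \<nu>))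
    = cauchy_sum sconst (\<lambda>r. sconst (c r) * power_sum r) d"
proof -
  have "over_one_minus_t (\<Sum>\<nu>\<in>partitions_of d. sscale (1 / of_nat (zee \<nu>) * prod_list (map (\<lambda>r. c r * (1 - tt ^ r)) \<nu>)) (power_sums \<nu>))
      = cauchy_sum sconst (\<lambda>r. sconst (c r * (1 - tt ^ r)) * sscale (1 / (1 - tt ^ r)) (power_sum r)) d"
    unfolding over_one_minus_t_def by (rule sconst_hom.plethysm_cauchy_sum)
  also have "cauchy_sum sconst (\<lambda>r. sconst (c r * (1 - tt ^ r)) * sscale (1 / (1 - tt ^ r)) (power_sum r))
      = cauchy_sum sconst (\<lambda>r. sconst (c r) * power_sum r)"
  proof (rule sconst_hom.cauchy_sum_cong)
    fix r :: nat assume "r > 0"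
    then have "c r * (1 - tt ^ r) * (1 / (1 - tt ^ r)) = c r" using tt_power_ne_1[of r] by simp
    then show "sconst (c r * (1 - tt ^ r)) * sscale (1 / (1 - tt ^ r)) (power_sum r) = sconst (c r) * power_sum r"
      by (simp only: sscale_eq_sconst_mult mult.assoc[symmetric] flip: sconst_simps(2))
  qed
  finally show ?thesis .
qed

lemma evl_over_weight:
  assumes "\<nu> \<in> partitions_of d"
  shows "evl n z (power_sums \<nu>) / qt_weight \<nu>
    = 1 / of_nat (zee \<nu>) * prod_list (map (\<lambda>r. (\<Sum>i<n. z i ^ r) / (1 - qq ^ r) * (1 - tt ^ r)) \<nu>)"
proof -
  have \<nu>: "0 \<notin> set \<nu>" using assms by (simp add: partitions_of_def is_partition_def)
  have "prod_list (map (\<lambda>r. (\<Sum>i<n. z i ^ r) / (1 - qq ^ r) * (1 - tt ^ r)) \<nu>)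
      = evl n z (power_sums \<nu>) / prod_list (map (\<lambda>r. (1 - qq ^ r) / (1 - tt ^ r)) \<nu>)"
    unfolding evl_power_sums[OF \<nu>] using \<nu> by (induction \<nu>) auto
  then show ?thesis by (simp add: qt_weight_def)
qed

lemma macdonald_reproducing:
  "(\<Sum>\<nu>\<in>partitions_of d. sscale (evl n z (power_sums \<nu>) / qt_weight \<nu>) (power_sums \<nu>))
    = (\<Sum>\<nu>\<in>partitions_of d. sscale (evl n z (macdonald_P \<nu>) / integral_norm \<nu>) (macdonald_J \<nu>))"
proof -
  have "(\<Sum>\<nu>\<in>partitions_of d. sscale (evl n z (power_sums \<nu>) / qt_weight \<nu>) (power_sums \<nu>))
    = (\<Sum>\<nu>\<in>partitions_of d. sscale (evl n z (macdonald_P \<nu>) / qt_inner (macdonald_P \<nu>) (macdonald_P \<nu>)) (macdonald_P \<nu>))"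
    by (rule mac.reproducing_kernel) simp_all
  also have "\<dots> = (\<Sum>\<nu>\<in>partitions_of d. sscale (evl n z (macdonald_P \<nu>) / integral_norm \<nu>) (macdonald_J \<nu>))"
    by (rule sum.cong) (simp_all add: macdonald_J_def integral_norm_def hook_poly_nonzero)
  finally show ?thesis .
qed

text \<open>X -> X/(1-t) cancels the factors 1 - t^r in the exponent of the Macdonald kernel and
  turns J_\<nu> into H_\<nu>.\<close>

theorem omega_q_expansion:
  "omega_q n z d = (\<Sum>\<nu>\<in>partitions_of d. sscale (evl n z (macdonald_P \<nu>) / integral_norm \<nu>) (H_qt \<nu>))"
proof -
  have "omega_q n z d = over_one_minus_t (\<Sum>\<nu>\<in>partitions_of d. sscale (evl n z (power_sums \<nu>) / qt_weight \<nu>) (power_sums \<nu>))"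
    unfolding omega_q_def over_one_minus_t_cauchy[symmetric]
    by (rule arg_cong[where f = over_one_minus_t], rule sum.cong[OF refl]) (simp only: evl_over_weight)
  then show ?thesis
    unfolding macdonald_reproducing by (simp add: over_one_minus_t_sum over_one_minus_t_sscale H_qt_def)
qed

lemma regular_power_sums: "0 \<notin> set \<nu> \<Longrightarrow> regular (scoeff (power_sums \<nu>) m) \<and> at_q0 (scoeff (power_sums \<nu>) m) = scoeff (power_sums \<nu>) m"
proof (induction \<nu> arbitrary: m)
  case (Cons r \<nu>)
  then have "r > 0" by auto
  then show ?case using Cons by (simp add: scoeff_power_sum_mult at_q0_sum)
qed (simp add: one_symfun.rep_eq)

text \<open>The case q = 0, where \<kappa>_\<nu> becomes 1. The specialization is carried out on
  coefficients, before the substitution X -> X/(1-t); the assumptions on z let it pass through the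
  evaluations.\<close>

theorem omega_expansion:
  assumes z: "\<And>i. regular (z i)" "\<And>i. at_q0 (z i) = z i"
  shows "omega n z d = (\<Sum>\<nu>\<in>partitions_of d. sscale (evl n z (hall_littlewood_P \<nu>)) (H_t \<nu>))"
proof -
  let ?c = "\<lambda>\<nu>. 1 / of_nat (zee \<nu>) * prod_list (map (\<lambda>r. (\<Sum>i<n. z i ^ r) * (1 - tt ^ r)) \<nu>)"
  have c: "regular (evl n z (power_sums \<nu>) / qt_weight \<nu>) \<and> at_q0 (evl n z (power_sums \<nu>) / qt_weight \<nu>) = ?c \<nu>"
    if \<nu>: "\<nu> \<in> partitions_of d" for \<nu>
  proof -
    have p: "regular (prod_list (map (\<lambda>r. (\<Sum>i<n. z i ^ r) / (1 - qq ^ r) * (1 - tt ^ r)) \<nu>)) \<and>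
        at_q0 (prod_list (map (\<lambda>r. (\<Sum>i<n. z i ^ r) / (1 - qq ^ r) * (1 - tt ^ r)) \<nu>))
          = prod_list (map (\<lambda>r. (\<Sum>i<n. z i ^ r) * (1 - tt ^ r)) \<nu>)" if "0 \<notin> set \<nu>" for \<nu>
      using that
    proof (induction \<nu>)
      case (Cons r \<nu>)
      then have r: "r > 0" by auto
      have q: "regular (1 - qq ^ r)" "at_q0 (1 - qq ^ r) = 1"
        using r by (simp_all add: at_q0_diff at_q0_power)
      have i: "regular (inverse (1 - qq ^ r))" "at_q0 (inverse (1 - qq ^ r)) = 1"
        using regular_inverse[OF q(1)] q(2) by simp_all
      have "regular ((\<Sum>i<n. z i ^ r) * inverse (1 - qq ^ r) * (1 - tt ^ r))"
        "at_q0 ((\<Sum>i<n. z i ^ r) * inverse (1 - qq ^ r) * (1 - tt ^ r)) = (\<Sum>i<n. z i ^ r) * (1 - tt ^ r)"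
        using z i by (simp_all add: at_q0_mult at_q0_diff at_q0_power at_q0_sum)
      then show ?case using Cons by (simp add: at_q0_mult divide_inverse)
    qed simp
    have zz: "regular (1 / of_nat (zee \<nu>))" "at_q0 (1 / of_nat (zee \<nu>)) = 1 / of_nat (zee \<nu>)"
      using regular_inverse[of "of_nat (zee \<nu>)"] zee_pos[of \<nu>] \<nu>
      by (simp_all add: divide_inverse partitions_of_def)
    have "0 \<notin> set \<nu>" using \<nu> by (simp add: partitions_of_def is_partition_def)
    note p' = p[OF this]
    show ?thesis
      unfolding evl_over_weight[OF \<nu>]
      using regular_mult[OF zz(1) conjunct1[OF p']]
        at_q0_mult[OF zz(1) conjunct1[OF p'], unfolded zz(2) conjunct2[OF p']] by blast
  qed
  have "(\<Sum>\<nu>\<in>partitions_of d. sscale (?c \<nu>) (power_sums \<nu>))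
      = (\<Sum>\<nu>\<in>partitions_of d. sscale (evl n z (hall_littlewood_P \<nu>)) (hall_littlewood_Q \<nu>))"
  proof (rule symfun_eqI)
    fix m
    let ?L = "\<Sum>\<nu>\<in>partitions_of d. evl n z (power_sums \<nu>) / qt_weight \<nu> * scoeff (power_sums \<nu>) m"
    let ?R = "\<Sum>\<nu>\<in>partitions_of d. evl n z (macdonald_P \<nu>) * inverse (integral_norm \<nu>) * scoeff (macdonald_J \<nu>) m"
    have eq: "?L = ?R"
      using arg_cong[OF macdonald_reproducing, of "\<lambda>F. scoeff F m" n z d] by (simp add: divide_inverse)
    have pm: "regular (scoeff (power_sums \<nu> :: qt symfun) m) \<and> at_q0 (scoeff (power_sums \<nu>) m) = scoeff (power_sums \<nu>) m"
      if "\<nu> \<in> partitions_of d" for \<nu>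
      by (rule regular_power_sums) (use that in \<open>simp add: partitions_of_def is_partition_def\<close>)
    have cpm: "regular (evl n z (power_sums \<nu>) / qt_weight \<nu> * scoeff (power_sums \<nu>) m) \<and>
        at_q0 (evl n z (power_sums \<nu>) / qt_weight \<nu> * scoeff (power_sums \<nu>) m) = ?c \<nu> * scoeff (power_sums \<nu>) m"
      if "\<nu> \<in> partitions_of d" for \<nu>
      using regular_mult[OF conjunct1[OF c[OF that]] conjunct1[OF pm[OF that]]]
        at_q0_mult[OF conjunct1[OF c[OF that]] conjunct1[OF pm[OF that]],
          unfolded conjunct2[OF c[OF that]] conjunct2[OF pm[OF that]]] by blast
    have L: "at_q0 ?L = (\<Sum>\<nu>\<in>partitions_of d. ?c \<nu> * scoeff (power_sums \<nu>) m)"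
    proof -
      have "at_q0 ?L = (\<Sum>\<nu>\<in>partitions_of d. at_q0 (evl n z (power_sums \<nu>) / qt_weight \<nu> * scoeff (power_sums \<nu>) m))"
        by (rule at_q0_sum) (use cpm in blast)
      also have "\<dots> = (\<Sum>\<nu>\<in>partitions_of d. ?c \<nu> * scoeff (power_sums \<nu>) m)"
        by (rule sum.cong[OF refl]) (use cpm in blast)
      finally show ?thesis .
    qed
    have summand: "regular (evl n z (macdonald_P \<nu>) * inverse (integral_norm \<nu>) * scoeff (macdonald_J \<nu>) m) \<and>
        at_q0 (evl n z (macdonald_P \<nu>) * inverse (integral_norm \<nu>) * scoeff (macdonald_J \<nu>) m)
          = evl n z (hall_littlewood_P \<nu>) * scoeff (hall_littlewood_Q \<nu>) m" if "\<nu> \<in> partitions_of d" for \<nu>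
    proof -
      have \<nu>: "is_partition \<nu>" using that by (simp add: partitions_of_def)
      have 1: "regular (inverse (integral_norm \<nu>))" "at_q0 (inverse (integral_norm \<nu>)) = 1"
        using regular_inverse[of "integral_norm \<nu>"] integral_norm_specialize[OF \<nu>] by simp_all
      have 2: "regular (evl n z (macdonald_P \<nu>))" "at_q0 (evl n z (macdonald_P \<nu>)) = evl n z (hall_littlewood_P \<nu>)"
        using regular_evl[OF regular_macdonald_P[OF \<nu>], of z n] z by simp_all
      have 3: "regular (scoeff (macdonald_J \<nu>) m)"
        using regular_hook_poly regular_macdonald_P[OF \<nu>] by (simp add: macdonald_J_def)
      have 4: "at_q0 (scoeff (macdonald_J \<nu>) m) = scoeff (hall_littlewood_Q \<nu>) m"
        by (simp add: hall_littlewood_Q_def scoeff_map_coeffs)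
      show ?thesis using 1 2 3 4 by (simp add: at_q0_mult)
    qed
    have R: "at_q0 ?R = (\<Sum>\<nu>\<in>partitions_of d. evl n z (hall_littlewood_P \<nu>) * scoeff (hall_littlewood_Q \<nu>) m)"
      by (subst at_q0_sum) (use summand in auto)
    show "scoeff (\<Sum>\<nu>\<in>partitions_of d. sscale (?c \<nu>) (power_sums \<nu>)) m
        = scoeff (\<Sum>\<nu>\<in>partitions_of d. sscale (evl n z (hall_littlewood_P \<nu>)) (hall_littlewood_Q \<nu>)) m"
      using arg_cong[OF eq, of at_q0] unfolding L R by simp
  qed
  from arg_cong[OF this, of over_one_minus_t] show ?thesis
    unfolding over_one_minus_t_cauchy omega_def
    by (simp add: over_one_minus_t_sum over_one_minus_t_sscale H_t_def)
qed


section \<open>The q-analogue of an operator on generating series\<close>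

lemma sconst_0 [simp]: "sconst (0 :: 'a::comm_ring_1) = 0"
  by (rule symfun_eqI) (simp add: sconst.rep_eq)

lemma sconst_sum: "sconst (sum f A) = (\<Sum>a\<in>A. sconst (f a :: 'a::comm_ring_1))"
  by (induction A rule: infinite_finite_induct) (simp_all add: sconst_simps)

section \<open>The two alphabets X and Y\<close>

abbreviation in_Y :: "qt symfun \<Rightarrow> bisym" where
  "in_Y \<equiv> map_coeffs sconst"

lemma scoeff_in_Y [simp]: "scoeff (in_Y F) m = sconst (scoeff F m)"
  by (simp add: scoeff_map_coeffs)

lemma in_Y_add: "in_Y (F + G) = in_Y F + in_Y G"
  by (rule symfun_eqI) (simp add: sconst_simps)

lemma in_Y_mult: "in_Y (F * G) = in_Y F * in_Y G"
  by (rule symfun_eqI) (simp add: times_symfun.rep_eq sconst_sum sconst_simps split_def)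

lemma in_Y_one: "in_Y 1 = 1"
  by (rule symfun_eqI) (simp add: one_symfun.rep_eq sconst_simps)

lemma in_Y_sconst: "in_Y (sconst c) = sconst (sconst c)"
  by (rule symfun_eqI) (simp add: sconst.rep_eq)

lemma in_Y_power_sum: "in_Y (power_sum r) = power_sum r"
  by (rule symfun_eqI) (simp add: power_sum.rep_eq sconst_simps)

lemma monomial_support_partitions: "monomial_support F \<subseteq> partitions"
  by (auto simp: monomial_support_def)

lemma set_Y_superset:
  assumes "finite A" "monomial_support F \<subseteq> A" "A \<subseteq> partitions"
  shows "set_Y_eq_X F = (\<Sum>\<nu>\<in>A. monomial_coeff F \<nu> * monomial_sym \<nu>)"
  unfolding set_Y_eq_X_def
  by (rule sum.mono_neutral_left) (use assms in \<open>auto simp: monomial_support_def\<close>)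

lemma set_Y_add: "set_Y_eq_X (F + G) = set_Y_eq_X F + set_Y_eq_X G"
proof -
  let ?A = "monomial_support F \<union> monomial_support G \<union> monomial_support (F + G)"
  have A: "finite ?A" "?A \<subseteq> partitions" using monomial_support_partitions by auto
  show ?thesis
    by (subst (1 2 3) set_Y_superset[OF A(1) _ A(2)]) (auto simp: distrib_right sum.distrib)
qed

lemma set_Y_sum: "set_Y_eq_X (sum f A) = (\<Sum>a\<in>A. set_Y_eq_X (f a))"
  by (induction A rule: infinite_finite_induct)
    (simp_all add: set_Y_add, simp_all add: set_Y_eq_X_def monomial_support_def)

lemma set_Y_tensor: "set_Y_eq_X (sscale A (in_Y B)) = A * B"
proof -
  let ?S = "monomial_support B"
  have S: "monomial_support (sscale A (in_Y B)) \<subseteq> ?S"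
    by (auto simp: monomial_support_def monomial_coeff_def)
  have "set_Y_eq_X (sscale A (in_Y B)) = (\<Sum>\<nu>\<in>?S. A * (sconst (monomial_coeff B \<nu>) * monomial_sym \<nu>))"
    by (subst set_Y_superset[OF finite_monomial_support S monomial_support_partitions])
      (simp add: monomial_coeff_def mult.assoc)
  also have "\<dots> = A * (\<Sum>\<nu>\<in>?S. sscale (monomial_coeff B \<nu>) (monomial_sym \<nu>))"
    by (simp add: sum_distrib_left sscale_eq_sconst_mult)
  also have "(\<Sum>\<nu>\<in>?S. sscale (monomial_coeff B \<nu>) (monomial_sym \<nu>)) = B"
    by (rule monomial_expansion[symmetric, OF finite_monomial_support])
      (auto simp: monomial_support_def)
  finally show ?thesis .
qed

text \<open>The two maps occur only composed; the composite is linear over the symmetric functions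
  in X and is determined by V on monomial functions.\<close>

lemma set_Y_act_Y:
  assumes "finite A" "monomial_support F \<subseteq> A" "A \<subseteq> partitions"
  shows "set_Y_eq_X (act_Y V F) = (\<Sum>\<nu>\<in>A. monomial_coeff F \<nu> * V (monomial_sym \<nu>))"
proof -
  have "set_Y_eq_X (act_Y V F) = (\<Sum>\<nu>\<in>monomial_support F. monomial_coeff F \<nu> * V (monomial_sym \<nu>))"
    unfolding act_Y_def set_Y_sum set_Y_tensor ..
  also have "\<dots> = (\<Sum>\<nu>\<in>A. monomial_coeff F \<nu> * V (monomial_sym \<nu>))"
    by (rule sum.mono_neutral_left) (use assms in \<open>auto simp: monomial_support_def\<close>)
  finally show ?thesis .
qed

lemma set_Y_act_Y_add: "set_Y_eq_X (act_Y V (F + G)) = set_Y_eq_X (act_Y V F) + set_Y_eq_X (act_Y V G)"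
proof -
  let ?A = "monomial_support F \<union> monomial_support G \<union> monomial_support (F + G)"
  have A: "finite ?A" "?A \<subseteq> partitions" using monomial_support_partitions by auto
  show ?thesis
    by (subst (1 2 3) set_Y_act_Y[OF A(1) _ A(2)]) (auto simp: distrib_right sum.distrib)
qed

lemma set_Y_act_Y_sscale: "set_Y_eq_X (act_Y V (sscale C F)) = C * set_Y_eq_X (act_Y V F)"
proof -
  let ?A = "monomial_support F \<union> monomial_support (sscale C F)"
  have A: "finite ?A" "?A \<subseteq> partitions" using monomial_support_partitions by auto
  show ?thesis
    by (subst (1 2) set_Y_act_Y[OF A(1) _ A(2)]) (auto simp: sum_distrib_left mult.assoc)
qed

lemma set_Y_act_Y_sum: "set_Y_eq_X (act_Y V (sum f A)) = (\<Sum>a\<in>A. set_Y_eq_X (act_Y V (f a)))"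
  by (induction A rule: infinite_finite_induct)
    (simp_all add: set_Y_act_Y_add, simp_all add: set_Y_act_Y[of "{}"] monomial_support_def)

lemma set_Y_act_Y_tensor:
  assumes "linear_op V"
  shows "set_Y_eq_X (act_Y V (sconst A * in_Y B)) = A * V B"
proof -
  interpret V: Vector_Spaces.linear sscale sscale V by fact
  let ?S = "monomial_support B"
  have S: "monomial_support (in_Y B) \<subseteq> ?S"
    by (auto simp: monomial_support_def monomial_coeff_def)
  have "set_Y_eq_X (act_Y V (in_Y B)) = (\<Sum>\<nu>\<in>?S. sscale (monomial_coeff B \<nu>) (V (monomial_sym \<nu>)))"
    by (subst set_Y_act_Y[OF finite_monomial_support S monomial_support_partitions])
      (simp add: monomial_coeff_def sscale_eq_sconst_mult)
  also have "\<dots> = V (\<Sum>\<nu>\<in>?S. sscale (monomial_coeff B \<nu>) (monomial_sym \<nu>))"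
    by (simp add: V.sum V.scale)
  also have "(\<Sum>\<nu>\<in>?S. sscale (monomial_coeff B \<nu>) (monomial_sym \<nu>)) = B"
    by (rule monomial_expansion[symmetric, OF finite_monomial_support])
      (auto simp: monomial_support_def)
  finally show ?thesis
    by (simp only: sscale_eq_sconst_mult[symmetric] set_Y_act_Y_sscale)
qed

lemma q_analogue_sscale: "q_analogue V (sscale c F) = sscale c (q_analogue V F)"
  unfolding q_analogue_def qX_plus_Y_def sconst2_hom.plethysm_sscale
  unfolding sscale_eq_sconst_mult[symmetric, of "sconst c"] set_Y_act_Y_sscale
  by (simp only: sscale_eq_sconst_mult)

lemma q_analogue_sum: "q_analogue V (sum f A) = (\<Sum>a\<in>A. q_analogue V (f a))"
  unfolding q_analogue_def qX_plus_Y_def sconst2_hom.plethysm_sum set_Y_act_Y_sum ..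

text \<open>The degree \<open>d\<close> part of \<open>\<Omega>[qXZ/(1-q)]\<close>.\<close>

definition omega_twist :: "nat \<Rightarrow> (nat \<Rightarrow> qt) \<Rightarrow> nat \<Rightarrow> qt symfun" where
  "omega_twist n z = cauchy_sum sconst (\<lambda>r. sconst ((\<Sum>i<n. z i ^ r) * (qq ^ r / (1 - qq ^ r))) * power_sum r)"

text \<open>The exponent p_r(z)/(1-q^r) times q^r p_r[X] + (1-q^r) p_r[Y] is a sum of a part in X
  and a part in Y, so the series is a product. V acts on the Y-factor alone, and setting Y = X
  leaves a convolution over degrees.\<close>

lemma q_analogue_omega_q:
  assumes "linear_op V"
  shows "q_analogue V (omega_q n z d) = (\<Sum>i=0..d. omega_twist n z i * V (omega n z (d - i)))"
proof -
  let ?\<iota> = "\<lambda>c. sconst (sconst c) :: bisym"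
  let ?p = "\<lambda>r. (\<Sum>i<n. z i ^ r)"
  let ?a = "\<lambda>r. sconst (sconst (?p r * (qq ^ r / (1 - qq ^ r))) * power_sum r) :: bisym"
  let ?b = "\<lambda>r. in_Y (sconst (?p r) * power_sum r)"
  have e: "omega_q n z d = (\<Sum>\<nu>\<in>partitions_of d. sscale (1 / of_nat (zee \<nu>) *
      prod_list (map (\<lambda>r. ?p r / (1 - qq ^ r)) \<nu>)) (power_sums \<nu>))"
  proof -
    have p: "sconst (prod_list (map c \<nu>)) * power_sums \<nu> = prod_list (map (\<lambda>r. sconst (c r) * power_sum r) \<nu>)"
      for c :: "nat \<Rightarrow> qt" and \<nu>
      by (induction \<nu>) (simp_all add: sconst_simps mult_ac)
    show ?thesis
      unfolding omega_q_def cauchy_sum_def sscale_eq_sconst_mult sconst_simps(2) mult.assoc p ..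
  qed
  have "qX_plus_Y (omega_q n z d) = cauchy_sum ?\<iota> (\<lambda>r. ?\<iota> (?p r / (1 - qq ^ r)) *
      (sconst (sscale (qq ^ r) (power_sum r)) + sscale (sconst (1 - qq ^ r)) (power_sum r))) d"
    unfolding e qX_plus_Y_def by (rule sconst2_hom.plethysm_cauchy_sum)
  also have "cauchy_sum ?\<iota> (\<lambda>r. ?\<iota> (?p r / (1 - qq ^ r)) *
      (sconst (sscale (qq ^ r) (power_sum r)) + sscale (sconst (1 - qq ^ r)) (power_sum r)))
      = cauchy_sum ?\<iota> (\<lambda>r. ?a r + ?b r)"
  proof (rule sconst2_hom.cauchy_sum_cong)
    fix r :: nat assume r: "r > 0"
    have "?p r / (1 - qq ^ r) * (1 - qq ^ r) = ?p r" using qq_power_ne_1[OF r] by simp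
    then have "?\<iota> (?p r / (1 - qq ^ r)) * ?\<iota> (1 - qq ^ r) = ?\<iota> (?p r)"
      by (simp only: sconst_simps(2)[symmetric])
    moreover have "?\<iota> (?p r / (1 - qq ^ r)) * ?\<iota> (qq ^ r) = ?\<iota> (?p r * (qq ^ r / (1 - qq ^ r)))"
      by (simp add: sconst_simps(2)[symmetric])
    ultimately show "?\<iota> (?p r / (1 - qq ^ r)) *
        (sconst (sscale (qq ^ r) (power_sum r)) + sscale (sconst (1 - qq ^ r)) (power_sum r)) = ?a r + ?b r"
      by (simp only: sscale_eq_sconst_mult sconst_simps(2) in_Y_mult in_Y_sconst in_Y_power_sum
          distrib_left mult.assoc[symmetric])
  qed
  also have "cauchy_sum ?\<iota> (\<lambda>r. ?a r + ?b r) d = (\<Sum>i=0..d. cauchy_sum ?\<iota> ?a i * cauchy_sum ?\<iota> ?b (d - i))"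
    using arg_cong[OF sconst2_hom.cauchy_series_add[of ?a ?b], of "\<lambda>f. fps_nth f d"]
    by (simp add: fps_mult_nth)
  also have "\<dots> = (\<Sum>i=0..d. sconst (omega_twist n z i) * in_Y (omega n z (d - i)))"
  proof -
    have "cauchy_sum ?\<iota> ?a i = sconst (omega_twist n z i)" for i
      unfolding omega_twist_def by (rule cauchy_sum_hom[symmetric]) (simp_all add: sconst_simps)
    moreover have "cauchy_sum ?\<iota> ?b i = in_Y (omega n z i)" for i
      unfolding omega_def
      by (rule cauchy_sum_hom[symmetric]) (simp_all add: in_Y_add in_Y_mult in_Y_one in_Y_sconst)
    ultimately show ?thesis by simp
  qed
  finally show ?thesis
    unfolding q_analogue_def by (simp add: set_Y_act_Y_sum set_Y_act_Y_tensor[OF assms])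
qed

text \<open>For r > 0, \<open>shift 0 I\<close> deletes the variables of I from the power sum. The
  exponents then add up: p_r q^r/(1-q^r) plus p_r without the part from I equals the power sum of
  q^I z over 1 - q^r.\<close>

lemma omega_twist_mult:
  assumes "I \<subseteq> {..<n}"
  shows "(\<Sum>i=0..d. omega_twist n z i * omega n (shift 0 I z) (d - i)) = omega_q n (shift qq I z) d"
proof -
  let ?a = "\<lambda>r. sconst ((\<Sum>i<n. z i ^ r) * (qq ^ r / (1 - qq ^ r))) * power_sum r :: qt symfun"
  let ?b = "\<lambda>r. sconst (\<Sum>i<n. shift 0 I z i ^ r) * power_sum r :: qt symfun"
  have "cauchy_sum sconst (\<lambda>r. sconst ((\<Sum>i<n. shift qq I z i ^ r) / (1 - qq ^ r)) * power_sum r)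
      = cauchy_sum sconst (\<lambda>r. ?a r + ?b r)"
  proof (rule sconst_hom.cauchy_sum_cong)
    fix r :: nat assume r: "r > 0"
    have "(\<Sum>i<n. shift qq I z i ^ r) / (1 - qq ^ r)
        = (\<Sum>i<n. z i ^ r) * (qq ^ r / (1 - qq ^ r)) + (\<Sum>i<n. shift 0 I z i ^ r)"
      using qq_power_ne_1[OF r] r unfolding sum_shift_power[OF assms]
      by (simp add: field_simps)
    then show "sconst ((\<Sum>i<n. shift qq I z i ^ r) / (1 - qq ^ r)) * power_sum r = ?a r + ?b r"
      by (simp only: sconst_simps(1) distrib_right)
  qed
  then have "omega_q n (shift qq I z) d = cauchy_sum sconst (\<lambda>r. ?a r + ?b r) d"
    by (simp add: omega_q_def)
  also have "\<dots> = (\<Sum>i=0..d. cauchy_sum sconst ?a i * cauchy_sum sconst ?b (d - i))"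
    using arg_cong[OF sconst_hom.cauchy_series_add[of ?a ?b], of "\<lambda>f. fps_nth f d"]
    by (simp add: fps_mult_nth)
  finally show ?thesis by (simp add: omega_twist_def omega_def)
qed


section \<open>The column-adding property\<close>

text \<open>Degree j of the alternating sum that describes G on the generating series;
  \<open>shift 0 I\<close> realizes the alphabet Z - Z_I.\<close>

definition omega_shift_sum :: "nat \<Rightarrow> (nat \<Rightarrow> qt) \<Rightarrow> nat \<Rightarrow> qt symfun" where
  "omega_shift_sum n z j =
     (\<Sum>I\<in>Pow {..<n}. sscale ((- 1) ^ card I * vdm n (shift tt I z)) (omega n (shift 0 I z) j))"

lemma sum_sscale_left: "(\<Sum>a\<in>A. sscale (c a) F) = sscale (\<Sum>a\<in>A. c a) (F :: qt symfun)"
  by (rule symfun.scale_sum_left[symmetric])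

text \<open>After exchanging the sums over I and \<nu>, the coefficient of H_\<nu> is D(-1) at q = 0
  applied to P_\<nu>(z;0,t), which is the projection to length n.\<close>

lemma omega_shift_sum_expansion:
  assumes x: "x \<in> generic_points n"
  shows "omega_shift_sum n (point x) j = (\<Sum>\<nu> | \<nu> \<in> partitions_of j \<and> length \<nu> = n.
    sscale (vdm n (point x) * evl n (point x) (hall_littlewood_P \<nu>)) (H_t \<nu>))"
proof -
  have z: "regular (shift 0 I (point x) i)" "at_q0 (shift 0 I (point x) i) = shift 0 I (point x) i" for I i
    by (simp_all add: shift_def)
  have "omega_shift_sum n (point x) j = (\<Sum>I\<in>Pow {..<n}. \<Sum>\<nu>\<in>partitions_of j.
      sscale ((- 1) ^ card I * vdm n (shift tt I (point x)) * evl n (shift 0 I (point x)) (hall_littlewood_P \<nu>)) (H_t \<nu>))"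
    unfolding omega_shift_sum_def omega_expansion[OF z] symfun.scale_sum_right symfun.scale_scale ..
  also have "\<dots> = (\<Sum>\<nu>\<in>partitions_of j. sscale
      (shift_sum 0 tt n (- 1) (\<lambda>y. evl n y (hall_littlewood_P \<nu>)) (point x)) (H_t \<nu>))"
    by (subst sum.swap) (simp add: sum_sscale_left shift_sum_def)
  also have "\<dots> = (\<Sum>\<nu>\<in>partitions_of j. if length \<nu> = n then
      sscale (vdm n (point x) * evl n (point x) (hall_littlewood_P \<nu>)) (H_t \<nu>) else 0)"
    by (rule sum.cong) (auto simp: hall_littlewood_shift_sum x partitions_of_def)
  also have "\<dots> = (\<Sum>\<nu> | \<nu> \<in> partitions_of j \<and> length \<nu> = n.
      sscale (vdm n (point x) * evl n (point x) (hall_littlewood_P \<nu>)) (H_t \<nu>))"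
    by (rule sum.inter_filter[symmetric]) simp
  finally show ?thesis .
qed

lemma omega_shift_sum_zero:
  assumes "x \<in> generic_points n" "j < n"
  shows "omega_shift_sum n (point x) j = 0"
proof -
  have "{\<nu>. \<nu> \<in> partitions_of j \<and> length \<nu> = n} = {}"
    using assms(2) length_le_sum_list by (force simp: partitions_of_def is_partition_def)
  then show ?thesis by (simp only: omega_shift_sum_expansion[OF assms(1)] sum.empty)
qed

text \<open>G prepends a column to H_\<nu> and the product of the z_i prepends one to P_\<nu>. The
  result is the part of the generating series of length n, hence the alternating sum, n degrees
  higher.\<close>

lemma column_operator_omega:
  assumes G: "linear_op G" "adds_column n H_t G" and x: "x \<in> generic_points n"
  shows "sscale (vdm n (point x) * (\<Prod>i<n. point x i)) (G (omega n (point x) j))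
    = omega_shift_sum n (point x) (j + n)"
proof -
  interpret G: Vector_Spaces.linear sscale sscale G by fact
  let ?P = "\<lambda>\<nu>. evl n (point x) (hall_littlewood_P \<nu>)"
  let ?V = "vdm n (point x)" and ?e = "\<Prod>i<n. point x i"
  have "G (omega n (point x) j) = (\<Sum>\<nu>\<in>partitions_of j. sscale (?P \<nu>) (G (H_t \<nu>)))"
    by (subst omega_expansion) (simp_all add: G.sum G.scale)
  also have "\<dots> = (\<Sum>\<nu> | \<nu> \<in> partitions_of j \<and> length \<nu> \<le> n. sscale (?P \<nu>) (G (H_t \<nu>)))"
    by (rule sum.mono_neutral_right)
      (auto, metis hall_littlewood_evl_zero not_le partitions_ofD(1))
  also have "\<dots> = (\<Sum>\<nu> | \<nu> \<in> partitions_of j \<and> length \<nu> \<le> n. sscale (?P \<nu>) (H_t (add_column n \<nu>)))"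
    by (rule sum.cong) (use G(2) in \<open>auto simp: adds_column_def partitions_of_def\<close>)
  finally have "sscale (?V * ?e) (G (omega n (point x) j))
      = (\<Sum>\<nu> | \<nu> \<in> partitions_of j \<and> length \<nu> \<le> n. sscale (?V * (?e * ?P \<nu>)) (H_t (add_column n \<nu>)))"
    by (simp add: symfun.scale_sum_right mult.assoc)
  also have "\<dots> = (\<Sum>\<nu> | \<nu> \<in> partitions_of j \<and> length \<nu> \<le> n. sscale (?V * ?P (add_column n \<nu>)) (H_t (add_column n \<nu>)))"
    by (rule sum.cong) (auto simp: hall_littlewood_multiply_column x partitions_of_def)
  also have "\<dots> = (\<Sum>\<nu> | \<nu> \<in> partitions_of (j + n) \<and> length \<nu> = n. sscale (?V * ?P \<nu>) (H_t \<nu>))"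
    by (rule sum.reindex_bij_betw[OF add_column_bij])
  also have "\<dots> = omega_shift_sum n (point x) (j + n)"
    by (rule omega_shift_sum_expansion[OF x, symmetric])
  finally show ?thesis .
qed

text \<open>Evaluate the q-analogue on Omega[XZ/(1-q)] in degree d with exactly n variables z, so
  that precisely the partitions of length at most n remain visible, and compare coefficients of
  P_\<nu>(z;q,t).\<close>

theorem q_analogue_adds_column:
  assumes G: "linear_op G" "adds_column n H_t G"
  shows "adds_column n H_qt (q_analogue G)"
  unfolding adds_column_def
proof (intro allI impI, elim conjE)
  fix \<mu> assume \<mu>: "is_partition \<mu>" "length \<mu> \<le> n"
  define d where "d = sum_list \<mu>"
  let ?L = "{\<nu>. \<nu> \<in> partitions_of d \<and> length \<nu> \<le> n}"
  let ?E = "\<lambda>\<nu>. q_analogue G (H_qt \<nu>) - H_qt (add_column n \<nu>)"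
  have main: "(\<Sum>\<nu>\<in>?L. sscale (evl n (point x) (macdonald_P \<nu>) / integral_norm \<nu>) (?E \<nu>)) = 0"
    if x: "x \<in> generic_points n" for x
  proof -
    let ?z = "point x"
    let ?P = "\<lambda>\<nu>. evl n ?z (macdonald_P \<nu>)" and ?\<kappa> = integral_norm
    let ?V = "vdm n ?z" and ?e = "\<Prod>i<n. ?z i" and ?a = "add_column n"
    have Ve: "?V * ?e \<noteq> 0"
      using vdm_nonzero[of ?z n] point_generic[OF x] by (simp add: prod_zero_iff)
    have zero: "omega_twist n ?z i * omega_shift_sum n ?z (d + n - i) = 0" if "i \<in> {0..d + n} - {0..d}" for i
    proof -
      have "d + n - i < n" using that by auto
      then show ?thesis by (simp add: omega_shift_sum_zero[OF x])
    qed
    have "sscale (?V * ?e) (q_analogue G (omega_q n ?z d))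
        = (\<Sum>i=0..d. omega_twist n ?z i * sscale (?V * ?e) (G (omega n ?z (d - i))))"
      unfolding q_analogue_omega_q[OF G(1)] symfun.scale_sum_right
      by (simp add: sscale_eq_sconst_mult mult_ac)
    also have "\<dots> = (\<Sum>i=0..d. omega_twist n ?z i * omega_shift_sum n ?z (d + n - i))"
      by (rule sum.cong) (simp_all add: column_operator_omega[OF G x])
    \<comment> \<open>Below degree n the alternating sum vanishes, so the convolution extends to all
      of degree d + n and can be multiplied out for each I.\<close>
    also have "\<dots> = (\<Sum>i=0..d + n. omega_twist n ?z i * omega_shift_sum n ?z (d + n - i))"
      by (rule sum.mono_neutral_left) (use zero in auto)
    also have "\<dots> = (\<Sum>I\<in>Pow {..<n}. sscale ((- 1) ^ card I * vdm n (shift tt I ?z))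
        (\<Sum>i=0..d + n. omega_twist n ?z i * omega n (shift 0 I ?z) (d + n - i)))"
      unfolding omega_shift_sum_def sum_distrib_left symfun.scale_sum_right
      by (subst sum.swap) (simp add: sscale_eq_sconst_mult mult_ac)
    also have "\<dots> = (\<Sum>I\<in>Pow {..<n}. sscale ((- 1) ^ card I * vdm n (shift tt I ?z))
        (omega_q n (shift qq I ?z) (d + n)))"
      by (rule sum.cong) (simp_all add: omega_twist_mult)
    also have "\<dots> = (\<Sum>I\<in>Pow {..<n}. \<Sum>\<nu>\<in>partitions_of (d + n).
        sscale ((- 1) ^ card I * vdm n (shift tt I ?z) * (evl n (shift qq I ?z) (macdonald_P \<nu>) / ?\<kappa> \<nu>)) (H_qt \<nu>))"
      unfolding omega_q_expansion symfun.scale_sum_right symfun.scale_scale ..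
    also have "\<dots> = (\<Sum>\<nu>\<in>partitions_of (d + n).
        sscale (shift_sum qq tt n (- 1) (\<lambda>y. evl n y (macdonald_P \<nu>)) ?z / ?\<kappa> \<nu>) (H_qt \<nu>))"
      by (subst sum.swap) (simp add: sum_sscale_left shift_sum_def sum_divide_distrib)
    also have "\<dots> = (\<Sum>\<nu>\<in>partitions_of (d + n).
        sscale (eigenvalue n (- 1) \<nu> * (?V * ?P \<nu>) / ?\<kappa> \<nu>) (H_qt \<nu>))"
      by (rule sum.cong) (auto simp: mac.eigen' x partitions_of_def)
    also have "\<dots> = (\<Sum>\<nu> | \<nu> \<in> partitions_of (d + n) \<and> length \<nu> = n.
        sscale (eigenvalue n (- 1) \<nu> * (?V * ?P \<nu>) / ?\<kappa> \<nu>) (H_qt \<nu>))"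
    proof (rule sum.mono_neutral_right[OF finite_partitions_of])
      show "\<forall>\<nu>\<in>partitions_of (d + n) - {\<nu>. \<nu> \<in> partitions_of (d + n) \<and> length \<nu> = n}.
          sscale (eigenvalue n (- 1) \<nu> * (?V * ?P \<nu>) / ?\<kappa> \<nu>) (H_qt \<nu>) = 0"
      proof
        fix \<nu> assume "\<nu> \<in> partitions_of (d + n) - {\<nu>. \<nu> \<in> partitions_of (d + n) \<and> length \<nu> = n}"
        then have "is_partition \<nu>" "length \<nu> < n \<or> n < length \<nu>" by (auto simp: partitions_of_def)
        then show "sscale (eigenvalue n (- 1) \<nu> * (?V * ?P \<nu>) / ?\<kappa> \<nu>) (H_qt \<nu>) = 0"
          using eigenvalue_minus_one[of \<nu> n] mac.evl_zero[of \<nu> n ?z] by auto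
      qed
    qed auto
    also have "\<dots> = (\<Sum>\<nu>\<in>?L. sscale (eigenvalue n (- 1) (?a \<nu>) * (?V * ?P (?a \<nu>)) / ?\<kappa> (?a \<nu>)) (H_qt (?a \<nu>)))"
      by (rule sum.reindex_bij_betw[OF add_column_bij, symmetric])
    also have "\<dots> = (\<Sum>\<nu>\<in>?L. sscale (?V * ?e) (sscale (?P \<nu> / ?\<kappa> \<nu>) (H_qt (?a \<nu>))))"
    proof (rule sum.cong[OF refl])
      fix \<nu> assume "\<nu> \<in> ?L"
      then have \<nu>: "is_partition \<nu>" "length \<nu> \<le> n" by (auto simp: partitions_of_def)
      \<comment> \<open>The eigenvalue produced by D(-1) is exactly the change of \<kappa> under the
        new column, so the two cancel.\<close>
      have "eigenvalue n (- 1) (?a \<nu>) * (?V * ?P (?a \<nu>)) / ?\<kappa> (?a \<nu>) = ?V * ?e * (?P \<nu> / ?\<kappa> \<nu>)"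
        unfolding integral_norm_add_column[OF \<nu>] mac.multiply_column[OF \<nu> x, symmetric]
        using eigenvalue_add_column_nonzero[of n \<nu>] by simp
      then show "sscale (eigenvalue n (- 1) (?a \<nu>) * (?V * ?P (?a \<nu>)) / ?\<kappa> (?a \<nu>)) (H_qt (?a \<nu>))
          = sscale (?V * ?e) (sscale (?P \<nu> / ?\<kappa> \<nu>) (H_qt (?a \<nu>)))"
        by (simp only: symfun.scale_scale)
    qed
    finally have "sscale (?V * ?e) (q_analogue G (omega_q n ?z d))
        = sscale (?V * ?e) (\<Sum>\<nu>\<in>?L. sscale (?P \<nu> / ?\<kappa> \<nu>) (H_qt (?a \<nu>)))"
      by (simp only: symfun.scale_sum_right)
    then have eq: "q_analogue G (omega_q n ?z d) = (\<Sum>\<nu>\<in>?L. sscale (?P \<nu> / ?\<kappa> \<nu>) (H_qt (?a \<nu>)))"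
      using Ve unfolding symfun.scale_cancel_left by blast
    have "q_analogue G (omega_q n ?z d) = (\<Sum>\<nu>\<in>partitions_of d. sscale (?P \<nu> / ?\<kappa> \<nu>) (q_analogue G (H_qt \<nu>)))"
      unfolding omega_q_expansion q_analogue_sum q_analogue_sscale ..
    also have "\<dots> = (\<Sum>\<nu>\<in>?L. sscale (?P \<nu> / ?\<kappa> \<nu>) (q_analogue G (H_qt \<nu>)))"
      by (rule sum.mono_neutral_right)
        (auto, metis mac.evl_zero not_le partitions_ofD(1))
    finally show ?thesis
      using eq by (simp add: symfun.scale_right_diff_distrib sum_subtractf)
  qed
  have "?E \<mu> = 0"
  proof (rule symfun_eqI)
    fix m
    \<comment> \<open>\<open>mac.independent\<close> concerns scalar coefficients, so it is applied
      to each monomial m of X separately.\<close>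
    have "scoeff (?E \<mu>) m / integral_norm \<mu> = 0"
    proof (rule mac.independent[where L = ?L and n = n and l = \<mu> and c = "\<lambda>\<nu>. scoeff (?E \<nu>) m / integral_norm \<nu>"])
      fix x assume "x \<in> generic_points n"
      from arg_cong[OF main[OF this], of "\<lambda>F. scoeff F m"]
      show "(\<Sum>\<nu>\<in>?L. scoeff (?E \<nu>) m / integral_norm \<nu> * evl n (point x) (macdonald_P \<nu>)) = 0"
        by (simp add: mult_ac)
    qed (use \<mu> in \<open>auto simp: d_def dest: partitions_ofD(1)\<close>, simp add: partitions_of_def)
    then show "scoeff (?E \<mu>) m = scoeff 0 m" using integral_norm_nonzero[OF \<mu>(1)] by simp
  qed
  then show "q_analogue G (H_qt \<mu>) = H_qt (add_column n \<mu>)" by simp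
qed

lemma H_qt_Nil: "H_qt [] = 1"
proof -
  have "over_one_minus_t (power_sums []) = 1"
    unfolding over_one_minus_t_def
    by (subst sconst_hom.plethysm_power_sums) (simp_all add: is_partition_def)
  then show ?thesis by (simp add: H_qt_def macdonald_J_def hook_poly_def cells_def)
qed

lemma conj_partition_add_column:
  assumes "length \<nu> \<le> n" "n > 0"
  shows "conj_partition (add_column n \<nu>) = n # conj_partition \<nu>"
proof -
  have "conj_partition (add_column n \<nu>) = map (col_length (add_column n \<nu>)) [0..<Suc (nth_part \<nu> 0)]"
    using assms(2) by (simp add: conj_partition_def nth_part_add_column)
  also have "\<dots> = col_length (add_column n \<nu>) 0 # map (\<lambda>j. col_length (add_column n \<nu>) (Suc j)) [0..<nth_part \<nu> 0]"
    unfolding map_upt_Suc by simp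
  finally show ?thesis
    using assms(1) by (simp add: col_length_add_column conj_partition_def)
qed

theorem theoremI1:
  shows
    "(\<forall>k G. linear_op G \<and> q_free_op G \<and> adds_column k H_t G
        \<longrightarrow> adds_column k H_qt (q_analogue G))
     \<and>
     (\<forall>G :: nat \<Rightarrow> qt symfun \<Rightarrow> qt symfun.
        (\<forall>k\<ge>1. linear_op (G k) \<and> q_free_op (G k) \<and> adds_column k H_t (G k))
        \<longrightarrow> (\<forall>\<mu>. is_partition \<mu> \<longrightarrow>
               H_qt \<mu> = foldr (\<lambda>k. q_analogue (G k)) (conj_partition \<mu>) 1))"
proof (intro conjI allI impI)
  fix k G assume "linear_op G \<and> q_free_op G \<and> adds_column k H_t G"
  then show "adds_column k H_qt (q_analogue G)" by (intro q_analogue_adds_column) auto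
next
  fix G :: "nat \<Rightarrow> qt symfun \<Rightarrow> qt symfun" and \<mu>
  assume G: "\<forall>k\<ge>1. linear_op (G k) \<and> q_free_op (G k) \<and> adds_column k H_t (G k)"
  assume "is_partition \<mu>"
  then show "H_qt \<mu> = foldr (\<lambda>k. q_analogue (G k)) (conj_partition \<mu>) 1"
  \<comment> \<open>The conjugate partition lists the column heights from left to right, so
    stripping the first column strips the outermost operator.\<close>
  proof (induction rule: partition_column_induct)
    case Nil
    then show ?case by (simp add: H_qt_Nil conj_partition_def nth_part_def)
  next
    case (column n \<nu>)
    have "adds_column n H_qt (q_analogue (G n))"
      using G column(3) by (intro q_analogue_adds_column) auto
    then have "H_qt (add_column n \<nu>) = q_analogue (G n) (H_qt \<nu>)"
      using column(1,2) by (simp add: adds_column_def)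
    then show ?case
      using column by (simp add: conj_partition_add_column)
  qed
qed

end
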